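(* Let $n\ge 1$ and let $B\subseteq[n]\times[n]$ be a board. Then for every integer $i$ with $0\le i\le n$, the function $H_i(B,x+1)$ of $x$ is polynomial modulo $x^2$, and its coefficient of $x$ is a non-negative integer. Explicitly: there is a unique integer $C_i(B)$ such that $$H_i(B,q)\equiv C_i(B)\,(q-1)+h_i(B)\pmod{(q-1)^2}\qquad\text{for all prime powers } q,$$ and $C_i(B)\ge 0$.
   Context: Notation: $[n]=\{1,\dots,n\}$. A board is a subset $B\subseteq[m]\times[n]$ (here $m=n$). The hit number $h_i(B)$ is the number of ways to place $m$ non-attacking rooks on $[m]\times[n]$ (i.e. $m$ cells, no two in the same row or column) with exactly $i$ of them in $B$ (for $m\le n$). For a prime power $q>1$, $\mathfrak m_i(B,q)$ is the number of $m\times n$ matrices over $\mathbb F_q$ of rank $i$ whose support (set of positions of nonzero entries) is contained in $B$. The $q$-rook number is $M_i(B,q)=\mathfrak m_i(B,q)/(q-1)^i$ (known to be an integer). Put $[k]_q=1+q+\cdots+q^{k-1}$, $[k]!_q=[k]_q[k-1]_q\cdots[1]_q$, and $(t;q)_k=\prod_{j=0}^{k-1}(1-tq^j)$. For $B\subseteq[m]\times[n]$ with $m\le n$, the $q$-hit numbers $H_i(B,q)$ are defined by the identity of polynomials in $t$ $$\sum_{i=0}^{m}H_i(B,q)t^i=q^{\binom m2}\sum_{i=0}^{m}M_i(B,q)\frac{[n-i]!_q}{[n-m]!_q}(-1)^i(t;q^{-1})_i .$$ They are integers for each prime power $q$. A function $f:S\to\mathbb Q$ on an unbounded set $S\subseteq\mathbb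 Z$ is polynomial modulo $x^k$ if there is a (necessarily unique) $P\in\mathbb Z[x]$ of degree at most $k-1$ with $P(x)\equiv f(x)\pmod{x^k}$ for all $x\in S$; the coefficients of $f$ are then those of $P$. Here $S=\{q-1: q \text{ a prime power}\}$. *)

theory Defs
  imports
    "Jordan_Normal_Form.Missing_VectorSpace"
    "HOL-Computational_Algebra.Polynomial"
    "HOL-Number_Theory.Prime_Powers"
begin

definition cells :: "nat \<Rightarrow> nat \<Rightarrow> (nat \<times> nat) set" where
  "cells m n = {1..m} \<times> {1..n}"

definition non_attacking :: "(nat \<times> nat) set \<Rightarrow> bool" where
  "non_attacking R \<longleftrightarrow>
     (\<forall>c\<in>R. \<forall>d\<in>R. c \<noteq> d \<longrightarrow> fst c \<noteq> fst d \<and> snd c \<noteq> snd d)"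

definition hit_number :: "nat \<Rightarrow> nat \<Rightarrow> (nat \<times> nat) set \<Rightarrow> nat \<Rightarrow> nat" where
  "hit_number m n B i =
     card {R. R \<subseteq> cells m n \<and> card R = m \<and> non_attacking R \<and> card (R \<inter> B) = i}"

text \<open>The order of the field varies inside the statements, so the field with \<open>q\<close> elements is a
  carrier-based structure, chosen on a set of natural numbers; it is determined up to isomorphism
  when \<open>q\<close> is a prime power, and unspecified otherwise.\<close>

definition GF :: "nat \<Rightarrow> nat ring" where
  "GF q = (SOME F. field F \<and> finite (carrier F) \<and> card (carrier F) = q)"

text \<open>An \<open>m \<times> n\<close> matrix over \<open>F\<close> is an element of \<open>cells m n \<rightarrow>\<^sub>E carrier F\<close>; its rank is the
  dimension of the span of its columns in the space of functions on \<open>{1..m}\<close>.\<close>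

definition mat_cols :: "nat \<Rightarrow> nat \<Rightarrow> (nat \<times> nat \<Rightarrow> 'a) \<Rightarrow> (nat \<Rightarrow> 'a) set" where
  "mat_cols m n A = (\<lambda>j. \<lambda>i\<in>{1..m}. A (i, j)) ` {1..n}"

definition mat_rank :: "'a ring \<Rightarrow> nat \<Rightarrow> nat \<Rightarrow> (nat \<times> nat \<Rightarrow> 'a) \<Rightarrow> nat" where
  "mat_rank F m n A =
     vectorspace.dim F (module.span_vs F (ring.func_space F {1..m}) (mat_cols m n A))"

definition mat_support :: "'a ring \<Rightarrow> nat \<Rightarrow> nat \<Rightarrow> (nat \<times> nat \<Rightarrow> 'a) \<Rightarrow> (nat \<times> nat) set" where
  "mat_support F m n A = {c \<in> cells m n. A c \<noteq> \<zero>\<^bsub>F\<^esub>}"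

definition rank_count :: "nat \<Rightarrow> nat \<Rightarrow> (nat \<times> nat) set \<Rightarrow> nat \<Rightarrow> nat \<Rightarrow> nat" where
  "rank_count m n B i q =
     card {A \<in> cells m n \<rightarrow>\<^sub>E carrier (GF q).
             mat_rank (GF q) m n A = i \<and> mat_support (GF q) m n A \<subseteq> B}"

definition q_rook :: "nat \<Rightarrow> nat \<Rightarrow> (nat \<times> nat) set \<Rightarrow> nat \<Rightarrow> nat \<Rightarrow> rat" where
  "q_rook m n B i q = of_nat (rank_count m n B i q) / (of_nat q - 1) ^ i"

definition q_int :: "'a::comm_semiring_1 \<Rightarrow> nat \<Rightarrow> 'a" where
  "q_int q k = (\<Sum>j<k. q ^ j)"

definition q_fact :: "'a::comm_semiring_1 \<Rightarrow> nat \<Rightarrow> 'a" where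
  "q_fact q k = (\<Prod>j=1..k. q_int q j)"

definition q_pochhammer :: "'a::comm_ring_1 \<Rightarrow> 'a \<Rightarrow> nat \<Rightarrow> 'a" where
  "q_pochhammer t q k = (\<Prod>j<k. 1 - t * q ^ j)"

text \<open>The variable \<open>t\<close> is \<open>[:0, 1:]\<close>, and \<open>1 / q\<close> enters as a constant polynomial.\<close>

definition q_hit_poly :: "nat \<Rightarrow> nat \<Rightarrow> (nat \<times> nat) set \<Rightarrow> nat \<Rightarrow> rat poly" where
  "q_hit_poly m n B q =
     smult (of_nat q ^ (m choose 2))
       (\<Sum>i\<le>m. smult (q_rook m n B i q * (q_fact (of_nat q) (n - i) / q_fact (of_nat q) (n - m)) * (-1) ^ i)
                  (q_pochhammer [:0, 1:] [:1 / of_nat q:] i))"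

definition q_hit :: "nat \<Rightarrow> nat \<Rightarrow> (nat \<times> nat) set \<Rightarrow> nat \<Rightarrow> nat \<Rightarrow> rat" where
  "q_hit m n B i q = coeff (q_hit_poly m n B q) i"

text \<open>Congruence modulo an integer: the difference is an integer multiple of the modulus.\<close>

definition rat_cong :: "rat \<Rightarrow> rat \<Rightarrow> int \<Rightarrow> bool" where
  "rat_cong a b d \<longleftrightarrow> (\<exists>k::int. a - b = of_int (k * d))"

definition represents_modulo :: "int set \<Rightarrow> nat \<Rightarrow> (int \<Rightarrow> rat) \<Rightarrow> int poly \<Rightarrow> bool" where
  "represents_modulo S k f P \<longleftrightarrow>
     degree P \<le> k - 1 \<and> (\<forall>x\<in>S. rat_cong (of_int (poly P x)) (f x) (x ^ k))"

definition polynomial_modulo :: "int set \<Rightarrow> nat \<Rightarrow> (int \<Rightarrow> rat) \<Rightarrow> bool" where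
  "polynomial_modulo S k f \<longleftrightarrow> (\<exists>P. represents_modulo S k f P)"

text \<open>Meaningful for unbounded \<open>S\<close>, where the representing polynomial is unique.\<close>

definition modulo_coeff :: "int set \<Rightarrow> nat \<Rightarrow> (int \<Rightarrow> rat) \<Rightarrow> nat \<Rightarrow> int" where
  "modulo_coeff S k f j = coeff (THE P. represents_modulo S k f P) j"

definition shifted_primepows :: "int set" where
  "shifted_primepows = {int q - 1 |q. primepow q}"

end

theory Submission
  imports "HOL-Algebra.Algebraic_Closure" "HOL-Number_Theory.Residues" Defs
begin

text \<open>
  Put \<open>z = q - 1\<close>. Scaling rows and columns shows that, modulo \<open>z\<^sup>2\<close>, the number \<open>M\<^sub>i(B, q)\<close> only sees the
  matrices of rank \<open>i\<close> whose support is a placement of rooks, or such a placement in which one part is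
  replaced by two cells in a line or by at least three cells of a two by two block. The counting is done by
  adding one row at a time, a matrix being measured by the cardinality of its kernel. A new row with
  support \<open>S\<close> contributes a multiple of \<open>z ^ |S|\<close>; a row with one nonzero entry deletes a column, and a
  row with two nonzero entries adds one column to another.

  Expanding the definition of the \<open>q\<close>-hit polynomial to first order in \<open>z\<close> and double counting, the
  coefficient of \<open>z\<close> becomes a sum over all two by two blocks of the hit polynomial of the complementary
  board times a local factor. With \<open>k\<close> cells of \<open>B\<close> in the block, this factor is
  \<open>3\<close>, \<open>2 + t\<close>, \<open>2 t + t\<^sup>2\<close>, \<open>3 t\<^sup>2\<close> for \<open>k = 0, 1, 3, 4\<close>, and for \<open>k = 2\<close> it is \<open>3 t\<close> or \<open>2 + t\<close> according to
  whether the two cells attack each other. All these factors have nonnegative coefficients.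
\<close>

section \<open>Finite fields of prime power order\<close>

text \<open>\<open>GF q\<close> is chosen by \<open>SOME\<close>, so nothing is known about it
  before a field with \<open>q\<close> elements on the natural numbers has been exhibited; hence the
  detour through an algebraic closure of the integers modulo \<open>p\<close>. Rank as the dimension
  of a column span is hard to follow when a matrix is changed. The equation
  \<open>card kernel * q ^ i = q ^ card J\<close> says the same, involves no division and makes
  sense for all finite index sets; rank-nullity is used once, to connect the two. As
  \<open>M_i\<close> is a quotient by \<open>z ^ i\<close>, counts of rank \<open>i\<close> are
  needed modulo \<open>z ^ (i + 2)\<close>. A row with two entries leads to a board on which two
  columns are united, so the induction over rows must treat all boards at once, and the correction
  polynomial has to satisfy a recursion that includes united columns. Every term of the linear
  coefficient becomes a sum over blocks by completion: double counting supplies the missing rows and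
  columns, and the factorials in the map from rook to hit polynomials absorb the numerical factors
  that arise.\<close>

lemma (in cring) binomial_theorem:
  assumes x: "x \<in> carrier R" and y: "y \<in> carrier R"
  shows "(x \<oplus> y) [^] (n::nat) = (\<Oplus>k\<in>{..n}. [(n choose k)] \<cdot> (x [^] k \<otimes> y [^] (n - k)))"
proof (induction n)
  case 0
  then show ?case by simp
next
  case (Suc n)
  let ?f = "\<lambda>k. [(n choose k)] \<cdot> (x [^] k \<otimes> y [^] (n - k))"
  let ?g = "\<lambda>k. [(n choose k)] \<cdot> (x [^] Suc k \<otimes> y [^] (n - k))"
  let ?h = "\<lambda>k. [(n choose k)] \<cdot> (x [^] k \<otimes> y [^] (Suc n - k))"
  have gh: "?g k \<in> carrier R" "?h k \<in> carrier R" "?f k \<in> carrier R" for k using x y by auto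
  have "(x \<oplus> y) [^] Suc n = (\<Oplus>k\<in>{..n}. ?f k) \<otimes> x \<oplus> (\<Oplus>k\<in>{..n}. ?f k) \<otimes> y"
    using x y Suc.IH by (simp add: r_distr)
  also have "(\<Oplus>k\<in>{..n}. ?f k) \<otimes> x = (\<Oplus>k\<in>{..n}. ?g k)"
    using x y by (subst finsum_ldistr) (auto simp: add_pow_ldistr add_pow_rdistr m_ac intro!: add.finprod_cong)
  also have "(\<Oplus>k\<in>{..n}. ?f k) \<otimes> y = (\<Oplus>k\<in>{..n}. ?h k)"
    using x y by (subst finsum_ldistr)
      (auto simp: add_pow_ldistr add_pow_rdistr m_ac Suc_diff_le intro!: add.finprod_cong)
  \<comment> \<open>The extra term at \<open>Suc n\<close> has the coefficient
    \<open>n choose Suc n\<close>, which is 0. With it present, \<open>k = 0\<close> can be split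
    off and the rest shifted to meet the other sum under Pascal's rule.\<close>
  also have "\<dots> = (\<Oplus>k\<in>{..Suc n}. ?h k)"
    using gh x y by (subst finsum_Suc) (auto simp: binomial_eq_0)
  also have "\<dots> = (\<Oplus>k\<in>{..n}. ?h (Suc k)) \<oplus> ?h 0"
    using gh by (subst finsum_Suc2) auto
  also have "(\<Oplus>k\<in>{..n}. ?g k) \<oplus> ((\<Oplus>k\<in>{..n}. ?h (Suc k)) \<oplus> ?h 0)
      = (\<Oplus>k\<in>{..n}. ?g k \<oplus> ?h (Suc k)) \<oplus> ?h 0"
    using x y by (subst finsum_addf) (auto simp: a_assoc simp del: nat_pow_Suc)
  also have "(\<Oplus>k\<in>{..n}. ?g k \<oplus> ?h (Suc k))
      = (\<Oplus>k\<in>{..n}. [(Suc n choose Suc k)] \<cdot> (x [^] Suc k \<otimes> y [^] (n - k)))"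
    using x y by (intro add.finprod_cong) (auto simp: add.nat_pow_mult simp del: nat_pow_Suc)
  also have "\<dots> \<oplus> ?h 0 = (\<Oplus>k\<in>{..Suc n}. [(Suc n choose k)] \<cdot> (x [^] k \<otimes> y [^] (Suc n - k)))"
    using x y by (subst finsum_Suc2) auto
  finally show ?case .
qed

text \<open>\<open>p\<close> divides the inner binomial coefficients \<open>p choose k\<close>, so
  only the two end terms of the expansion survive; the exponent \<open>p ^ k\<close> follows by
  iteration. The characteristic enters as an equation about \<open>\<one>\<close>, a form that is
  easily transported along embeddings.\<close>

lemma (in cring) frobenius_add:
  assumes p: "Factorial_Ring.prime (p::nat)" and char: "[p] \<cdot> \<one> = \<zero>"
    and x: "x \<in> carrier R" and y: "y \<in> carrier R"
  shows "(x \<oplus> y) [^] (p ^ k) = x [^] (p ^ k) \<oplus> y [^] (p ^ k)"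
proof -
  have zero: "[m] \<cdot> z = \<zero>" if "p dvd m" "z \<in> carrier R" for m z
  proof -
    from that obtain l where l: "m = p * l" by blast
    have "[m] \<cdot> z = [l] \<cdot> ([p] \<cdot> (\<one> \<otimes> z))" using that l by (simp add: add.nat_pow_pow)
    also have "[p] \<cdot> (\<one> \<otimes> z) = [p] \<cdot> \<one> \<otimes> z" using that by (subst add_pow_ldistr) auto
    finally show ?thesis using char that by simp
  qed
  have step: "(u \<oplus> v) [^] p = u [^] p \<oplus> v [^] p" if u: "u \<in> carrier R" and v: "v \<in> carrier R" for u v
  proof -
    let ?f = "\<lambda>k. [(p choose k)] \<cdot> (u [^] k \<otimes> v [^] (p - k))"
    have "(u \<oplus> v) [^] p = (\<Oplus>k\<in>{..p}. ?f k)" by (rule binomial_theorem[OF u v])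
    also have "\<dots> = (\<Oplus>k\<in>{0, p}. ?f k)"
    proof (rule add.finprod_mono_neutral_cong_right)
      show "\<And>k. k \<in> {..p} - {0, p} \<Longrightarrow> ?f k = \<zero>"
        using u v p by (intro zero dvd_choose_prime) auto
    qed (use u v in auto)
    also have "\<dots> = v [^] p \<oplus> u [^] p"
      using u v prime_gt_0_nat[OF p] by simp
    finally show ?thesis using u v by (simp add: a_comm)
  qed
  show ?thesis
  proof (induction k)
    case 0
    then show ?case using x y by simp
  next
    case (Suc k)
    have "(x \<oplus> y) [^] (p ^ Suc k) = ((x \<oplus> y) [^] (p ^ k)) [^] p"
      using x y by (simp add: nat_pow_pow mult.commute)
    also have "\<dots> = x [^] (p ^ Suc k) \<oplus> y [^] (p ^ Suc k)"
      using x y Suc.IH by (simp add: step nat_pow_pow mult.commute)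
    finally show ?case .
  qed
qed

text \<open>Additivity applied to \<open>\<ominus> x\<close> and \<open>x\<close> treats odd and
  even \<open>p\<close> alike.\<close>

lemma (in cring) frobenius_minus:
  assumes p: "Factorial_Ring.prime (p::nat)" and char: "[p] \<cdot> \<one> = \<zero>" and x: "x \<in> carrier R"
  shows "(\<ominus> x) [^] (p ^ k) = \<ominus> (x [^] (p ^ k))"
proof -
  have "(\<ominus> x) [^] (p ^ k) \<oplus> x [^] (p ^ k) = (\<ominus> x \<oplus> x) [^] (p ^ k)"
    using frobenius_add[OF p char, of "\<ominus> x" x k] x by simp
  also have "\<dots> = \<zero>" using x p by (simp add: l_neg nat_pow_zero prime_gt_0_nat)
  finally show ?thesis using x by (simp add: minus_equality)
qed

text \<open>These are the roots of \<open>P = X ^ q - X\<close> with \<open>q = p ^ k\<close>. Over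
  an algebraically closed field \<open>P\<close> has \<open>q\<close> roots with multiplicity, and
  it remains to see that all are simple. This is done without derivatives: at a root
  \<open>a\<close>, with \<open>A = X - a\<close>, the Frobenius map gives
  \<open>A ^ q = X ^ q - a\<close>, hence \<open>P = A ^ q - A = A (A ^ (q - 1) - 1)\<close>, and
  the second factor has the value \<open>-1\<close> at \<open>a\<close>.\<close>

lemma (in algebraically_closed) card_frobenius_fixed_points:
  assumes p: "Factorial_Ring.prime (p::nat)" and char: "[p] \<cdot> \<one> = \<zero>" and k: "k > 0"
  shows "finite {a \<in> carrier L. a [^] (p ^ k) = a}" (is "finite ?S")
    and "card {a \<in> carrier L. a [^] (p ^ k) = a} = p ^ k"
proof -
  define q where "q = p ^ k"
  have q2: "q \<ge> 2"
    using k prime_ge_2_nat[OF p] self_le_power[of p k] unfolding q_def by linarith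
  let ?U = "poly_ring L"
  note sub = carrier_is_subring
  interpret UP: domain ?U by (rule univ_poly_is_domain[OF sub])
  interpret emb: ring_hom_ring L ?U poly_of_const
    using canonical_embedding_ring_hom[OF sub] by simp
  have "[n] \<cdot>\<^bsub>?U\<^esub> \<one>\<^bsub>?U\<^esub> = poly_of_const ([n] \<cdot> \<one>)" for n :: nat
    by (induction n) auto
  with char have Uchar: "[p] \<cdot>\<^bsub>?U\<^esub> \<one>\<^bsub>?U\<^esub> = \<zero>\<^bsub>?U\<^esub>" by simp
  have X: "X \<in> carrier ?U" by (rule var_closed[OF sub])
  define P where "P = X [^]\<^bsub>?U\<^esub> q \<ominus>\<^bsub>?U\<^esub> X"
  have P: "P \<in> carrier ?U" using X unfolding P_def by simp
  have Xq: "X [^]\<^bsub>?U\<^esub> q = monom \<one> q" using unitary_monom_eq_var_pow[OF sub] by simp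
  have degP: "length P - 1 = q"
  proof -
    have "length P - 1 = max (length (X [^]\<^bsub>?U\<^esub> q) - 1) (length (\<ominus>\<^bsub>?U\<^esub> X) - 1)"
      unfolding P_def a_minus_def univ_poly_add
    proof (rule poly_add_degree_eq[OF sub])
      show "length (X [^]\<^bsub>?U\<^esub> q) - 1 \<noteq> length (\<ominus>\<^bsub>?U\<^esub> X) - 1"
        using q2 unfolding Xq univ_poly_a_inv_degree[OF sub X] by (simp add: monom_def var_def)
    qed (use X in \<open>auto simp: univ_poly_carrier\<close>)
    also have "\<dots> = q"
      using q2 unfolding Xq univ_poly_a_inv_degree[OF sub X] by (simp add: monom_def var_def)
    finally show ?thesis .
  qed
  then have P0: "P \<noteq> []" using q2 by auto
  have evP: "eval P a = a [^] q \<ominus> a" if a: "a \<in> carrier L" for a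
  proof -
    interpret ev: ring_hom_ring ?U L "\<lambda>p. eval p a" by (rule eval_ring_hom[OF sub a])
    have "eval X a = a" by (rule eval_var[OF a])
    then show ?thesis using X a by (simp add: P_def a_minus_def ev.hom_nat_pow)
  qed
  have root: "is_root P a \<longleftrightarrow> a \<in> carrier L \<and> a [^] q = a" for a
    unfolding is_root_def using P0 evP[of a] by (metis nat_pow_closed r_right_minus_eq)
  have count: "count (roots P) a = 1" if "is_root P a" for a
  proof -
    from that root have a: "a \<in> carrier L" and aq: "a [^] q = a" by auto
    interpret ev: ring_hom_ring ?U L "\<lambda>p. eval p a" by (rule eval_ring_hom[OF sub a])
    let ?c = "poly_of_const (\<ominus> a)"
    have c: "?c \<in> carrier ?U" using a by simp
    have A_eq: "[\<one>, \<ominus> a] = X \<oplus>\<^bsub>?U\<^esub> ?c"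
      using a unfolding univ_poly_add var_def poly_of_const_def by (auto simp: minus_equality)
    let ?A = "[\<one>, \<ominus> a]"
    have A: "?A \<in> carrier ?U" unfolding A_eq using X c by simp
    have "(\<ominus> a) [^] q = \<ominus> a" using frobenius_minus[OF p char a, of k] aq by (simp add: q_def)
    then have cq: "?c [^]\<^bsub>?U\<^esub> q = ?c" using a by (metis a_inv_closed emb.hom_nat_pow)
    have "?A [^]\<^bsub>?U\<^esub> q = X [^]\<^bsub>?U\<^esub> q \<oplus>\<^bsub>?U\<^esub> ?c"
      unfolding A_eq using UP.frobenius_add[OF p Uchar X c, of k] cq by (simp add: q_def)
    moreover have cancel: "(u \<oplus>\<^bsub>?U\<^esub> w) \<ominus>\<^bsub>?U\<^esub> (v \<oplus>\<^bsub>?U\<^esub> w) = u \<ominus>\<^bsub>?U\<^esub> v"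
      if "u \<in> carrier ?U" "v \<in> carrier ?U" "w \<in> carrier ?U" for u v w
    proof -
      have "(u \<oplus>\<^bsub>?U\<^esub> w) \<ominus>\<^bsub>?U\<^esub> (v \<oplus>\<^bsub>?U\<^esub> w) = u \<oplus>\<^bsub>?U\<^esub> (w \<oplus>\<^bsub>?U\<^esub> (\<ominus>\<^bsub>?U\<^esub> w \<oplus>\<^bsub>?U\<^esub> \<ominus>\<^bsub>?U\<^esub> v))"
        using that UP.a_comm[of "\<ominus>\<^bsub>?U\<^esub> v" "\<ominus>\<^bsub>?U\<^esub> w"]
        by (simp add: a_minus_def UP.minus_add UP.a_assoc)
      then show ?thesis using that by (simp add: a_minus_def UP.r_neg2)
    qed
    ultimately have P_eq: "P = ?A [^]\<^bsub>?U\<^esub> q \<ominus>\<^bsub>?U\<^esub> ?A"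
      unfolding P_def A_eq using X c cancel[of "X [^]\<^bsub>?U\<^esub> q" X ?c] by (simp add: A_eq)
    define G where "G = ?A [^]\<^bsub>?U\<^esub> (q - 1) \<ominus>\<^bsub>?U\<^esub> \<one>\<^bsub>?U\<^esub>"
    have G: "G \<in> carrier ?U" using A by (simp add: G_def)
    have "?A [^]\<^bsub>?U\<^esub> q = ?A \<otimes>\<^bsub>?U\<^esub> ?A [^]\<^bsub>?U\<^esub> (q - 1)"
      using q2 A UP.nat_pow_Suc2[of ?A "q - 1"] by simp
    then have PG: "P = ?A \<otimes>\<^bsub>?U\<^esub> G"
      unfolding P_eq G_def a_minus_def using A by (simp add: UP.r_distr UP.r_minus)
    have "eval ?A a = \<zero>" using a by (simp add: r_neg)
    then have "eval G a = \<ominus> \<one>"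
      unfolding G_def a_minus_def using A q2 by (simp add: ev.hom_nat_pow nat_pow_zero)
    then have Ga: "eval G a \<noteq> \<zero>"
      by (metis one_closed one_not_zero add.inv_eq_1_iff)
    then have G0: "G \<noteq> []" by auto
    have "a \<notin># roots G" using Ga roots_mem_iff_is_root[OF G] unfolding is_root_def by simp
    then show ?thesis
      unfolding PG poly_mult_degree_one_monic_imp_same_roots[OF a G G0]
      by (simp add: not_in_iff)
  qed
  have S_eq: "?S = set_mset (roots P)"
    using roots_mem_iff_is_root[OF P] root by (auto simp: q_def)
  show "finite ?S" unfolding S_eq by simp
  have "card ?S = (\<Sum>a\<in>set_mset (roots P). count (roots P) a)"
    unfolding S_eq using count roots_mem_iff_is_root[OF P] by simp
  also have "\<dots> = size (roots P)" by (simp add: size_multiset_overloaded_eq)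
  also have "\<dots> = q" using roots_over_carrier[OF P] degP unfolding splitted_def by simp
  finally show "card ?S = p ^ k" by (simp add: q_def)
qed

text \<open>The Frobenius map respects sums, negatives, products and inverses, so its fixed points
  are closed under all field operations.\<close>

lemma (in algebraically_closed) frobenius_fixed_points_field:
  assumes p: "Factorial_Ring.prime (p::nat)" and char: "[p] \<cdot> \<one> = \<zero>"
  shows "field (L \<lparr>carrier := {a \<in> carrier L. a [^] (p ^ k) = a}\<rparr>)"
proof (rule subfield_iff(2), rule subfieldI')
  show "subring {a \<in> carrier L. a [^] (p ^ k) = a} L"
    by (rule subringI) (auto simp: frobenius_add[OF p char] frobenius_minus[OF p char] nat_pow_distrib)
next
  fix a assume "a \<in> {a \<in> carrier L. a [^] (p ^ k) = a} - {\<zero>}"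
  then have a: "a \<in> Units L" "a [^] (p ^ k) = a" by (auto simp: field_Units)
  have "a [^] (p ^ k) \<otimes> inv a [^] (p ^ k) = \<one>"
    using a(1) by (simp add: nat_pow_distrib[symmetric] Units_closed)
  then have "inv a [^] (p ^ k) = inv (a [^] (p ^ k))"
    using a(1) by (intro comm_inv_char[symmetric]) (auto simp: Units_closed)
  with a show "inv a \<in> {a \<in> carrier L. a [^] (p ^ k) = a}" by simp
qed

text \<open>\<open>GF\<close> ranges over structures on natural numbers only, so a field found
  inside an algebraic closure has to be copied along an enumeration of its carrier.\<close>

lemma field_nat_transfer:
  assumes "field F" and "finite (carrier F)"
  shows "\<exists>F' :: nat ring. field F' \<and> finite (carrier F') \<and> card (carrier F') = card (carrier F)"
proof -
  interpret field F by fact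
  obtain h where h: "bij_betw h (carrier F) {..<card (carrier F)}"
    using ex_bij_betw_finite_nat[OF assms(2)] by (auto simp: atLeast0LessThan)
  define g where "g = inv_into (carrier F) h"
  have gh: "g (h x) = x" if "x \<in> carrier F" for x
    using that h unfolding g_def by (meson bij_betw_inv_into_left)
  define S :: "nat ring" where "S = \<lparr>carrier = {..<card (carrier F)},
    monoid.mult = (\<lambda>x y. h (g x \<otimes>\<^bsub>F\<^esub> g y)), one = h \<one>\<^bsub>F\<^esub>, zero = h \<zero>\<^bsub>F\<^esub>, add = (\<lambda>x y. h (g x \<oplus>\<^bsub>F\<^esub> g y))\<rparr>"
  have "h \<in> ring_iso F S"
    using h by (intro ring_iso_memI) (auto simp: S_def gh bij_betwE lessThan_iff dest: bij_betwE)
  from ring_iso_imp_img_field[OF this] have "field S" by (simp add: S_def)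
  then show ?thesis by (intro exI[of _ S]) (simp add: S_def)
qed

lemma GF_field:
  assumes "primepow q"
  shows "field (GF q)" "finite (carrier (GF q))" "card (carrier (GF q)) = q"
proof -
  obtain p k where pk: "Factorial_Ring.prime p" "k > 0" "q = p ^ k"
    using assms unfolding primepow_def by auto
  interpret Zp: residues_prime p "residue_ring (int p)" by unfold_locales (use pk in auto)
  interpret cl: algebraic_closure Zp.alg_closure "Zp.indexed_const ` carrier (residue_ring (int p))"
    by (rule Zp.alg_closureE)
  interpret hom: ring_hom_ring "residue_ring (int p)" Zp.alg_closure Zp.indexed_const
    using ring_hom_ringI2[OF Zp.ring_axioms cl.ring_axioms Zp.alg_closureE(2)] .
  \<comment> \<open>Multiples of one in the closure are images of residues, so \<open>p\<close>
    times one is the image of zero.\<close>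
  have "[n] \<cdot>\<^bsub>Zp.alg_closure\<^esub> \<one>\<^bsub>Zp.alg_closure\<^esub> = Zp.indexed_const (int n mod int p)" for n :: nat
  proof (induction n)
    case 0
    then show ?case using hom.hom_zero by (simp add: Zp.res_zero_eq)
  next
    case (Suc n)
    have "Zp.indexed_const (int n mod int p) \<oplus>\<^bsub>Zp.alg_closure\<^esub> Zp.indexed_const (1 mod int p)
        = Zp.indexed_const (int (Suc n) mod int p)"
      by (subst hom.hom_add[symmetric]) (auto simp: Zp.add_cong algebra_simps)
    with Suc show ?case using hom.hom_one by (simp add: Zp.one_cong)
  qed
  from this[of p] have char: "[p] \<cdot>\<^bsub>Zp.alg_closure\<^esub> \<one>\<^bsub>Zp.alg_closure\<^esub> = \<zero>\<^bsub>Zp.alg_closure\<^esub>"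
    using hom.hom_zero by (simp add: Zp.res_zero_eq)
  have "\<exists>F :: nat ring. field F \<and> finite (carrier F) \<and> card (carrier F) = q"
    using field_nat_transfer[OF cl.frobenius_fixed_points_field[OF pk(1) char, of k]]
      cl.card_frobenius_fixed_points[OF pk(1) char pk(2)] pk(3) by auto
  then have "field (GF q) \<and> finite (carrier (GF q)) \<and> card (carrier (GF q)) = q"
    unfolding GF_def by (intro someI_ex[of "\<lambda>F. field F \<and> finite (carrier F) \<and> card (carrier F) = q"]) auto
  then show "field (GF q)" "finite (carrier (GF q))" "card (carrier (GF q)) = q" by auto
qed

section \<open>Rank and the cardinality of the kernel\<close>

lemma (in vectorspace) card_carrier_eq_power_dim:
  assumes "finite (carrier V)"
  shows "card (carrier V) = card (carrier K) ^ dim"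
proof -
  \<comment> \<open>A finite carrier generates itself, which gives the finite dimension required for
    the existence of a basis.\<close>
  have "span (carrier V) = carrier V"
    using in_own_span[of "carrier V"] span_is_subset2[of "carrier V"] by auto
  then have "fin_dim" using assms unfolding fin_dim_def by blast
  then obtain b where b: "finite b" "basis b" using finite_basis_exists by blast
  then have sub: "b \<subseteq> carrier V" by (simp add: basis_def)
  have "bij_betw (\<lambda>a. lincomb a b) (b \<rightarrow>\<^sub>E carrier K) (carrier V)"
  proof (rule bij_betwI')
    fix a a' assume a: "a \<in> b \<rightarrow>\<^sub>E carrier K" "a' \<in> b \<rightarrow>\<^sub>E carrier K"
    then have "lincomb a b \<in> carrier V" using sub b(1) by (intro lincomb_closed) auto
    then show "lincomb a b = lincomb a' b \<longleftrightarrow> a = a'"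
      using basis_criterion[OF b(1) sub] b(2) a by metis
  next
    fix a assume "a \<in> b \<rightarrow>\<^sub>E carrier K"
    then show "lincomb a b \<in> carrier V" using sub b(1) by (intro lincomb_closed) auto
  next
    fix v assume "v \<in> carrier V"
    then show "\<exists>a\<in>b \<rightarrow>\<^sub>E carrier K. v = lincomb a b"
      using basis_criterion[OF b(1) sub] b(2) by metis
  qed
  then have "card (carrier V) = card (b \<rightarrow>\<^sub>E carrier K)" by (simp add: bij_betw_same_card)
  also have "\<dots> = card (carrier K) ^ dim"
    using b by (simp add: card_PiE dim_basis)
  finally show ?thesis .
qed

section \<open>Homogeneous linear systems over a commutative ring\<close>

definition dot :: "('a, 'b) ring_scheme \<Rightarrow> 'j set \<Rightarrow> ('j \<Rightarrow> 'a) \<Rightarrow> ('j \<Rightarrow> 'a) \<Rightarrow> 'a" where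
  "dot F J v y = (\<Oplus>\<^bsub>F\<^esub>j\<in>J. v j \<otimes>\<^bsub>F\<^esub> y j)"

text \<open>A matrix is a family of rows, so that adding a row or deleting a column changes only the
  index sets. Solutions are extensional on \<open>J\<close>, so that they can be counted as elements
  of a function space.\<close>

definition kern :: "('a, 'b) ring_scheme \<Rightarrow> 'i set \<Rightarrow> 'j set \<Rightarrow> ('i \<Rightarrow> 'j \<Rightarrow> 'a) \<Rightarrow> ('j \<Rightarrow> 'a) set" where
  "kern F I J A = {y \<in> J \<rightarrow>\<^sub>E carrier F. \<forall>a\<in>I. dot F J (A a) y = \<zero>\<^bsub>F\<^esub>}"

context cring
begin

lemma dot_closed [simp]:
  "v \<in> J \<rightarrow> carrier R \<Longrightarrow> y \<in> J \<rightarrow> carrier R \<Longrightarrow> dot R J v y \<in> carrier R"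
  unfolding dot_def by (intro finsum_closed) (auto simp: Pi_iff)

lemma dot_add:
  assumes "v \<in> J \<rightarrow> carrier R" "y \<in> J \<rightarrow> carrier R" "z \<in> J \<rightarrow> carrier R"
  shows "dot R J v (\<lambda>j\<in>J. y j \<oplus> z j) = dot R J v y \<oplus> dot R J v z"
proof -
  have "dot R J v (\<lambda>j\<in>J. y j \<oplus> z j) = (\<Oplus>j\<in>J. v j \<otimes> y j \<oplus> v j \<otimes> z j)"
    unfolding dot_def using assms by (intro add.finprod_cong') (auto simp: r_distr Pi_iff)
  also have "\<dots> = dot R J v y \<oplus> dot R J v z"
    unfolding dot_def using assms by (intro finsum_addf) (auto simp: Pi_iff)
  finally show ?thesis .
qed

lemma dot_smult:
  assumes "v \<in> J \<rightarrow> carrier R" "y \<in> J \<rightarrow> carrier R" "c \<in> carrier R" "finite J"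
  shows "dot R J v (\<lambda>j\<in>J. c \<otimes> y j) = c \<otimes> dot R J v y"
proof -
  have "dot R J v (\<lambda>j\<in>J. c \<otimes> y j) = (\<Oplus>j\<in>J. c \<otimes> (v j \<otimes> y j))"
    unfolding dot_def using assms by (intro add.finprod_cong') (auto simp: m_lcomm Pi_iff)
  also have "\<dots> = c \<otimes> dot R J v y"
    unfolding dot_def using assms by (intro finsum_rdistr[symmetric]) (auto simp: Pi_iff)
  finally show ?thesis .
qed

lemma dot_neg:
  assumes "v \<in> J \<rightarrow> carrier R" "y \<in> J \<rightarrow> carrier R" "finite J"
  shows "dot R J v (\<lambda>j\<in>J. \<ominus> y j) = \<ominus> dot R J v y"
proof -
  have "(\<lambda>j\<in>J. \<ominus> y j) = (\<lambda>j\<in>J. \<ominus> \<one> \<otimes> y j)" using assms by (auto simp: l_minus Pi_iff fun_eq_iff)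
  then show ?thesis using assms dot_smult[of v J y "\<ominus> \<one>"] by (simp add: l_minus)
qed

lemma dot_insert:
  assumes "finite J" "c \<notin> J" "v \<in> insert c J \<rightarrow> carrier R" "y \<in> insert c J \<rightarrow> carrier R"
  shows "dot R (insert c J) v y = v c \<otimes> y c \<oplus> dot R J v y"
  unfolding dot_def using assms by (subst finsum_insert) (auto simp: Pi_iff)

lemma dot_cong:
  assumes "\<And>j. j \<in> J \<Longrightarrow> v j = v' j" "\<And>j. j \<in> J \<Longrightarrow> y j = y' j"
    "v' \<in> J \<rightarrow> carrier R" "y' \<in> J \<rightarrow> carrier R"
  shows "dot R J v y = dot R J v' y'"
  unfolding dot_def using assms by (intro add.finprod_cong') (auto simp: Pi_iff)

text \<open>All nonempty fibres of a linear map are translates of its kernel.\<close>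
lemma card_fibre_dot:
  assumes J: "finite J" and A: "\<And>a. a \<in> I \<Longrightarrow> A a \<in> J \<rightarrow> carrier R" and y: "y \<in> J \<rightarrow>\<^sub>E carrier R"
  shows "card {z \<in> J \<rightarrow>\<^sub>E carrier R. \<forall>a\<in>I. dot R J (A a) z = dot R J (A a) y} = card (kern R I J A)"
proof -
  have y': "y \<in> J \<rightarrow> carrier R" using y by auto
  let ?f = "\<lambda>z. \<lambda>j\<in>J. y j \<oplus> z j" and ?g = "\<lambda>z. \<lambda>j\<in>J. \<ominus> y j \<oplus> z j"
  have "bij_betw ?f (kern R I J A) {z \<in> J \<rightarrow>\<^sub>E carrier R. \<forall>a\<in>I. dot R J (A a) z = dot R J (A a) y}"
  proof (rule bij_betw_byWitness[where f' = ?g])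
    show "\<forall>z\<in>kern R I J A. ?g (?f z) = z"
    proof
      fix z assume "z \<in> kern R I J A"
      then have z: "z \<in> J \<rightarrow>\<^sub>E carrier R" by (simp add: kern_def)
      show "?g (?f z) = z"
      proof
        fix j show "?g (?f z) j = z j"
          using PiE_mem[OF y, of j] PiE_mem[OF z, of j] PiE_arb[OF z, of j]
          by (cases "j \<in> J") (simp_all add: r_neg1)
      qed
    qed
    show "\<forall>z\<in>{z \<in> J \<rightarrow>\<^sub>E carrier R. \<forall>a\<in>I. dot R J (A a) z = dot R J (A a) y}. ?f (?g z) = z"
    proof
      fix z assume "z \<in> {z \<in> J \<rightarrow>\<^sub>E carrier R. \<forall>a\<in>I. dot R J (A a) z = dot R J (A a) y}"
      then have z: "z \<in> J \<rightarrow>\<^sub>E carrier R" by simp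
      show "?f (?g z) = z"
      proof
        fix j show "?f (?g z) j = z j"
          using PiE_mem[OF y, of j] PiE_mem[OF z, of j] PiE_arb[OF z, of j]
          by (cases "j \<in> J") (simp_all add: r_neg2)
      qed
    qed
    show "?f ` kern R I J A \<subseteq> {z \<in> J \<rightarrow>\<^sub>E carrier R. \<forall>a\<in>I. dot R J (A a) z = dot R J (A a) y}"
    proof (intro image_subsetI CollectI conjI ballI)
      fix z a assume z: "z \<in> kern R I J A" and a: "a \<in> I"
      then have "z \<in> J \<rightarrow> carrier R" by (auto simp: kern_def)
      then show "dot R J (A a) (?f z) = dot R J (A a) y"
        using z a A[OF a] y' by (simp add: dot_add kern_def)
    next
      fix z assume "z \<in> kern R I J A"
      then show "?f z \<in> J \<rightarrow>\<^sub>E carrier R" using y by (auto simp: kern_def)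
    qed
    show "?g ` {z \<in> J \<rightarrow>\<^sub>E carrier R. \<forall>a\<in>I. dot R J (A a) z = dot R J (A a) y} \<subseteq> kern R I J A"
    proof (intro image_subsetI)
      fix z assume z: "z \<in> {z \<in> J \<rightarrow>\<^sub>E carrier R. \<forall>a\<in>I. dot R J (A a) z = dot R J (A a) y}"
      then have z': "z \<in> J \<rightarrow> carrier R" by auto
      have g: "?g z = (\<lambda>j\<in>J. (\<lambda>j\<in>J. \<ominus> y j) j \<oplus> z j)" by auto
      have "dot R J (A a) (?g z) = \<zero>" if a: "a \<in> I" for a
      proof -
        have "(\<lambda>j\<in>J. \<ominus> y j) \<in> J \<rightarrow> carrier R" using y' by auto
        then have "dot R J (A a) (?g z) = \<ominus> dot R J (A a) y \<oplus> dot R J (A a) z"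
          unfolding g using A[OF a] y' z' J by (subst dot_add) (auto simp: dot_neg)
        then show ?thesis using z a A[OF a] y' by (simp add: l_neg)
      qed
      moreover have "?g z \<in> J \<rightarrow>\<^sub>E carrier R" using y z by auto
      ultimately show "?g z \<in> kern R I J A" by (simp add: kern_def)
    qed
  qed
  then show ?thesis by (simp add: bij_betw_same_card)
qed

end

text \<open>Rank-nullity by counting: \<open>T J\<close> maps the \<open>q ^ n\<close> vectors onto
  the span of the columns, whose cardinality is \<open>q\<close> to the power of the rank, and all
  fibres have the size of the kernel.\<close>

lemma card_kern_mat_rank:
  fixes R :: "'a ring" (structure)
  assumes field: "field R" and fin: "finite (carrier R)" and A: "A \<in> cells m n \<rightarrow>\<^sub>E carrier R"
  shows "card (kern R {1..m} {1..n} (\<lambda>i j. A (i, j))) * card (carrier R) ^ mat_rank R m n A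
    = card (carrier R) ^ n"
proof -
  interpret field R by (rule field)
  define I J where "I = {1..m}" and "J = {1..n}"
  let ?V = "func_space I"
  let ?Fn = "J \<rightarrow>\<^sub>E carrier R"
  interpret V: vectorspace R ?V
    by (intro vectorspace.intro func_space_is_module field_axioms)
  have Ac: "A (i, j) \<in> carrier R" if "i \<in> I" "j \<in> J" for i j
    using A that by (auto simp: cells_def I_def J_def)
  define T where "T J' y = (\<lambda>i\<in>I. dot R J' (\<lambda>j. A (i, j)) y)" for J' y
  define col where "col j = (\<lambda>i\<in>I. A (i, j))" for j
  define S where "S = mat_cols m n A"
  have S_eq: "S = col ` J" unfolding S_def mat_cols_def col_def I_def J_def by simp
  have SV: "S \<subseteq> carrier ?V" unfolding S_eq col_def func_space_def using Ac by auto
  have finJ: "finite J" by (simp add: J_def)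
  have Ad: "(\<lambda>j. A (i, j)) \<in> J \<rightarrow> carrier R" if "i \<in> I" for i using Ac that by auto
  \<comment> \<open>An image vector is a sum of scaled columns, built up one column at a time;
    conversely the image is a subspace that contains each column as the image of a unit
    vector.\<close>
  have "T J ` ?Fn = V.span S"
  proof
    interpret sp: LinearCombinations.submodule R "V.span S" ?V by (rule V.span_is_submodule[OF SV])
    show "T J ` ?Fn \<subseteq> V.span S"
    proof (intro image_subsetI)
      fix y assume y: "y \<in> ?Fn"
      have "T J' y \<in> V.span S" if "finite J'" "J' \<subseteq> J" for J'
        using that
      proof (induction J')
        case empty
        have "T {} y = \<zero>\<^bsub>?V\<^esub>" by (simp add: T_def dot_def func_space_def)
        then show ?case by simp
      next
        case (insert j J')
        have "col j \<in> V.span S" using V.in_own_span[OF SV] insert.prems by (auto simp: S_eq)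
        moreover have "y j \<in> carrier R" using y insert.prems by auto
        moreover have "T (insert j J') y = (y j \<odot>\<^bsub>?V\<^esub> col j) \<oplus>\<^bsub>?V\<^esub> T J' y"
        proof -
          have "dot R (insert j J') (\<lambda>j. A (i, j)) y = y j \<otimes> A (i, j) \<oplus> dot R J' (\<lambda>j. A (i, j)) y"
            if "i \<in> I" for i
            using insert y that Ac by (subst dot_insert) (auto simp: subset_iff Pi_iff PiE_iff m_comm)
          then show ?thesis by (auto simp: T_def col_def func_space_def fun_eq_iff)
        qed
        ultimately show ?case using insert by simp
      qed
      from this[OF finJ order_refl] show "T J y \<in> V.span S" .
    qed
    show "V.span S \<subseteq> T J ` ?Fn"
    proof (rule V.span_is_subset)
      show "S \<subseteq> T J ` ?Fn"
      proof
        fix v assume "v \<in> S"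
        then obtain c where c: "c \<in> J" "v = col c" by (auto simp: S_eq)
        define y where "y = (\<lambda>j\<in>J. if j = c then \<one> else \<zero>)"
        have "dot R J (\<lambda>j. A (i, j)) y = A (i, c)" if "i \<in> I" for i
        proof -
          have "dot R J (\<lambda>j. A (i, j)) y = (\<Oplus>j\<in>J. if c = j then A (i, j) else \<zero>)"
            unfolding dot_def y_def using Ac that by (intro add.finprod_cong') auto
          also have "\<dots> = A (i, c)"
            using c Ac that finJ by (intro add.finprod_singleton) auto
          finally show ?thesis .
        qed
        then have "v = T J y" unfolding c T_def col_def by auto
        moreover have "y \<in> ?Fn" by (auto simp: y_def)
        ultimately show "v \<in> T J ` ?Fn" by blast
      qed
      show "LinearCombinations.submodule R (T J ` ?Fn) ?V"
      proof
        show "T J ` ?Fn \<subseteq> carrier ?V"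
          using Ac by (auto simp: T_def func_space_def PiE_mem intro!: dot_closed)
      next
        fix v w assume "v \<in> T J ` ?Fn" "w \<in> T J ` ?Fn"
        then obtain y z where yz: "y \<in> ?Fn" "z \<in> ?Fn" "v = T J y" "w = T J z" by auto
        then have "v \<oplus>\<^bsub>?V\<^esub> w = T J (\<lambda>j\<in>J. y j \<oplus> z j)"
          using Ad by (auto simp: T_def func_space_def dot_add fun_eq_iff PiE_def)
        moreover have "(\<lambda>j\<in>J. y j \<oplus> z j) \<in> ?Fn" using yz by auto
        ultimately show "v \<oplus>\<^bsub>?V\<^esub> w \<in> T J ` ?Fn" by blast
      next
        have "dot R J (\<lambda>j. A (i, j)) (\<lambda>j\<in>J. \<zero>) = \<zero>" if "i \<in> I" for i
          unfolding dot_def using Ac that by (intro add.finprod_one_eqI) auto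
        then have "\<zero>\<^bsub>?V\<^esub> = T J (\<lambda>j\<in>J. \<zero>)" by (auto simp: T_def func_space_def)
        then show "\<zero>\<^bsub>?V\<^esub> \<in> T J ` ?Fn" by auto
      next
        fix c v assume c: "c \<in> carrier R" and "v \<in> T J ` ?Fn"
        then obtain y where y: "y \<in> ?Fn" "v = T J y" by auto
        then have "c \<odot>\<^bsub>?V\<^esub> v = T J (\<lambda>j\<in>J. c \<otimes> y j)"
          using Ad c finJ by (auto simp: T_def func_space_def dot_smult fun_eq_iff PiE_def)
        moreover have "(\<lambda>j\<in>J. c \<otimes> y j) \<in> ?Fn" using y c by auto
        ultimately show "c \<odot>\<^bsub>?V\<^esub> v \<in> T J ` ?Fn" by blast
      qed
    qed
  qed
  moreover have finFn: "finite ?Fn" using fin finJ by (intro finite_PiE) auto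
  ultimately have img: "T J ` ?Fn = V.span S" and finsp: "finite (V.span S)" by (auto simp flip: \<open>_ = V.span S\<close>)
  interpret W: vectorspace R "?V\<lparr>carrier := V.span S\<rparr>"
    by (rule V.subspace_is_vs[OF V.span_is_subspace[OF SV]])
  have card_span: "card (V.span S) = card (carrier R) ^ mat_rank R m n A"
    using W.card_carrier_eq_power_dim finsp unfolding mat_rank_def S_def I_def by simp
  have "card (carrier R) ^ n = card ?Fn" using finJ by (simp add: card_PiE J_def)
  also have "?Fn = (\<Union>w\<in>V.span S. {z \<in> ?Fn. T J z = w})" using img by blast
  also have "card \<dots> = (\<Sum>w\<in>V.span S. card {z \<in> ?Fn. T J z = w})"
    using finsp finFn by (intro card_UN_disjoint) auto
  also have "\<dots> = (\<Sum>w\<in>V.span S. card (kern R I J (\<lambda>i j. A (i, j))))"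
  proof (rule sum.cong)
    fix w assume "w \<in> V.span S"
    then obtain y where y: "y \<in> ?Fn" "w = T J y" using img by auto
    then have "{z \<in> ?Fn. T J z = w} = {z \<in> ?Fn. \<forall>i\<in>I. dot R J (\<lambda>j. A (i, j)) z = dot R J (\<lambda>j. A (i, j)) y}"
      by (auto simp: T_def fun_eq_iff restrict_def)
    then show "card {z \<in> ?Fn. T J z = w} = card (kern R I J (\<lambda>i j. A (i, j)))"
      using card_fibre_dot[OF finJ Ad y(1), of I "\<lambda>i. i"] by simp
  qed simp
  finally have "card (carrier R) ^ n = card (V.span S) * card (kern R I J (\<lambda>i j. A (i, j)))" by simp
  then show ?thesis unfolding card_span by (simp add: I_def J_def mult.commute)
qed

section \<open>Adding a row to a matrix supported on a board\<close>

definition row_space :: "('a, 'b) ring_scheme \<Rightarrow> ('i \<times> 'j) set \<Rightarrow> 'j set \<Rightarrow> 'i \<Rightarrow> ('j \<Rightarrow> 'a) set" where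
  "row_space F B J a = (\<Pi>\<^sub>E j\<in>J. if (a, j) \<in> B then carrier F else {\<zero>\<^bsub>F\<^esub>})"

definition board_mats ::
  "('a, 'b) ring_scheme \<Rightarrow> ('i \<times> 'j) set \<Rightarrow> 'i set \<Rightarrow> 'j set \<Rightarrow> ('i \<Rightarrow> 'j \<Rightarrow> 'a) set" where
  "board_mats F B I J = (\<Pi>\<^sub>E a\<in>I. row_space F B J a)"

definition rank_num ::
  "('a, 'b) ring_scheme \<Rightarrow> ('i \<times> 'j) set \<Rightarrow> 'i set \<Rightarrow> 'j set \<Rightarrow> nat \<Rightarrow> nat" where
  "rank_num F B I J i = card {A \<in> board_mats F B I J.
     card (kern F I J A) * card (carrier F) ^ i = card (carrier F) ^ card J}"

text \<open>The rank in question is that of the matrix with \<open>v\<close> appended as one more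
  row. This row is held fixed and need not respect \<open>B\<close>, so that the dependence of the
  count on \<open>v\<close> can be studied.\<close>

definition ext_rank_num ::
  "('a, 'b) ring_scheme \<Rightarrow> ('i \<times> 'j) set \<Rightarrow> ('j \<Rightarrow> 'a) \<Rightarrow> 'i set \<Rightarrow> 'j set \<Rightarrow> nat \<Rightarrow> nat" where
  "ext_rank_num F B v I J i = card {A \<in> board_mats F B I J.
     card {y \<in> kern F I J A. dot F J v y = \<zero>\<^bsub>F\<^esub>} * card (carrier F) ^ i = card (carrier F) ^ card J}"

definition ind_vec :: "('a, 'b) ring_scheme \<Rightarrow> 'j set \<Rightarrow> 'j set \<Rightarrow> 'j \<Rightarrow> 'a" where
  "ind_vec F J S = (\<lambda>j\<in>J. if j \<in> S then \<one>\<^bsub>F\<^esub> else \<zero>\<^bsub>F\<^esub>)"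

text \<open>The board that results from adding column \<open>c\<close> to column \<open>d\<close>.\<close>
definition merge_board :: "'j \<Rightarrow> 'j \<Rightarrow> ('i \<times> 'j) set \<Rightarrow> ('i \<times> 'j) set" where
  "merge_board c d B = {(a, j). (a, j) \<in> B \<or> j = d \<and> (a, c) \<in> B}"

text \<open>A map that acts on each row separately has products of row fibres as its fibres. If the
  size of a row fibre depends on the row index alone, all fibres are equally large. Deleting a
  column and uniting two columns are both of this kind.\<close>

lemma card_PiE_fibration:
  assumes I: "finite I" and U: "\<And>a. a \<in> I \<Longrightarrow> finite (U a)" and Y: "\<And>a. a \<in> I \<Longrightarrow> finite (Y a)"
    and f: "\<And>a v. a \<in> I \<Longrightarrow> v \<in> U a \<Longrightarrow> f a v \<in> Y a"
    and m: "\<And>a w. a \<in> I \<Longrightarrow> w \<in> Y a \<Longrightarrow> card {v \<in> U a. f a v = w} = m a"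
  shows "card {A \<in> Pi\<^sub>E I U. P (\<lambda>a\<in>I. f a (A a))} = (\<Prod>a\<in>I. m a) * card {A \<in> Pi\<^sub>E I Y. P A}"
proof -
  let ?Z = "{A \<in> Pi\<^sub>E I Y. P A}"
  have "finite (Pi\<^sub>E I Y)" using I Y by (rule finite_PiE)
  then have finZ: "finite ?Z" by simp
  have "{A \<in> Pi\<^sub>E I U. P (\<lambda>a\<in>I. f a (A a))} = (\<Union>C\<in>?Z. \<Pi>\<^sub>E a\<in>I. {v \<in> U a. f a v = C a})"
  proof (intro equalityI subsetI)
    fix A assume A: "A \<in> {A \<in> Pi\<^sub>E I U. P (\<lambda>a\<in>I. f a (A a))}"
    then have "(\<lambda>a\<in>I. f a (A a)) \<in> ?Z" using f by auto
    moreover have "A \<in> (\<Pi>\<^sub>E a\<in>I. {v \<in> U a. f a v = (\<lambda>a\<in>I. f a (A a)) a})" using A by auto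
    ultimately show "A \<in> (\<Union>C\<in>?Z. \<Pi>\<^sub>E a\<in>I. {v \<in> U a. f a v = C a})" by blast
  next
    fix A assume "A \<in> (\<Union>C\<in>?Z. \<Pi>\<^sub>E a\<in>I. {v \<in> U a. f a v = C a})"
    then obtain C where C: "C \<in> Pi\<^sub>E I Y" "P C" "A \<in> (\<Pi>\<^sub>E a\<in>I. {v \<in> U a. f a v = C a})" by blast
    then have "(\<lambda>a\<in>I. f a (A a)) = C"
      by (intro extensionalityI[of _ I]) (auto simp: PiE_def Pi_iff)
    with C show "A \<in> {A \<in> Pi\<^sub>E I U. P (\<lambda>a\<in>I. f a (A a))}" by (auto simp: PiE_iff)
  qed
  also have "card \<dots> = (\<Sum>C\<in>?Z. card (\<Pi>\<^sub>E a\<in>I. {v \<in> U a. f a v = C a}))"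
  proof (rule card_UN_disjoint[OF finZ])
    show "\<forall>C\<in>?Z. finite (\<Pi>\<^sub>E a\<in>I. {v \<in> U a. f a v = C a})"
      using I U by (auto intro!: finite_PiE)
    show "\<forall>C\<in>?Z. \<forall>D\<in>?Z. C \<noteq> D \<longrightarrow>
        (\<Pi>\<^sub>E a\<in>I. {v \<in> U a. f a v = C a}) \<inter> (\<Pi>\<^sub>E a\<in>I. {v \<in> U a. f a v = D a}) = {}"
    proof (intro ballI impI)
      fix C D assume CD: "C \<in> ?Z" "D \<in> ?Z" "C \<noteq> D"
      then obtain a where "a \<in> I" "C a \<noteq> D a" by (metis (no_types, lifting) PiE_ext mem_Collect_eq)
      then show "(\<Pi>\<^sub>E a\<in>I. {v \<in> U a. f a v = C a}) \<inter> (\<Pi>\<^sub>E a\<in>I. {v \<in> U a. f a v = D a}) = {}"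
        by (force simp: PiE_iff)
    qed
  qed
  also have "\<dots> = (\<Sum>C\<in>?Z. \<Prod>a\<in>I. m a)"
    using m I by (intro sum.cong refl) (auto simp: card_PiE PiE_iff intro!: prod.cong)
  finally show ?thesis by simp
qed

lemma prod_if_const:
  "finite I \<Longrightarrow> (\<Prod>a\<in>I. if P a then q else 1 :: 'a :: comm_monoid_mult) = q ^ card {a \<in> I. P a}"
  by (simp add: prod.If_cases Int_def)

locale finite_field = field R for R (structure) +
  assumes finite_carrier [simp]: "finite (carrier R)"
begin

abbreviation q where "q \<equiv> card (carrier R)"

lemma q_gt_1: "q > 1"
proof -
  have "card {\<zero>, \<one>} \<le> q" by (intro card_mono) auto
  then show ?thesis by simp
qed

lemma finite_row_space [simp]: "finite J \<Longrightarrow> finite (row_space R B J a)"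
  unfolding row_space_def by (intro finite_PiE) auto

lemma row_space_subset: "row_space R B J a \<subseteq> J \<rightarrow>\<^sub>E carrier R"
  unfolding row_space_def by (intro PiE_mono) auto

lemma board_matsD:
  "A \<in> board_mats R B I J \<Longrightarrow> a \<in> I \<Longrightarrow> A a \<in> J \<rightarrow> carrier R"
  using row_space_subset[of B J a] unfolding board_mats_def by (blast dest: PiE_mem)

lemma finite_board_mats [simp]: "finite I \<Longrightarrow> finite J \<Longrightarrow> finite (board_mats R B I J)"
  unfolding board_mats_def by (intro finite_PiE) auto

lemma finite_kern [simp]: "finite J \<Longrightarrow> finite (kern R I J A)"
  unfolding kern_def by (rule finite_subset[of _ "J \<rightarrow>\<^sub>E carrier R"]) (auto intro!: finite_PiE)

lemma kern_cong:
  assumes "\<And>a j. a \<in> I \<Longrightarrow> j \<in> J \<Longrightarrow> A a j = A' a j" "\<And>a. a \<in> I \<Longrightarrow> A' a \<in> J \<rightarrow> carrier R"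
  shows "kern R I J A = kern R I J A'"
proof -
  have "dot R J (A a) y = dot R J (A' a) y" if "a \<in> I" "y \<in> J \<rightarrow>\<^sub>E carrier R" for a y
    using assms that by (intro dot_cong) auto
  then show ?thesis by (auto simp: kern_def)
qed

lemma rank_num_insert_row:
  assumes fin: "finite I" "finite J" and x: "x \<notin> I"
  shows "rank_num R B (insert x I) J i = (\<Sum>v\<in>row_space R B J x. ext_rank_num R B v I J i)"
proof -
  let ?P = "\<lambda>I A. card (kern R I J A) * q ^ i = q ^ card J"
  let ?h = "\<lambda>(v, A). A(x := v)"
  let ?D = "SIGMA v:row_space R B J x. {A \<in> board_mats R B I J. ?P (insert x I) (A(x := v))}"
  have eq: "board_mats R B (insert x I) J = ?h ` (row_space R B J x \<times> board_mats R B I J)"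
    unfolding board_mats_def by (subst PiE_insert_eq) auto
  have inj: "inj_on ?h (row_space R B J x \<times> board_mats R B I J)"
    using x unfolding board_mats_def by (rule inj_combinator)
  have "{A \<in> board_mats R B (insert x I) J. ?P (insert x I) A} = ?h ` ?D" unfolding eq by auto
  then have "rank_num R B (insert x I) J i = card (?h ` ?D)" unfolding rank_num_def by simp
  also have "\<dots> = card ?D" by (intro card_image inj_on_subset[OF inj]) auto
  also have "\<dots> = (\<Sum>v\<in>row_space R B J x. card {A \<in> board_mats R B I J. ?P (insert x I) (A(x := v))})"
    using fin by (intro card_SigmaI) auto
  also have "\<dots> = (\<Sum>v\<in>row_space R B J x. ext_rank_num R B v I J i)"
  proof (rule sum.cong[OF refl])
    fix v
    have "kern R (insert x I) J (A(x := v)) = {y \<in> kern R I J A. dot R J v y = \<zero>}" for A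
      using x by (auto simp: kern_def)
    then show "card {A \<in> board_mats R B I J. ?P (insert x I) (A(x := v))} = ext_rank_num R B v I J i"
      unfolding ext_rank_num_def by simp
  qed
  finally show ?thesis .
qed

section \<open>Scaling columns: the count depends only on the support of the new row\<close>

lemma dot_scale:
  assumes u: "\<And>j. j \<in> J \<Longrightarrow> u j \<in> carrier R - {\<zero>}" and v: "v \<in> J \<rightarrow> carrier R" and y: "y \<in> J \<rightarrow> carrier R"
  shows "dot R J (\<lambda>j\<in>J. v j \<otimes> u j) (\<lambda>j\<in>J. inv (u j) \<otimes> y j) = dot R J v y"
proof -
  have "v j \<otimes> u j \<otimes> (inv (u j) \<otimes> y j) = v j \<otimes> y j" if j: "j \<in> J" for j
  proof -
    have "u j \<in> Units R" using u[OF j] by (simp add: field_Units)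
    then have U: "u j \<in> carrier R" "inv (u j) \<in> carrier R" "u j \<otimes> inv (u j) = \<one>" by auto
    have vy: "v j \<in> carrier R" "y j \<in> carrier R" using v y j by auto
    have "v j \<otimes> u j \<otimes> (inv (u j) \<otimes> y j) = v j \<otimes> ((u j \<otimes> inv (u j)) \<otimes> y j)"
      using U(1,2) vy by (simp only: m_assoc m_closed)
    then show ?thesis using U(3) vy by simp
  qed
  then show ?thesis unfolding dot_def using v y by (intro add.finprod_cong') auto
qed

text \<open>Multiplying column \<open>j\<close> by the unit \<open>u j\<close> keeps supports, and
  dividing the coordinates of a solution by the same units keeps all equations, hence the size of
  the kernel. For an inequality injectivity of the scaling is enough; the converse is the same
  inequality for the inverse units.\<close>

lemma ext_rank_num_scale_le:
  assumes fin: "finite I" "finite J" and u: "\<And>j. j \<in> J \<Longrightarrow> u j \<in> carrier R - {\<zero>}"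
    and v: "v \<in> J \<rightarrow> carrier R"
  shows "ext_rank_num R B v I J i \<le> ext_rank_num R B (\<lambda>j\<in>J. v j \<otimes> u j) I J i"
proof -
  let ?K = "\<lambda>v A. {y \<in> kern R I J A. dot R J v y = \<zero>}"
  let ?M = "\<lambda>v. {A \<in> board_mats R B I J. card (?K v A) * q ^ i = q ^ card J}"
  let ?s = "\<lambda>A. \<lambda>a\<in>I. \<lambda>j\<in>J. A a j \<otimes> u j"
  have U: "u j \<in> Units R" if "j \<in> J" for j using u[OF that] by (simp add: field_Units)
  have inv_u: "inv (u j) \<in> carrier R - {\<zero>}" if "j \<in> J" for j
    using U[OF that] by (metis Units_inv_Units field_Units)
  have s_mats: "?s A \<in> board_mats R B I J" if A: "A \<in> board_mats R B I J" for A
    unfolding board_mats_def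
  proof (intro PiE_I)
    fix a assume a: "a \<in> I"
    then have Aa: "A a \<in> row_space R B J a" using A by (auto simp: board_mats_def)
    show "?s A a \<in> row_space R B J a"
      unfolding row_space_def
    proof (intro PiE_I)
      fix j assume j: "j \<in> J"
      then have "A a j \<in> (if (a, j) \<in> B then carrier R else {\<zero>})"
        using Aa unfolding row_space_def by (rule PiE_mem[rotated])
      then show "?s A a j \<in> (if (a, j) \<in> B then carrier R else {\<zero>})"
        using u[OF j] a j by (auto split: if_splits)
    qed (use a in auto)
  qed auto
  have inj: "inj_on ?s (board_mats R B I J)"
  proof (rule inj_onI)
    fix A A' assume A: "A \<in> board_mats R B I J" "A' \<in> board_mats R B I J" and eq: "?s A = ?s A'"
    have "A a j = A' a j" if "a \<in> I" "j \<in> J" for a j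
    proof -
      have "A a j \<otimes> u j = A' a j \<otimes> u j" using fun_cong[OF fun_cong[OF eq, of a], of j] that by simp
      then show ?thesis
        using A u[of j] that board_matsD[of A B I J a] board_matsD[of A' B I J a] m_rcancel[of "u j" "A a j" "A' a j"]
        by (auto simp: Pi_iff)
    qed
    moreover have "A a j = A' a j" if "a \<in> I" "j \<notin> J" for a j
      using A that unfolding board_mats_def row_space_def by (metis (no_types, lifting) PiE_arb PiE_mem)
    moreover have "A a = A' a" if "a \<notin> I" for a
      using A that unfolding board_mats_def by (metis (no_types, lifting) PiE_arb)
    ultimately show "A = A'" by (intro ext) metis
  qed
  have card_K: "card (?K (\<lambda>j\<in>J. v j \<otimes> u j) (?s A)) = card (?K v A)" if A: "A \<in> board_mats R B I J" for A
  proof -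
    let ?f = "\<lambda>y. \<lambda>j\<in>J. inv (u j) \<otimes> y j" and ?g = "\<lambda>y. \<lambda>j\<in>J. u j \<otimes> y j"
    have gf: "?f (?g y) = y" "?g (?f y) = y" if y: "y \<in> J \<rightarrow>\<^sub>E carrier R" for y
    proof -
      have e: "inv (u j) \<otimes> (u j \<otimes> y j) = y j" "u j \<otimes> (inv (u j) \<otimes> y j) = y j" if "j \<in> J" for j
        using U[OF that] PiE_mem[OF y that]
        by (simp_all add: m_assoc[symmetric] Units_closed)
      have "?f (?g y) j = y j" "?g (?f y) j = y j" for j
        using e[of j] PiE_arb[OF y, of j] by (cases "j \<in> J"; simp)+
      then show "?f (?g y) = y" "?g (?f y) = y" by blast+
    qed
    have dotA: "dot R J (?s A a) (?f y) = dot R J (A a) y" if "a \<in> I" "y \<in> J \<rightarrow>\<^sub>E carrier R" for a y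
    proof -
      have "?s A a = (\<lambda>j\<in>J. A a j \<otimes> u j)" using that by simp
      moreover have "dot R J (\<lambda>j\<in>J. A a j \<otimes> u j) (?f y) = dot R J (A a) y"
        by (rule dot_scale[OF u]) (use board_matsD[OF A that(1)] that(2) in auto)
      ultimately show ?thesis by simp
    qed
    have dotv: "dot R J (\<lambda>j\<in>J. v j \<otimes> u j) (?f y) = dot R J v y" if "y \<in> J \<rightarrow>\<^sub>E carrier R" for y
      by (rule dot_scale[OF u]) (use v that in auto)
    have fc: "?f y \<in> J \<rightarrow>\<^sub>E carrier R" "?g y \<in> J \<rightarrow>\<^sub>E carrier R" if "y \<in> J \<rightarrow>\<^sub>E carrier R" for y
      using that u inv_u by (auto simp: PiE_iff)
    have "bij_betw ?f (?K v A) (?K (\<lambda>j\<in>J. v j \<otimes> u j) (?s A))"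
    proof (rule bij_betw_byWitness[where f' = ?g])
      show "\<forall>y\<in>?K v A. ?g (?f y) = y" using gf by (auto simp: kern_def)
      show "\<forall>y\<in>?K (\<lambda>j\<in>J. v j \<otimes> u j) (?s A). ?f (?g y) = y" using gf by (auto simp: kern_def)
      show "?f ` ?K v A \<subseteq> ?K (\<lambda>j\<in>J. v j \<otimes> u j) (?s A)"
      proof (intro image_subsetI)
        fix y assume "y \<in> ?K v A"
        then have y: "y \<in> J \<rightarrow>\<^sub>E carrier R" "\<forall>a\<in>I. dot R J (A a) y = \<zero>" "dot R J v y = \<zero>"
          by (auto simp: kern_def)
        have "dot R J (?s A a) (?f y) = \<zero>" if "a \<in> I" for a
          using dotA[OF that y(1)] bspec[OF y(2) that] by (rule trans)
        moreover have "dot R J (\<lambda>j\<in>J. v j \<otimes> u j) (?f y) = \<zero>"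
          using dotv[OF y(1)] y(3) by (rule trans)
        ultimately show "?f y \<in> ?K (\<lambda>j\<in>J. v j \<otimes> u j) (?s A)"
          unfolding kern_def using fc(1)[OF y(1)] by (intro CollectI conjI ballI)
      qed
      show "?g ` ?K (\<lambda>j\<in>J. v j \<otimes> u j) (?s A) \<subseteq> ?K v A"
      proof (intro image_subsetI)
        fix y assume "y \<in> ?K (\<lambda>j\<in>J. v j \<otimes> u j) (?s A)"
        then have y: "y \<in> J \<rightarrow>\<^sub>E carrier R" "\<forall>a\<in>I. dot R J (?s A a) y = \<zero>"
          "dot R J (\<lambda>j\<in>J. v j \<otimes> u j) y = \<zero>"
          unfolding kern_def mem_Collect_eq by blast+
        have gy: "?g y \<in> J \<rightarrow>\<^sub>E carrier R" by (rule fc(2)[OF y(1)])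
        have "dot R J (A a) (?g y) = \<zero>" if "a \<in> I" for a
          using dotA[OF that gy] bspec[OF y(2) that] unfolding gf(1)[OF y(1)] by (metis (lifting))
        moreover have "dot R J v (?g y) = \<zero>"
          using dotv[OF gy] y(3) unfolding gf(1)[OF y(1)] by (metis (lifting))
        ultimately show "?g y \<in> ?K v A"
          unfolding kern_def using gy by (intro CollectI conjI ballI)
      qed
    qed
    then show ?thesis by (rule bij_betw_same_card[symmetric])
  qed
  have "card (?M v) \<le> card (?M (\<lambda>j\<in>J. v j \<otimes> u j))"
  proof (rule card_inj_on_le)
    show "inj_on ?s (?M v)" using inj by (rule inj_on_subset) auto
    show "?s ` ?M v \<subseteq> ?M (\<lambda>j\<in>J. v j \<otimes> u j)"
    proof (intro image_subsetI)
      fix A assume "A \<in> ?M v"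
      then show "?s A \<in> ?M (\<lambda>j\<in>J. v j \<otimes> u j)" using s_mats[of A] card_K[of A] by simp
    qed
    show "finite (?M (\<lambda>j\<in>J. v j \<otimes> u j))" using fin by simp
  qed
  then show ?thesis unfolding ext_rank_num_def .
qed

lemma ext_rank_num_support:
  assumes fin: "finite I" "finite J" and v: "v \<in> J \<rightarrow>\<^sub>E carrier R"
    and S: "S = {j \<in> J. v j \<noteq> \<zero>}"
  shows "ext_rank_num R B v I J i = ext_rank_num R B (ind_vec R J S) I J i"
proof (rule antisym)
  \<comment> \<open>The entries of \<open>v\<close> on its support serve as scaling factors;
    elsewhere the factor is one, as a factor zero is not allowed.\<close>
  define u where "u j = (if j \<in> S then v j else \<one>)" for j
  have u: "u j \<in> carrier R - {\<zero>}" if "j \<in> J" for j using v S that by (auto simp: u_def)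
  then have U: "u j \<in> Units R" if "j \<in> J" for j using that by (simp add: field_Units)
  have iu: "inv (u j) \<in> carrier R - {\<zero>}" if "j \<in> J" for j
    using U[OF that] by (metis Units_inv_Units field_Units)
  have "v j \<otimes> inv (u j) = (if j \<in> S then \<one> else \<zero>)" if "j \<in> J" for j
    using Units_r_inv[OF U[OF that]] iu[OF that] S that by (auto simp: u_def)
  then have "(\<lambda>j\<in>J. v j \<otimes> inv (u j)) = ind_vec R J S"
    by (auto simp: ind_vec_def fun_eq_iff)
  then show "ext_rank_num R B v I J i \<le> ext_rank_num R B (ind_vec R J S) I J i"
    using ext_rank_num_scale_le[OF fin, of "\<lambda>j. inv (u j)" v B i] iu v by auto
  have "(\<lambda>j\<in>J. ind_vec R J S j \<otimes> u j) j = v j" for j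
    using v S u[of j] by (cases "j \<in> J") (auto simp: ind_vec_def u_def PiE_iff extensional_def)
  then have "(\<lambda>j\<in>J. ind_vec R J S j \<otimes> u j) = v" by blast
  then show "ext_rank_num R B (ind_vec R J S) I J i \<le> ext_rank_num R B v I J i"
    using ext_rank_num_scale_le[OF fin, of u "ind_vec R J S" B i] u by (auto simp: ind_vec_def)
qed

lemma card_support:
  assumes "finite J" "S \<subseteq> J"
  shows "card {v \<in> J \<rightarrow>\<^sub>E carrier R. {j \<in> J. v j \<noteq> \<zero>} = S} = (q - 1) ^ card S"
proof -
  have "{v \<in> J \<rightarrow>\<^sub>E carrier R. {j \<in> J. v j \<noteq> \<zero>} = S}
      = (\<Pi>\<^sub>E j\<in>J. if j \<in> S then carrier R - {\<zero>} else {\<zero>})"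
    (is "?L = ?R")
  proof (intro equalityI subsetI)
    fix v assume "v \<in> ?L"
    then show "v \<in> ?R" by (auto simp: PiE_iff)
  next
    fix v assume v: "v \<in> ?R"
    have "v j \<in> carrier R \<and> (v j \<noteq> \<zero> \<longleftrightarrow> j \<in> S)" if "j \<in> J" for j
      using PiE_mem[OF v that] by (cases "j \<in> S") auto
    then show "v \<in> ?L" using v assms by (auto simp: PiE_iff)
  qed
  then show ?thesis
    using assms by (simp add: card_PiE if_distrib[of card] prod.If_cases Int_absorb1 Int_commute)
qed

text \<open>All \<open>(q - 1) ^ card S\<close> rows with support \<open>S\<close> contribute
  equally; this is where powers of \<open>q - 1\<close> enter the recursion.\<close>

lemma rank_num_insert:
  assumes fin: "finite I" "finite J" and x: "x \<notin> I"
  shows "rank_num R B (insert x I) J i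
    = (\<Sum>S\<in>Pow {j \<in> J. (x, j) \<in> B}. (q - 1) ^ card S * ext_rank_num R B (ind_vec R J S) I J i)"
proof -
  let ?supp = "\<lambda>v. {j \<in> J. v j \<noteq> \<zero>}" and ?Bx = "{j \<in> J. (x, j) \<in> B}"
  have sub: "?supp ` row_space R B J x \<subseteq> Pow ?Bx"
    by (auto simp: row_space_def PiE_iff split: if_splits)
  have "rank_num R B (insert x I) J i = (\<Sum>v\<in>row_space R B J x. ext_rank_num R B v I J i)"
    by (rule rank_num_insert_row[OF fin x])
  also have "\<dots> = (\<Sum>S\<in>Pow ?Bx. \<Sum>v\<in>{v \<in> row_space R B J x. ?supp v = S}. ext_rank_num R B v I J i)"
    using fin sub by (intro sum.group[symmetric]) auto
  also have "\<dots> = (\<Sum>S\<in>Pow ?Bx. (q - 1) ^ card S * ext_rank_num R B (ind_vec R J S) I J i)"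
  proof (rule sum.cong[OF refl])
    fix S assume S: "S \<in> Pow ?Bx"
    have "(\<Sum>v\<in>{v \<in> row_space R B J x. ?supp v = S}. ext_rank_num R B v I J i)
        = (\<Sum>v\<in>{v \<in> row_space R B J x. ?supp v = S}. ext_rank_num R B (ind_vec R J S) I J i)"
      using row_space_subset[of B J x] fin by (intro sum.cong refl ext_rank_num_support) auto
    moreover have "{v \<in> row_space R B J x. ?supp v = S} = {v \<in> J \<rightarrow>\<^sub>E carrier R. ?supp v = S}"
      using S unfolding row_space_def by (auto simp: PiE_iff split: if_splits)
    ultimately show "(\<Sum>v\<in>{v \<in> row_space R B J x. ?supp v = S}. ext_rank_num R B v I J i)
        = (q - 1) ^ card S * ext_rank_num R B (ind_vec R J S) I J i"
      using card_support[of J S] S fin by auto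
  qed
  finally show ?thesis .
qed

end

context finite_field
begin

lemma ind_vec_closed [simp]: "ind_vec R J S \<in> J \<rightarrow> carrier R"
  by (auto simp: ind_vec_def)

lemma dot_ind_vec:
  assumes "finite J" "S \<subseteq> J" "y \<in> J \<rightarrow> carrier R"
  shows "dot R J (ind_vec R J S) y = (\<Oplus>j\<in>S. y j)"
  unfolding dot_def
  by (rule add.finprod_mono_neutral_cong_right) (use assms in \<open>auto simp: ind_vec_def Pi_iff subset_iff\<close>)

lemma ext_rank_num_empty:
  assumes "finite J"
  shows "ext_rank_num R B (ind_vec R J {}) I J i = rank_num R B I J i"
proof -
  have "{y \<in> kern R I J A. dot R J (ind_vec R J {}) y = \<zero>} = kern R I J A" for A
    using dot_ind_vec[OF assms, of "{}"] by (auto simp: kern_def)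
  then show ?thesis unfolding ext_rank_num_def rank_num_def by simp
qed

lemma row_space_mem:
  "v \<in> row_space R B J a \<Longrightarrow> j \<in> J \<Longrightarrow> v j \<in> (if (a, j) \<in> B then carrier R else {\<zero>})"
  unfolding row_space_def by (rule PiE_mem)

lemma row_spaceI:
  assumes "\<And>j. j \<in> J \<Longrightarrow> v j \<in> (if (a, j) \<in> B then carrier R else {\<zero>})"
    "\<And>j. j \<notin> J \<Longrightarrow> v j = undefined"
  shows "v \<in> row_space R B J a"
  unfolding row_space_def using assms by (rule PiE_I)

section \<open>A new row with one nonzero entry\<close>

lemma card_row_space_fibre_restrict:
  assumes c: "c \<in> J" and w: "w \<in> row_space R B (J - {c}) a"
  shows "card {v \<in> row_space R B J a. restrict v (J - {c}) = w} = (if (a, c) \<in> B then q else 1)"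
proof -
  let ?U = "if (a, c) \<in> B then carrier R else {\<zero>}"
  have "{v \<in> row_space R B J a. restrict v (J - {c}) = w} = (\<lambda>u. w(c := u)) ` ?U"
  proof (intro equalityI subsetI)
    fix v assume v: "v \<in> {v \<in> row_space R B J a. restrict v (J - {c}) = w}"
    then have "v c \<in> ?U" using c unfolding row_space_def by (blast dest: PiE_mem)
    moreover have "v = w(c := v c)"
    proof
      fix j show "v j = (w(c := v c)) j"
        using v c fun_cong[of "restrict v (J - {c})" w j]
        by (auto simp: row_space_def PiE_iff extensional_def split: if_splits)
    qed
    ultimately show "v \<in> (\<lambda>u. w(c := u)) ` ?U" by blast
  next
    fix v assume "v \<in> (\<lambda>u. w(c := u)) ` ?U"
    then obtain u where u: "u \<in> ?U" "v = w(c := u)" by blast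
    have "v \<in> row_space R B J a"
    proof (rule row_spaceI)
      fix j assume "j \<in> J"
      then show "v j \<in> (if (a, j) \<in> B then carrier R else {\<zero>})"
        using u row_space_mem[OF w, of j] by (cases "j = c") auto
    next
      fix j assume "j \<notin> J"
      then show "v j = undefined" using u w c by (auto simp: row_space_def PiE_iff extensional_def)
    qed
    moreover have "restrict v (J - {c}) = w"
      using u w unfolding row_space_def by (auto simp: fun_eq_iff restrict_def PiE_iff extensional_def)
    ultimately show "v \<in> {v \<in> row_space R B J a. restrict v (J - {c}) = w}" by blast
  qed
  moreover have "inj_on (\<lambda>u. w(c := u)) ?U" by (rule inj_onI) (metis fun_upd_same)
  ultimately show ?thesis by (simp add: card_image)
qed

text \<open>The appended equation says \<open>y c = \<zero>\<close>, so column \<open>c\<close>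
  drops out of all other equations.\<close>

lemma card_kern_delete:
  assumes fin: "finite J" and c: "c \<in> J" and A: "\<And>a. a \<in> I \<Longrightarrow> A a \<in> J \<rightarrow> carrier R"
  shows "card {y \<in> kern R I J A. dot R J (ind_vec R J {c}) y = \<zero>} = card (kern R I (J - {c}) A)"
proof -
  have dots: "dot R J (A a) y = A a c \<otimes> y c \<oplus> dot R (J - {c}) (A a) y"
    if "a \<in> I" "y \<in> J \<rightarrow> carrier R" for a y
    using dot_insert[of "J - {c}" c "A a" y] A[OF that(1)] that(2) fin
      funcset_mem[OF A[OF that(1)] c] funcset_mem[OF that(2) c]
    by (simp add: insert_absorb[OF c] Pi_iff)
  have yc: "dot R J (ind_vec R J {c}) y = y c" if "y \<in> J \<rightarrow> carrier R" for y
    using dot_ind_vec[OF fin, of "{c}" y] that c by (auto simp: Pi_iff)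
  have dz: "dot R J (A a) y = dot R (J - {c}) (A a) y" if "a \<in> I" "y \<in> J \<rightarrow> carrier R" "y c = \<zero>" for a y
  proof -
    have "A a \<in> J - {c} \<rightarrow> carrier R" "y \<in> J - {c} \<rightarrow> carrier R" "A a c \<in> carrier R"
      using A[OF that(1)] that c by auto
    then show ?thesis using dots[OF that(1,2)] that(3) by simp
  qed
  have dr: "dot R (J - {c}) v (restrict y (J - {c})) = dot R (J - {c}) v y"
    if "v \<in> J \<rightarrow> carrier R" "y \<in> J \<rightarrow> carrier R" for v y
    using that by (intro dot_cong) auto
  have du: "dot R (J - {c}) v (y(c := \<zero>)) = dot R (J - {c}) v y"
    if "v \<in> J \<rightarrow> carrier R" "y \<in> J - {c} \<rightarrow> carrier R" for v y
    using that by (intro dot_cong) auto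
  have "bij_betw (\<lambda>y. restrict y (J - {c})) {y \<in> kern R I J A. dot R J (ind_vec R J {c}) y = \<zero>}
      (kern R I (J - {c}) A)"
  proof (rule bij_betw_byWitness[where f' = "\<lambda>z. z(c := \<zero>)"])
    show "\<forall>y\<in>{y \<in> kern R I J A. dot R J (ind_vec R J {c}) y = \<zero>}. (restrict y (J - {c}))(c := \<zero>) = y"
    proof
      fix y assume "y \<in> {y \<in> kern R I J A. dot R J (ind_vec R J {c}) y = \<zero>}"
      then have y: "y \<in> J \<rightarrow>\<^sub>E carrier R" "dot R J (ind_vec R J {c}) y = \<zero>" by (auto simp: kern_def)
      then have "y \<in> J \<rightarrow> carrier R" by auto
      then have "y c = \<zero>" using yc[of y] y(2) by simp
      then show "(restrict y (J - {c}))(c := \<zero>) = y"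
        using y(1) by (auto simp: fun_eq_iff restrict_def PiE_iff extensional_def)
    qed
    show "\<forall>z\<in>kern R I (J - {c}) A. restrict (z(c := \<zero>)) (J - {c}) = z"
      by (auto simp: kern_def fun_eq_iff restrict_def PiE_iff extensional_def)
    show "(\<lambda>y. restrict y (J - {c})) ` {y \<in> kern R I J A. dot R J (ind_vec R J {c}) y = \<zero>}
        \<subseteq> kern R I (J - {c}) A"
    proof (intro image_subsetI)
      fix y assume "y \<in> {y \<in> kern R I J A. dot R J (ind_vec R J {c}) y = \<zero>}"
      then have y: "y \<in> J \<rightarrow>\<^sub>E carrier R" "\<forall>a\<in>I. dot R J (A a) y = \<zero>" "dot R J (ind_vec R J {c}) y = \<zero>"
        by (auto simp: kern_def)
      then have y1: "y \<in> J \<rightarrow> carrier R" by auto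
      then have y': "y \<in> J \<rightarrow> carrier R" "y c = \<zero>" using yc[of y] y(3) by auto
      then show "restrict y (J - {c}) \<in> kern R I (J - {c}) A"
        using y(2) dz[OF _ y'] dr[OF A y'(1)] by (auto simp: kern_def)
    qed
    show "(\<lambda>z. z(c := \<zero>)) ` kern R I (J - {c}) A
        \<subseteq> {y \<in> kern R I J A. dot R J (ind_vec R J {c}) y = \<zero>}"
    proof (intro image_subsetI)
      fix z assume z: "z \<in> kern R I (J - {c}) A"
      then have z1: "z \<in> J - {c} \<rightarrow> carrier R" by (auto simp: kern_def)
      let ?y = "z(c := \<zero>)"
      have y1: "?y \<in> J \<rightarrow> carrier R" "?y c = \<zero>" using z1 by auto
      have "?y \<in> J \<rightarrow>\<^sub>E carrier R" using z c by (auto simp: kern_def PiE_iff extensional_def)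
      moreover have "dot R J (A a) ?y = \<zero>" if "a \<in> I" for a
      proof -
        have "dot R (J - {c}) (A a) z = \<zero>" using z that by (simp add: kern_def)
        then show ?thesis using dz[OF that y1] du[OF A[OF that] z1] by (simp only:)
      qed
      ultimately show "?y \<in> {y \<in> kern R I J A. dot R J (ind_vec R J {c}) y = \<zero>}"
        using yc[OF y1(1)] by (auto simp: kern_def)
    qed
  qed
  then show ?thesis by (rule bij_betw_same_card)
qed

text \<open>Deleting column \<open>c\<close> lowers the rank and the number of columns by one and
  leaves the kernel size \<open>k\<close> as it is, so the two conditions differ by a factor
  \<open>q\<close> on both sides.\<close>

lemma power_card_Diff_eq:
  assumes "finite J" "c \<in> J"
  shows "k * q ^ Suc i = q ^ card J \<longleftrightarrow> k * q ^ i = q ^ card (J - {c})"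
proof -
  have "card J = Suc (card (J - {c}))" using assms by (metis card.remove)
  then show ?thesis using q_gt_1 by auto
qed

text \<open>The entries of the deleted column are free wherever the board allows them, which gives
  one factor \<open>q\<close> for each row with a cell in column \<open>c\<close>.\<close>

lemma ext_rank_num_singleton:
  assumes fin: "finite I" "finite J" and c: "c \<in> J"
  shows "ext_rank_num R B (ind_vec R J {c}) I J (Suc i)
    = q ^ card {a \<in> I. (a, c) \<in> B} * rank_num R B I (J - {c}) i"
proof -
  let ?P = "\<lambda>A. card (kern R I (J - {c}) A) * q ^ i = q ^ card (J - {c})"
  have "card (kern R I (J - {c}) A) = card (kern R I (J - {c}) (\<lambda>a\<in>I. restrict (A a) (J - {c})))"
    if "A \<in> board_mats R B I J" for A
    using board_matsD[OF that] by (intro arg_cong[of _ _ card] kern_cong) (auto simp: Pi_iff)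
  moreover have "card {y \<in> kern R I J A. dot R J (ind_vec R J {c}) y = \<zero>} = card (kern R I (J - {c}) A)"
    if "A \<in> board_mats R B I J" for A
    using board_matsD[OF that] by (intro card_kern_delete fin c)
  ultimately have "{A \<in> board_mats R B I J.
      card {y \<in> kern R I J A. dot R J (ind_vec R J {c}) y = \<zero>} * q ^ Suc i = q ^ card J}
    = {A \<in> board_mats R B I J. ?P (\<lambda>a\<in>I. restrict (A a) (J - {c}))}"
    unfolding power_card_Diff_eq[OF fin(2) c] by auto
  then have "ext_rank_num R B (ind_vec R J {c}) I J (Suc i)
      = card {A \<in> board_mats R B I J. ?P (\<lambda>a\<in>I. restrict (A a) (J - {c}))}"
    unfolding ext_rank_num_def by simp
  also have "\<dots> = (\<Prod>a\<in>I. if (a, c) \<in> B then q else 1) * rank_num R B I (J - {c}) i"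
    unfolding rank_num_def board_mats_def
  proof (rule card_PiE_fibration)
    fix a v assume "v \<in> row_space R B J a"
    then show "restrict v (J - {c}) \<in> row_space R B (J - {c}) a" by (auto simp: row_space_def PiE_iff)
  next
    fix a w assume "w \<in> row_space R B (J - {c}) a"
    then show "card {v \<in> row_space R B J a. restrict v (J - {c}) = w} = (if (a, c) \<in> B then q else 1)"
      by (rule card_row_space_fibre_restrict[OF c])
  qed (use fin in auto)
  finally show ?thesis using fin by (simp only: prod_if_const)
qed

section \<open>A new row with two nonzero entries\<close>

definition merge_row :: "'j \<Rightarrow> 'j \<Rightarrow> 'j set \<Rightarrow> ('j \<Rightarrow> 'a) \<Rightarrow> 'j \<Rightarrow> 'a" where
  "merge_row c d J v = (\<lambda>j\<in>J - {c}. if j = d then v d \<ominus> v c else v j)"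

lemma merge_row_in_row_space:
  assumes c: "c \<in> J" and d: "d \<in> J" and cd: "c \<noteq> d" and v: "v \<in> row_space R B J a"
  shows "merge_row c d J v \<in> row_space R (merge_board c d B) (J - {c}) a"
proof (rule row_spaceI)
  fix j assume j: "j \<in> J - {c}"
  show "merge_row c d J v j \<in> (if (a, j) \<in> merge_board c d B then carrier R else {\<zero>})"
    using row_space_mem[OF v, of j] row_space_mem[OF v c] row_space_mem[OF v d] j
    by (auto simp: merge_row_def merge_board_def a_minus_def split: if_splits)
qed (auto simp: merge_row_def)

text \<open>Of the two entries only \<open>w d = v d - v c\<close> is known. If both cells are on
  the board, \<open>v c\<close> is arbitrary and determines \<open>v d\<close>; if exactly one is,
  its value is forced; if none is, \<open>w d\<close> vanishes because the merged board has no cell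
  there either.\<close>

lemma card_row_space_fibre_merge:
  assumes c: "c \<in> J" and d: "d \<in> J" and cd: "c \<noteq> d"
    and w: "w \<in> row_space R (merge_board c d B) (J - {c}) a"
  shows "card {v \<in> row_space R B J a. merge_row c d J v = w}
    = (if (a, c) \<in> B \<and> (a, d) \<in> B then q else 1)"
proof -
  let ?U = "if (a, c) \<in> B then if (a, d) \<in> B then carrier R else {\<ominus> w d} else {\<zero>}"
  let ?f = "\<lambda>u. w(c := u, d := w d \<oplus> u)"
  have d': "d \<in> J - {c}" using d cd by auto
  have wd: "w d \<in> carrier R" using row_space_mem[OF w d'] by (auto split: if_splits)
  have wd0: "w d = \<zero>" if "(a, c) \<notin> B" "(a, d) \<notin> B"
    using row_space_mem[OF w d'] that by (auto simp: merge_board_def split: if_splits)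
  have wj: "w j \<in> (if (a, j) \<in> B then carrier R else {\<zero>})" if "j \<in> J" "j \<noteq> c" "j \<noteq> d" for j
    using row_space_mem[OF w, of j] that by (auto simp: merge_board_def split: if_splits)
  have "{v \<in> row_space R B J a. merge_row c d J v = w} = ?f ` ?U"
  proof (intro equalityI subsetI)
    fix v assume "v \<in> {v \<in> row_space R B J a. merge_row c d J v = w}"
    then have v: "v \<in> row_space R B J a" and vw: "w = merge_row c d J v" by auto
    have vc: "v c \<in> carrier R" and vd: "v d \<in> carrier R"
      using row_space_mem[OF v c] row_space_mem[OF v d] by (auto split: if_splits)
    have wd_eq: "w d = v d \<ominus> v c" using d' by (simp add: vw merge_row_def)
    have "v c \<in> ?U"
      using row_space_mem[OF v c] row_space_mem[OF v d] vc wd_eq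
      by (auto simp: a_minus_def split: if_splits)
    moreover have "v = ?f (v c)"
    proof
      fix j
      consider "j = c" | "j = d" | "j \<in> J" "j \<noteq> c" "j \<noteq> d" | "j \<notin> J" "j \<noteq> c" "j \<noteq> d" by blast
      then show "v j = ?f (v c) j"
      proof cases
        case 2
        then show ?thesis using wd_eq vc vd by (simp add: a_minus_def a_assoc l_neg)
      qed (use v cd in \<open>auto simp: vw merge_row_def row_space_def PiE_iff extensional_def\<close>)
    qed
    ultimately show "v \<in> ?f ` ?U" by blast
  next
    fix v assume "v \<in> ?f ` ?U"
    then obtain u where u: "u \<in> ?U" and v: "v = ?f u" by blast
    have uc: "u \<in> carrier R" using u wd by (auto split: if_splits)
    have "v \<in> row_space R B J a"
    proof (rule row_spaceI)
      fix j assume j: "j \<in> J"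
      consider "j = c" | "j = d" | "j \<noteq> c" "j \<noteq> d" by blast
      then show "v j \<in> (if (a, j) \<in> B then carrier R else {\<zero>})"
      proof cases
        case 1
        then show ?thesis using u cd wd by (auto simp: v split: if_splits)
      next
        case 2
        then show ?thesis using u uc wd wd0 by (auto simp: v r_neg split: if_splits)
      next
        case 3
        then show ?thesis using wj[OF j] by (simp add: v)
      qed
    next
      fix j assume "j \<notin> J"
      then show "v j = undefined"
        using w c d by (auto simp: v row_space_def PiE_iff extensional_def)
    qed
    moreover have "merge_row c d J v = w"
    proof
      fix j
      consider "j = d" | "j \<in> J - {c}" "j \<noteq> d" | "j \<notin> J - {c}" using d' by blast
      then show "merge_row c d J v j = w j"
      proof cases
        case 1
        then show ?thesis using d' cd uc wd by (simp add: merge_row_def v a_minus_def a_assoc r_neg)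
      next
        case 3
        then show ?thesis using w d' by (auto simp: merge_row_def row_space_def PiE_iff extensional_def)
      qed (auto simp: merge_row_def v)
    qed
    ultimately show "v \<in> {v \<in> row_space R B J a. merge_row c d J v = w}" by blast
  qed
  moreover have "inj_on ?f ?U"
    by (rule inj_onI) (metis cd fun_upd_other fun_upd_same)
  ultimately show ?thesis by (simp add: card_image)
qed

text \<open>The appended equation \<open>y c + y d = 0\<close> allows \<open>y c\<close> to be
  replaced by \<open>\<ominus> y d\<close>, and \<open>A c y c + A d y d\<close> becomes
  \<open>(A d - A c) y d\<close>. This is why \<open>merge_row\<close> subtracts; on the level of
  boards the sign is invisible.\<close>

lemma card_kern_merge:
  assumes fin: "finite J" and c: "c \<in> J" and d: "d \<in> J" and cd: "c \<noteq> d"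
    and A: "\<And>a. a \<in> I \<Longrightarrow> A a \<in> J \<rightarrow> carrier R"
  shows "card {y \<in> kern R I J A. dot R J (ind_vec R J {c, d}) y = \<zero>}
    = card (kern R I (J - {c}) (\<lambda>a\<in>I. merge_row c d J (A a)))"
proof -
  let ?J = "J - {c}" and ?K = "J - {c} - {d}"
  have d': "d \<in> ?J" using d cd by auto
  let ?M = "\<lambda>a\<in>I. merge_row c d J (A a)"
  have yc: "dot R J (ind_vec R J {c, d}) y = y c \<oplus> y d" if "y \<in> J \<rightarrow> carrier R" for y
    using dot_ind_vec[OF fin, of "{c, d}" y] that c d cd by (auto simp: Pi_iff)
  have key: "dot R J (A a) y = dot R ?J (?M a) y"
    if a: "a \<in> I" and y: "y \<in> J \<rightarrow> carrier R" and eq: "y c = \<ominus> y d" for a y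
  proof -
    have cl: "A a c \<in> carrier R" "A a d \<in> carrier R" "y c \<in> carrier R" "y d \<in> carrier R"
      using A[OF a] y c d by auto
    have K: "A a \<in> ?K \<rightarrow> carrier R" "y \<in> ?K \<rightarrow> carrier R" "y \<in> ?J \<rightarrow> carrier R"
      "A a \<in> ?J \<rightarrow> carrier R" using A[OF a] y by auto
    have M: "?M a \<in> ?J \<rightarrow> carrier R" "?M a \<in> ?K \<rightarrow> carrier R"
      using A[OF a] a c d by (auto simp: merge_row_def Pi_iff)
    have "dot R J (A a) y = A a c \<otimes> y c \<oplus> dot R ?J (A a) y"
      using dot_insert[of ?J c "A a" y] fin A[OF a] y by (simp add: insert_absorb[OF c])
    also have "dot R ?J (A a) y = A a d \<otimes> y d \<oplus> dot R ?K (A a) y"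
      using dot_insert[of ?K d "A a" y] fin K cl by (simp add: insert_absorb[OF d'])
    also have "dot R ?K (A a) y = dot R ?K (?M a) y"
      using M K a by (intro dot_cong) (auto simp: merge_row_def)
    also have "A a c \<otimes> y c \<oplus> (A a d \<otimes> y d \<oplus> dot R ?K (?M a) y)
        = ?M a d \<otimes> y d \<oplus> dot R ?K (?M a) y"
    proof -
      have D: "dot R ?K (?M a) y \<in> carrier R" using M K by simp
      have Md: "?M a d = A a d \<ominus> A a c" using a d' by (simp add: merge_row_def)
      have "A a c \<otimes> y c \<oplus> A a d \<otimes> y d = (A a d \<ominus> A a c) \<otimes> y d"
        using cl(1,2,4) by (simp add: eq a_minus_def l_distr r_minus l_minus a_comm)
      then show ?thesis using D cl Md by (simp add: a_assoc[symmetric])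
    qed
    also have "\<dots> = dot R ?J (?M a) y"
      using dot_insert[of ?K d "?M a" y] fin K cl M a d' by (simp add: insert_absorb[OF d'] Pi_iff)
    finally show ?thesis .
  qed
  have Mc: "?M a \<in> ?J \<rightarrow> carrier R" if "a \<in> I" for a
    using A[OF that] that c d by (auto simp: merge_row_def Pi_iff)
  have dr: "dot R ?J v (restrict y ?J) = dot R ?J v y"
    if "v \<in> ?J \<rightarrow> carrier R" "y \<in> J \<rightarrow> carrier R" for v y
    using that by (intro dot_cong) auto
  have du: "dot R ?J v (z(c := u)) = dot R ?J v z"
    if "v \<in> ?J \<rightarrow> carrier R" "z \<in> ?J \<rightarrow> carrier R" for v z u
    using that by (intro dot_cong) auto
  let ?S = "{y \<in> kern R I J A. dot R J (ind_vec R J {c, d}) y = \<zero>}"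
  have SD: "y \<in> J \<rightarrow>\<^sub>E carrier R" "y \<in> J \<rightarrow> carrier R" "y c = \<ominus> y d" if "y \<in> ?S" for y
  proof -
    show 1: "y \<in> J \<rightarrow>\<^sub>E carrier R" "y \<in> J \<rightarrow> carrier R" using that by (auto simp: kern_def)
    then have "y c \<oplus> y d = \<zero>" using yc[of y] that by simp
    moreover have "y c \<in> carrier R" "y d \<in> carrier R" using 1(2) c d by auto
    ultimately show "y c = \<ominus> y d" by (metis minus_equality)
  qed
  have "bij_betw (\<lambda>y. restrict y ?J) ?S (kern R I ?J ?M)"
  proof (rule bij_betw_byWitness[where f' = "\<lambda>z. z(c := \<ominus> z d)"])
    show "\<forall>y\<in>?S. (restrict y ?J)(c := \<ominus> restrict y ?J d) = y"
    proof
      fix y assume y: "y \<in> ?S"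
      have "((restrict y ?J)(c := \<ominus> restrict y ?J d)) j = y j" for j
        using SD(1,3)[OF y] d' by (auto simp: PiE_iff extensional_def)
      then show "(restrict y ?J)(c := \<ominus> restrict y ?J d) = y" by blast
    qed
    show "\<forall>z\<in>kern R I ?J ?M. restrict (z(c := \<ominus> z d)) ?J = z"
    proof
      fix z assume "z \<in> kern R I ?J ?M"
      then have "z \<in> extensional ?J" by (simp add: kern_def PiE_iff)
      then have "restrict (z(c := \<ominus> z d)) ?J j = z j" for j by (auto simp: extensional_def)
      then show "restrict (z(c := \<ominus> z d)) ?J = z" by blast
    qed
    show "(\<lambda>y. restrict y ?J) ` ?S \<subseteq> kern R I ?J ?M"
    proof (intro image_subsetI)
      fix y assume y: "y \<in> ?S"
      have "dot R ?J (?M a) (restrict y ?J) = \<zero>" if "a \<in> I" for a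
      proof -
        have "dot R J (A a) y = \<zero>" using y that by (simp add: kern_def)
        then show ?thesis using dr[OF Mc[OF that] SD(2)[OF y]] key[OF that SD(2,3)[OF y]] by metis
      qed
      moreover have "restrict y ?J \<in> ?J \<rightarrow>\<^sub>E carrier R" using SD(2)[OF y] by auto
      ultimately show "restrict y ?J \<in> kern R I ?J ?M"
        unfolding kern_def by (intro CollectI conjI ballI)
    qed
    show "(\<lambda>z. z(c := \<ominus> z d)) ` kern R I ?J ?M \<subseteq> ?S"
    proof (intro image_subsetI)
      fix z assume z: "z \<in> kern R I ?J ?M"
      then have z1: "z \<in> ?J \<rightarrow> carrier R" and z2: "z \<in> extensional ?J" and zd: "z d \<in> carrier R"
        using d' by (auto simp: kern_def PiE_iff)
      define y where "y = z(c := \<ominus> z d)"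
      have y1: "y \<in> J \<rightarrow> carrier R" using z1 zd by (auto simp: y_def)
      have yeq: "y c = \<ominus> y d" using cd by (simp add: y_def)
      have "y \<in> extensional J" using z2 c by (auto simp: extensional_def y_def)
      with y1 have "y \<in> J \<rightarrow>\<^sub>E carrier R" by (simp add: PiE_def)
      moreover have "dot R J (A a) y = \<zero>" if "a \<in> I" for a
      proof -
        have "dot R ?J (?M a) z = \<zero>" using z that unfolding kern_def by blast
        then show ?thesis using key[OF that y1 yeq] du[OF Mc[OF that] z1] unfolding y_def by metis
      qed
      moreover have "dot R J (ind_vec R J {c, d}) y = \<zero>"
        using yc[OF y1] yeq zd cd by (simp add: y_def l_neg)
      ultimately have "y \<in> ?S" unfolding kern_def by (intro CollectI conjI ballI)
      then show "z(c := \<ominus> z d) \<in> ?S" unfolding y_def .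
    qed
  qed
  then show ?thesis by (rule bij_betw_same_card)
qed

text \<open>Merging loses information only in rows with both cells on the board, each giving a
  factor \<open>q\<close>. The price is a new board, so an induction over rows cannot keep
  \<open>B\<close> fixed.\<close>

lemma ext_rank_num_pair:
  assumes fin: "finite I" "finite J" and c: "c \<in> J" and d: "d \<in> J" and cd: "c \<noteq> d"
  shows "ext_rank_num R B (ind_vec R J {c, d}) I J (Suc i)
    = q ^ card {a \<in> I. (a, c) \<in> B \<and> (a, d) \<in> B} * rank_num R (merge_board c d B) I (J - {c}) i"
proof -
  let ?P = "\<lambda>A. card (kern R I (J - {c}) A) * q ^ i = q ^ card (J - {c})"
  have "card {y \<in> kern R I J A. dot R J (ind_vec R J {c, d}) y = \<zero>}
      = card (kern R I (J - {c}) (\<lambda>a\<in>I. merge_row c d J (A a)))" if "A \<in> board_mats R B I J" for A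
    using board_matsD[OF that] by (intro card_kern_merge fin c d cd)
  then have "{A \<in> board_mats R B I J.
      card {y \<in> kern R I J A. dot R J (ind_vec R J {c, d}) y = \<zero>} * q ^ Suc i = q ^ card J}
    = {A \<in> board_mats R B I J. ?P (\<lambda>a\<in>I. merge_row c d J (A a))}"
    unfolding power_card_Diff_eq[OF fin(2) c] by auto
  then have "ext_rank_num R B (ind_vec R J {c, d}) I J (Suc i)
      = card {A \<in> board_mats R B I J. ?P (\<lambda>a\<in>I. merge_row c d J (A a))}"
    unfolding ext_rank_num_def by simp
  also have "\<dots> = (\<Prod>a\<in>I. if (a, c) \<in> B \<and> (a, d) \<in> B then q else 1)
      * rank_num R (merge_board c d B) I (J - {c}) i"
    unfolding rank_num_def board_mats_def
  proof (rule card_PiE_fibration)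
    fix a w assume "w \<in> row_space R (merge_board c d B) (J - {c}) a"
    then show "card {v \<in> row_space R B J a. merge_row c d J v = w}
        = (if (a, c) \<in> B \<and> (a, d) \<in> B then q else 1)"
      by (rule card_row_space_fibre_merge[OF c d cd])
  qed (use fin merge_row_in_row_space[OF c d cd] in auto)
  finally show ?thesis using fin by (simp only: prod_if_const)
qed

text \<open>Rank zero means that the kernel is the whole space; testing the equations on unit
  vectors then shows that every entry is zero.\<close>

lemma rank_num_0:
  assumes fin: "finite I" "finite J"
  shows "rank_num R B I J 0 = 1"
proof -
  let ?Z = "\<lambda>a\<in>I. \<lambda>j\<in>J. \<zero>"
  have cF: "card (J \<rightarrow>\<^sub>E carrier R) = q ^ card J" using fin by (simp add: card_PiE)
  have finF: "finite (J \<rightarrow>\<^sub>E carrier R)" using fin by (auto intro!: finite_PiE)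
  have ksub: "kern R I J A \<subseteq> J \<rightarrow>\<^sub>E carrier R" for A by (auto simp: kern_def)
  have "{A \<in> board_mats R B I J. card (kern R I J A) * q ^ 0 = q ^ card J} = {?Z}"
  proof (intro equalityI subsetI)
    fix A assume A': "A \<in> {A \<in> board_mats R B I J. card (kern R I J A) * q ^ 0 = q ^ card J}"
    then have A: "A \<in> board_mats R B I J" and "card (kern R I J A) = card (J \<rightarrow>\<^sub>E carrier R)"
      by (auto simp: cF)
    then have full: "kern R I J A = J \<rightarrow>\<^sub>E carrier R" using card_subset_eq[OF finF ksub] by blast
    have zero: "A a c = \<zero>" if a: "a \<in> I" and c: "c \<in> J" for a c
    proof -
      have cl: "A a \<in> J \<rightarrow> carrier R" using board_matsD[OF A a] .
      have "dot R J (A a) (ind_vec R J {c}) = (\<Oplus>j\<in>{c}. A a j)"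
        unfolding dot_def
        by (rule add.finprod_mono_neutral_cong_right)
          (use cl c fin in \<open>auto simp: ind_vec_def Pi_iff\<close>)
      also have "\<dots> = A a c" using cl c by (auto simp: Pi_iff)
      finally have "A a c = dot R J (A a) (ind_vec R J {c})" ..
      also have "ind_vec R J {c} \<in> kern R I J A" unfolding full by (auto simp: ind_vec_def)
      then have "dot R J (A a) (ind_vec R J {c}) = \<zero>" using a by (simp add: kern_def)
      finally show ?thesis .
    qed
    have "A a j = ?Z a j" for a j
    proof -
      consider "a \<notin> I" | "a \<in> I" "j \<notin> J" | "a \<in> I" "j \<in> J" by blast
      then show ?thesis
      proof cases
        case 1
        then show ?thesis using A by (simp add: board_mats_def PiE_iff extensional_def)
      next
        case 2
        then have "A a \<in> row_space R B J a" using A by (auto simp: board_mats_def)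
        then show ?thesis using 2 by (simp add: row_space_def PiE_iff extensional_def)
      qed (simp add: zero)
    qed
    then show "A \<in> {?Z}" by blast
  next
    fix A assume "A \<in> {?Z}"
    then have A: "A = ?Z" by simp
    have "dot R J (?Z a) y = \<zero>" if "a \<in> I" "y \<in> J \<rightarrow>\<^sub>E carrier R" for a y
      unfolding dot_def using PiE_mem[OF that(2)] that(1) by (intro add.finprod_one_eqI) simp
    then have "kern R I J A = J \<rightarrow>\<^sub>E carrier R" unfolding A kern_def by blast
    moreover have "A \<in> board_mats R B I J" unfolding A board_mats_def row_space_def by auto
    ultimately show "A \<in> {A \<in> board_mats R B I J. card (kern R I J A) * q ^ 0 = q ^ card J}"
      by (simp add: cF)
  qed
  then show ?thesis unfolding rank_num_def by simp
qed

end

section \<open>Divisibility of counts by powers of \<open>q - 1\<close> through scaling of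
  rows\<close>

context finite_field
begin

text \<open>The nonzero scalars act freely on the nonzero vectors, which therefore split into orbits
  of \<open>q - 1\<close> elements; on each orbit \<open>g\<close> is constant with a value
  divisible by \<open>d\<close>.\<close>

lemma sum_scaling_dvd:
  fixes g :: "('j \<Rightarrow> 'a) \<Rightarrow> nat"
  assumes J: "finite J"
    and inv_g: "\<And>u v. u \<in> carrier R - {\<zero>} \<Longrightarrow> v \<in> J \<rightarrow>\<^sub>E carrier R \<Longrightarrow> g (\<lambda>j\<in>J. u \<otimes> v j) = g v"
    and dvd: "\<And>v. v \<in> (J \<rightarrow>\<^sub>E carrier R) - {\<lambda>j\<in>J. \<zero>} \<Longrightarrow> d dvd g v"
  shows "(q - 1) * d dvd (\<Sum>v\<in>(J \<rightarrow>\<^sub>E carrier R) - {\<lambda>j\<in>J. \<zero>}. g v)"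
proof -
  let ?V = "(J \<rightarrow>\<^sub>E carrier R) - {\<lambda>j\<in>J. \<zero>}" and ?s = "\<lambda>u v. \<lambda>j\<in>J. u \<otimes> v j"
  let ?C = "carrier R - {\<zero>}"
  define orb where "orb v = (\<lambda>u. ?s u v) ` ?C" for v
  have finV: "finite ?V" using J by (auto intro!: finite_PiE)
  have U: "u \<in> Units R" if "u \<in> ?C" for u using that by (simp add: field_Units)
  have s1: "?s \<one> v = v" if "v \<in> ?V" for v
  proof
    fix j show "?s \<one> v j = v j" using that by (cases "j \<in> J") (auto simp: PiE_iff extensional_def)
  qed
  have ss: "?s u (?s u' v) = ?s (u \<otimes> u') v" if "u \<in> ?C" "u' \<in> ?C" "v \<in> ?V" for u u' v
  proof
    fix j show "?s u (?s u' v) j = ?s (u \<otimes> u') v j"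
      using that by (cases "j \<in> J") (auto simp: PiE_iff m_assoc)
  qed
  have nz: "\<exists>j\<in>J. v j \<in> ?C" if "v \<in> ?V" for v
  proof (rule ccontr)
    assume neg: "\<not> (\<exists>j\<in>J. v j \<in> ?C)"
    have "v j = (\<lambda>j\<in>J. \<zero>) j" for j
      using that neg by (cases "j \<in> J") (auto simp: PiE_iff extensional_def)
    then have "v = (\<lambda>j\<in>J. \<zero>)" by blast
    then show False using that by blast
  qed
  have inj: "inj_on (\<lambda>u. ?s u v) ?C" if v: "v \<in> ?V" for v
  proof (rule inj_onI)
    fix u u' assume u: "u \<in> ?C" "u' \<in> ?C" "?s u v = ?s u' v"
    obtain j where j: "j \<in> J" "v j \<in> ?C" using nz[OF v] by blast
    then have "u \<otimes> v j = u' \<otimes> v j" using fun_cong[OF u(3), of j] by simp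
    then show "u = u'" using u j m_rcancel[of "v j" u u'] by auto
  qed
  have sV: "?s u v \<in> ?V" if u: "u \<in> ?C" and v: "v \<in> ?V" for u v
  proof -
    obtain j where j: "j \<in> J" "v j \<in> ?C" using nz[OF v] by blast
    then have "?s u v j \<noteq> \<zero>" using u by (auto simp: integral_iff)
    then have "?s u v \<noteq> (\<lambda>j\<in>J. \<zero>)" using j by (metis restrict_apply')
    moreover have "?s u v \<in> J \<rightarrow>\<^sub>E carrier R" using u v by (auto simp: PiE_iff)
    ultimately show ?thesis by blast
  qed
  have orb_eq: "orb (?s u v) = orb v" if u: "u \<in> ?C" and v: "v \<in> ?V" for u v
  proof
    show "orb (?s u v) \<subseteq> orb v"
    proof
      fix w assume "w \<in> orb (?s u v)"
      then obtain t where t: "t \<in> ?C" "w = ?s t (?s u v)" unfolding orb_def by blast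
      then have "w = ?s (t \<otimes> u) v" using ss[OF t(1) u v] by simp
      moreover have "t \<otimes> u \<in> ?C" using t u by (auto simp: integral_iff)
      ultimately show "w \<in> orb v" unfolding orb_def by blast
    qed
    show "orb v \<subseteq> orb (?s u v)"
    proof
      fix w assume "w \<in> orb v"
      then obtain t where t: "t \<in> ?C" "w = ?s t v" unfolding orb_def by blast
      have iu: "inv u \<in> Units R" using U[OF u] by simp
      then have tu: "t \<otimes> inv u \<in> ?C" using t by (auto simp: integral_iff field_Units)
      have "t \<otimes> inv u \<otimes> u = t" using t U[OF u] by (simp add: m_assoc Units_closed)
      then have "w = ?s (t \<otimes> inv u) (?s u v)" using ss[OF tu u v] t(2) by simp
      then show "w \<in> orb (?s u v)" using tu unfolding orb_def by blast
    qed
  qed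
  have fibre: "{w \<in> ?V. orb w = orb v} = orb v" if v: "v \<in> ?V" for v
  proof (intro equalityI subsetI)
    fix w assume w: "w \<in> {w \<in> ?V. orb w = orb v}"
    then have "w \<in> orb w" unfolding orb_def using s1[of w] by (intro image_eqI[of _ _ \<one>]) auto
    then show "w \<in> orb v" using w by simp
  next
    fix w assume "w \<in> orb v"
    then obtain t where t: "t \<in> ?C" "w = ?s t v" unfolding orb_def by blast
    then show "w \<in> {w \<in> ?V. orb w = orb v}" using sV[OF t(1) v] orb_eq[OF t(1) v] by simp
  qed
  have "(\<Sum>v\<in>?V. g v) = (\<Sum>Q\<in>orb ` ?V. \<Sum>w\<in>{w \<in> ?V. orb w = Q}. g w)"
    using finV by (rule sum.image_gen)
  moreover have "(q - 1) * d dvd (\<Sum>w\<in>{w \<in> ?V. orb w = Q}. g w)" if "Q \<in> orb ` ?V" for Q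
  proof -
    from that obtain v where v: "v \<in> ?V" "Q = orb v" by blast
    have "(\<Sum>w\<in>{w \<in> ?V. orb w = Q}. g w) = (\<Sum>w\<in>orb v. g w)" using v fibre[OF v(1)] by simp
    also have "\<dots> = (\<Sum>u\<in>?C. g (?s u v))" unfolding orb_def by (simp add: sum.reindex[OF inj[OF v(1)]])
    also have "\<dots> = (\<Sum>u\<in>?C. g v)" using v inv_g by (intro sum.cong) auto
    also have "\<dots> = (q - 1) * g v" by simp
    finally show ?thesis using dvd[OF v(1)] by (simp add: mult_dvd_mono)
  qed
  ultimately show ?thesis by (simp add: dvd_sum)
qed

text \<open>Nonzero scalars act on each row independently, and freely on nonzero rows. In the
  induction, if row \<open>x\<close> is zero, the other rows still include \<open>k\<close> nonzero
  ones; if it is not, its orbit supplies one factor \<open>q - 1\<close>, and \<open>k - 1\<close>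
  nonzero rows remain to be used.\<close>

lemma row_scaling_dvd:
  assumes "finite I" and J: "finite J"
    and "\<C> \<subseteq> I \<rightarrow>\<^sub>E (J \<rightarrow>\<^sub>E carrier R)"
    and "\<And>A a u. A \<in> \<C> \<Longrightarrow> a \<in> I \<Longrightarrow> u \<in> carrier R - {\<zero>} \<Longrightarrow> A(a := \<lambda>j\<in>J. u \<otimes> A a j) \<in> \<C>"
    and "\<And>A. A \<in> \<C> \<Longrightarrow> k \<le> card {a \<in> I. A a \<noteq> (\<lambda>j\<in>J. \<zero>)}"
  shows "(q - 1) ^ k dvd card \<C>"
  using assms(1,3-)
proof (induction I arbitrary: \<C> k rule: finite_induct)
  case empty
  show ?case
  proof (cases "\<C> = {}")
    case False
    then have "k = 0" using empty.prems(3) by fastforce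
    then show ?thesis by simp
  qed simp
next
  case (insert x I)
  let ?V = "J \<rightarrow>\<^sub>E carrier R" and ?z = "\<lambda>j\<in>J. \<zero>"
  define D where "D v = {A \<in> I \<rightarrow>\<^sub>E ?V. A(x := v) \<in> \<C>}" for v
  have finV: "finite ?V" using J by (auto intro!: finite_PiE)
  have finI: "finite (I \<rightarrow>\<^sub>E ?V)" using insert.hyps finV by (auto intro!: finite_PiE)
  have finD: "finite (D v)" for v unfolding D_def using finI by simp
  have C_eq: "\<C> = (\<lambda>(v, A). A(x := v)) ` (SIGMA v:?V. D v)"
  proof (intro equalityI subsetI)
    fix A assume A: "A \<in> \<C>"
    then have "A \<in> (\<lambda>(v, A). A(x := v)) ` (?V \<times> (I \<rightarrow>\<^sub>E ?V))"
      using insert.prems(1) by (auto simp: PiE_insert_eq)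
    then obtain v A' where "v \<in> ?V" "A' \<in> I \<rightarrow>\<^sub>E ?V" "A = A'(x := v)" by auto
    then show "A \<in> (\<lambda>(v, A). A(x := v)) ` (SIGMA v:?V. D v)" using A unfolding D_def by force
  qed (auto simp: D_def)
  have "inj_on (\<lambda>(v, A). A(x := v)) (SIGMA v:?V. D v)"
    using inj_combinator[OF insert.hyps(2), of "\<lambda>_. ?V"] by (rule inj_on_subset) (auto simp: D_def)
  then have "card \<C> = card (SIGMA v:?V. D v)" using C_eq by (simp add: card_image)
  also have "\<dots> = (\<Sum>v\<in>?V. card (D v))" using finV finD by (simp add: card_SigmaI)
  also have "\<dots> = card (D ?z) + (\<Sum>v\<in>?V - {?z}. card (D v))"
    using finV by (intro sum.remove) auto
  finally have card_C: "card \<C> = card (D ?z) + (\<Sum>v\<in>?V - {?z}. card (D v))" .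
  have scale: "A(a := \<lambda>j\<in>J. u \<otimes> A a j) \<in> D v"
    if "A \<in> D v" "a \<in> I" "u \<in> carrier R - {\<zero>}" "v \<in> ?V" for A a u v
  proof -
    have ax: "a \<noteq> x" using that insert.hyps by auto
    have "A a \<in> ?V" using that by (auto simp: D_def)
    then have row: "(\<lambda>j\<in>J. u \<otimes> A a j) \<in> ?V" using that by (auto simp: PiE_iff)
    have "A(x := v) \<in> \<C>" using that by (simp add: D_def)
    then have "(A(x := v))(a := \<lambda>j\<in>J. u \<otimes> (A(x := v)) a j) \<in> \<C>"
      by (rule insert.prems(2)) (use that in auto)
    moreover have "(A(x := v))(a := \<lambda>j\<in>J. u \<otimes> (A(x := v)) a j) = (A(a := \<lambda>j\<in>J. u \<otimes> A a j))(x := v)"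
      using ax by (simp add: fun_upd_twist)
    moreover have "A(a := \<lambda>j\<in>J. u \<otimes> A a j) \<in> I \<rightarrow>\<^sub>E ?V"
      using that row unfolding D_def PiE_iff extensional_def by auto
    ultimately show ?thesis by (simp add: D_def)
  qed
  have nzrows: "k \<le> card {a \<in> I. A a \<noteq> ?z} + (if v = ?z then 0 else 1)" if "A \<in> D v" for A v
  proof -
    have "A(x := v) \<in> \<C>" using that by (simp add: D_def)
    then have "k \<le> card {a \<in> insert x I. (A(x := v)) a \<noteq> ?z}"
      by (rule insert.prems(3))
    also have "{a \<in> insert x I. (A(x := v)) a \<noteq> ?z} \<subseteq> {a \<in> I. A a \<noteq> ?z} \<union> (if v = ?z then {} else {x})"
      by auto
    then have "card {a \<in> insert x I. (A(x := v)) a \<noteq> ?z}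
        \<le> card ({a \<in> I. A a \<noteq> ?z} \<union> (if v = ?z then {} else {x}))"
      using insert.hyps by (intro card_mono) auto
    also have "\<dots> \<le> card {a \<in> I. A a \<noteq> ?z} + card (if v = ?z then {} else {x})" by (rule card_Un_le)
    finally show ?thesis by (auto split: if_splits)
  qed
  have "(q - 1) ^ k dvd card (D ?z)"
  proof (rule insert.IH)
    show "D ?z \<subseteq> I \<rightarrow>\<^sub>E ?V" by (auto simp only: D_def)
  next
    fix A a u assume "A \<in> D ?z" "a \<in> I" "u \<in> carrier R - {\<zero>}"
    then show "A(a := \<lambda>j\<in>J. u \<otimes> A a j) \<in> D ?z" by (rule scale) auto
  next
    fix A assume "A \<in> D ?z"
    from nzrows[OF this] show "k \<le> card {a \<in> I. A a \<noteq> ?z}" by simp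
  qed
  moreover have "(q - 1) ^ k dvd (\<Sum>v\<in>?V - {?z}. card (D v))"
  proof (cases k)
    case (Suc l)
    have "(q - 1) * (q - 1) ^ l dvd (\<Sum>v\<in>?V - {?z}. card (D v))"
    proof (rule sum_scaling_dvd[OF J])
      fix v assume v: "v \<in> ?V - {?z}"
      show "(q - 1) ^ l dvd card (D v)"
      proof (rule insert.IH)
        show "D v \<subseteq> I \<rightarrow>\<^sub>E ?V" by (auto simp only: D_def)
      next
        fix A a u assume "A \<in> D v" "a \<in> I" "u \<in> carrier R - {\<zero>}"
        then show "A(a := \<lambda>j\<in>J. u \<otimes> A a j) \<in> D v" by (rule scale) (use v in blast)
      next
        fix A assume "A \<in> D v"
        moreover have "v \<noteq> ?z" using v by blast
        ultimately show "l \<le> card {a \<in> I. A a \<noteq> ?z}" using nzrows[of A v] Suc by simp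
      qed
    next
      fix u v assume u: "u \<in> carrier R - {\<zero>}" and v: "v \<in> ?V"
      have sub: "D v \<subseteq> D (\<lambda>j\<in>J. u \<otimes> v j)" if u: "u \<in> carrier R - {\<zero>}" for u v
      proof
        fix A assume A: "A \<in> D v"
        then have "A(x := v) \<in> \<C>" by (simp add: D_def)
        then have "(A(x := v))(x := \<lambda>j\<in>J. u \<otimes> (A(x := v)) x j) \<in> \<C>"
          by (rule insert.prems(2)) (use u in auto)
        then show "A \<in> D (\<lambda>j\<in>J. u \<otimes> v j)" using A by (simp add: D_def)
      qed
      have uU: "u \<in> Units R" using u by (simp add: field_Units)
      have iu: "inv u \<in> carrier R - {\<zero>}" using uU by (metis Units_inv_Units field_Units)
      have "(\<lambda>j\<in>J. inv u \<otimes> (\<lambda>j\<in>J. u \<otimes> v j) j) j = v j" for j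
      proof (cases "j \<in> J")
        case True
        then have "inv u \<otimes> (u \<otimes> v j) = v j"
          using v uU by (subst m_assoc[symmetric]) (auto simp: PiE_iff Units_closed)
        then show ?thesis using True by simp
      qed (use v in \<open>auto simp: PiE_iff extensional_def\<close>)
      then have "(\<lambda>j\<in>J. inv u \<otimes> (\<lambda>j\<in>J. u \<otimes> v j) j) = v" by blast
      then have "D (\<lambda>j\<in>J. u \<otimes> v j) \<subseteq> D v" using sub[OF iu, of "\<lambda>j\<in>J. u \<otimes> v j"] by simp
      then show "card (D (\<lambda>j\<in>J. u \<otimes> v j)) = card (D v)" using sub[OF u, of v] by simp
    qed
    then show ?thesis by (simp add: Suc)
  qed simp
  ultimately show ?case unfolding card_C by simp
qed


text \<open>The kernel splits into fibres over the \<open>q\<close> possible values of the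
  additional linear form, and each nonempty fibre is a translate of the one over zero.\<close>

lemma card_kern_le:
  assumes J: "finite J" and A: "\<And>a. a \<in> I \<Longrightarrow> A a \<in> J \<rightarrow> carrier R" and v: "v \<in> J \<rightarrow> carrier R"
  shows "card (kern R I J A) \<le> q * card {y \<in> kern R I J A. dot R J v y = \<zero>}"
proof -
  \<comment> \<open>The additional row gets the index \<open>None\<close>, so that the description
    of fibres applies to the system that includes \<open>v\<close>.\<close>
  let ?K = "kern R I J A" and ?A = "case_option v A" and ?I = "insert None (Some ` I)"
  have K0: "kern R ?I J ?A = {y \<in> ?K. dot R J v y = \<zero>}" by (auto simp: kern_def)
  have "dot R J v y \<in> carrier R" if "y \<in> ?K" for y
    using that v by (intro dot_closed) (auto simp: kern_def)
  then have "?K = (\<Union>t\<in>carrier R. {y \<in> ?K. dot R J v y = t})" by auto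
  then have "card ?K \<le> (\<Sum>t\<in>carrier R. card {y \<in> ?K. dot R J v y = t})"
    using card_UN_le[OF finite_carrier, of "\<lambda>t. {y \<in> ?K. dot R J v y = t}"] by simp
  also have "\<dots> \<le> (\<Sum>t\<in>carrier R. card {y \<in> ?K. dot R J v y = \<zero>})"
  proof (rule sum_mono)
    fix t
    show "card {y \<in> ?K. dot R J v y = t} \<le> card {y \<in> ?K. dot R J v y = \<zero>}"
    proof (cases "{y \<in> ?K. dot R J v y = t} = {}")
      case False
      then obtain y where y: "y \<in> ?K" "dot R J v y = t" by blast
      then have yE: "y \<in> J \<rightarrow>\<^sub>E carrier R" by (simp add: kern_def)
      have A': "?A a \<in> J \<rightarrow> carrier R" if "a \<in> ?I" for a
      proof (cases a)
        case (Some b)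
        then show ?thesis using that A[of b] by (simp add: image_iff)
      qed (simp add: v)
      have "{y \<in> ?K. dot R J v y = t}
          = {z \<in> J \<rightarrow>\<^sub>E carrier R. \<forall>a\<in>?I. dot R J (?A a) z = dot R J (?A a) y}"
        using y by (auto simp: kern_def)
      then show ?thesis
        using card_fibre_dot[of J ?I ?A y, OF J A' yE] unfolding K0 by (simp only: order_refl)
    next
      case True
      then show ?thesis by (metis card.empty zero_le)
    qed
  qed
  also have "\<dots> = q * card {y \<in> ?K. dot R J v y = \<zero>}" by simp
  finally show ?thesis .
qed

text \<open>A nonzero row costs at most one factor \<open>q\<close>, a zero row none. In terms of
  rank: it is at most the number of nonzero rows.\<close>

lemma card_kern_ge:
  assumes "finite I" and J: "finite J" and "\<And>a. a \<in> I \<Longrightarrow> A a \<in> J \<rightarrow>\<^sub>E carrier R"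
  shows "q ^ card J \<le> q ^ card {a \<in> I. A a \<noteq> (\<lambda>j\<in>J. \<zero>)} * card (kern R I J A)"
  using assms(1,3)
proof (induction I rule: finite_induct)
  case empty
  then show ?case using J by (simp add: kern_def card_PiE)
next
  case (insert x I)
  have IH: "q ^ card J \<le> q ^ card {a \<in> I. A a \<noteq> (\<lambda>j\<in>J. \<zero>)} * card (kern R I J A)"
    using insert.IH insert.prems by blast
  have Ac: "A a \<in> J \<rightarrow> carrier R" if "a \<in> insert x I" for a using insert.prems[OF that] by auto
  have kern_eq: "kern R (insert x I) J A = {y \<in> kern R I J A. dot R J (A x) y = \<zero>}"
    by (auto simp: kern_def)
  show ?case
  proof (cases "A x = (\<lambda>j\<in>J. \<zero>)")
    case True
    have "dot R J (A x) y = \<zero>" if "y \<in> kern R I J A" for y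
    proof -
      have "y j \<in> carrier R" if "j \<in> J" for j
        using \<open>y \<in> kern R I J A\<close> that by (auto simp: kern_def)
      then show ?thesis
        unfolding dot_def True by (intro add.finprod_one_eqI) simp
    qed
    then have "kern R (insert x I) J A = kern R I J A" unfolding kern_eq by blast
    moreover have "{a \<in> insert x I. A a \<noteq> (\<lambda>j\<in>J. \<zero>)} = {a \<in> I. A a \<noteq> (\<lambda>j\<in>J. \<zero>)}" using True by blast
    ultimately show ?thesis using IH by (simp only:)
  next
    case False
    have "{a \<in> insert x I. A a \<noteq> (\<lambda>j\<in>J. \<zero>)} = insert x {a \<in> I. A a \<noteq> (\<lambda>j\<in>J. \<zero>)}" using False by blast
    then have card_eq: "card {a \<in> insert x I. A a \<noteq> (\<lambda>j\<in>J. \<zero>)} = Suc (card {a \<in> I. A a \<noteq> (\<lambda>j\<in>J. \<zero>)})"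
      using insert.hyps by simp
    have "card (kern R I J A) \<le> q * card (kern R (insert x I) J A)"
      unfolding kern_eq using Ac by (intro card_kern_le J) auto
    then have "q ^ card {a \<in> I. A a \<noteq> (\<lambda>j\<in>J. \<zero>)} * card (kern R I J A)
        \<le> q ^ card {a \<in> I. A a \<noteq> (\<lambda>j\<in>J. \<zero>)} * (q * card (kern R (insert x I) J A))"
      by (rule mult_le_mono2)
    also have "\<dots> = q ^ Suc (card {a \<in> I. A a \<noteq> (\<lambda>j\<in>J. \<zero>)}) * card (kern R (insert x I) J A)"
      by simp
    finally show ?thesis using IH unfolding card_eq by (rule order_trans[rotated])
  qed
qed

text \<open>Rank \<open>Suc i\<close> with \<open>v\<close> appended forces at least
  \<open>i\<close> nonzero rows among those indexed by \<open>I\<close>, and scaling them does not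
  change the kernel. The row \<open>v\<close> itself is not scaled, hence the exponent
  \<open>i\<close> and not \<open>Suc i\<close>.\<close>

lemma ext_rank_num_dvd:
  assumes fin: "finite I" "finite J" and v: "v \<in> J \<rightarrow> carrier R"
  shows "(q - 1) ^ i dvd ext_rank_num R B v I J (Suc i)"
  unfolding ext_rank_num_def
proof (rule row_scaling_dvd[OF fin])
  let ?K = "\<lambda>A. {y \<in> kern R I J A. dot R J v y = \<zero>}"
  let ?C = "{A \<in> board_mats R B I J. card (?K A) * q ^ Suc i = q ^ card J}"
  show "?C \<subseteq> I \<rightarrow>\<^sub>E (J \<rightarrow>\<^sub>E carrier R)"
    using row_space_subset[of B J] unfolding board_mats_def by (auto simp only: PiE_iff subset_iff mem_Collect_eq)
  show "i \<le> card {a \<in> I. A a \<noteq> (\<lambda>j\<in>J. \<zero>)}" if A: "A \<in> ?C" for A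
  proof -
    let ?r = "card {a \<in> I. A a \<noteq> (\<lambda>j\<in>J. \<zero>)}"
    have AE: "A a \<in> J \<rightarrow>\<^sub>E carrier R" if "a \<in> I" for a
      using A that row_space_subset[of B J a] by (auto simp only: board_mats_def PiE_iff subset_iff mem_Collect_eq)
    then have Ac: "A a \<in> J \<rightarrow> carrier R" if "a \<in> I" for a using that by auto
    have "card (?K A) * q ^ Suc i = q ^ card J" using A by simp
    also have "\<dots> \<le> q ^ ?r * card (kern R I J A)" using AE by (intro card_kern_ge fin)
    also have "\<dots> \<le> q ^ ?r * (q * card (?K A))"
      by (intro mult_le_mono2 card_kern_le[OF fin(2) Ac v])
    finally have "card (?K A) * q ^ Suc i \<le> card (?K A) * q ^ Suc ?r" by (simp add: mult_ac)
    moreover have "card (?K A) > 0"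
    proof (rule ccontr)
      assume "\<not> card (?K A) > 0"
      then have "q ^ card J = 0" using A by simp
      then show False using q_gt_1 by simp
    qed
    ultimately have "q ^ Suc i \<le> q ^ Suc ?r" by simp
    then show ?thesis using q_gt_1 power_le_imp_le_exp by blast
  qed
  show "A(a := \<lambda>j\<in>J. u \<otimes> A a j) \<in> ?C" if A: "A \<in> ?C" and a: "a \<in> I" and u: "u \<in> carrier R - {\<zero>}" for A a u
  proof -
    let ?A = "A(a := \<lambda>j\<in>J. u \<otimes> A a j)"
    have AB: "A \<in> board_mats R B I J" using A by simp
    have "?A a' \<in> row_space R B J a'" if a': "a' \<in> I" for a'
    proof -
      have r: "A a' \<in> row_space R B J a'" using AB a' by (auto simp only: board_mats_def PiE_iff)
      show ?thesis
      proof (cases "a' = a")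
        case True
        have "(\<lambda>j\<in>J. u \<otimes> A a j) \<in> row_space R B J a"
        proof (rule row_spaceI)
          fix j assume j: "j \<in> J"
          show "(\<lambda>j\<in>J. u \<otimes> A a j) j \<in> (if (a, j) \<in> B then carrier R else {\<zero>})"
            using row_space_mem[OF r j] u j True by (auto split: if_splits)
        qed simp
        then show ?thesis using True by simp
      qed (use r in simp)
    qed
    moreover have "?A a' = undefined" if "a' \<notin> I" for a'
      using AB that a by (auto simp: board_mats_def PiE_iff extensional_def)
    ultimately have "?A \<in> board_mats R B I J" unfolding board_mats_def by (intro PiE_I)
    moreover have "kern R I J ?A = kern R I J A"
    proof -
      have "dot R J (?A a) y = \<zero> \<longleftrightarrow> dot R J (A a) y = \<zero>" if y: "y \<in> J \<rightarrow>\<^sub>E carrier R" for y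
      proof -
        have Aa: "A a \<in> J \<rightarrow> carrier R" by (rule board_matsD[OF AB a])
        have yc: "y \<in> J \<rightarrow> carrier R" using y by auto
        have "dot R J (?A a) y = dot R J (A a) (\<lambda>j\<in>J. u \<otimes> y j)"
          unfolding dot_def using Aa yc u by (intro add.finprod_cong') (auto simp: Pi_iff m_ac)
        also have "\<dots> = u \<otimes> dot R J (A a) y" using Aa yc u fin by (intro dot_smult) auto
        finally show ?thesis using u Aa yc by (auto simp: integral_iff)
      qed
      then have "dot R J (?A a') y = \<zero> \<longleftrightarrow> dot R J (A a') y = \<zero>" if "y \<in> J \<rightarrow>\<^sub>E carrier R" for y a'
        using that by (cases "a' = a") (simp_all only: fun_upd_other simp_thms)
      then show ?thesis unfolding kern_def by (intro Collect_cong conj_cong refl ball_cong)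
    qed
    ultimately show ?thesis using A by simp
  qed
qed

end

section \<open>Sums over pairs and rook placements\<close>

text \<open>Unordered pairs are represented by their increasing order, which is what the linear
  orders on row and column indices are for.\<close>

definition psum :: "'a::linorder set \<Rightarrow> ('a \<Rightarrow> 'a \<Rightarrow> 'b::comm_monoid_add) \<Rightarrow> 'b" where
  "psum J F = (\<Sum>c\<in>J. \<Sum>d\<in>{d \<in> J. c < d}. F c d)"

lemma psum_cong:
  "(\<And>c d. c \<in> J \<Longrightarrow> d \<in> J \<Longrightarrow> c < d \<Longrightarrow> F c d = G c d) \<Longrightarrow> psum J F = psum J G"
  unfolding psum_def by (intro sum.cong) auto

lemma psum_add: "psum J (\<lambda>c d. F c d + G c d) = psum J F + psum J G"
  unfolding psum_def by (simp add: sum.distrib)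

lemma psum_diff: "psum J (\<lambda>c d. F c d - G c d) = psum J F - (psum J G :: 'b::ab_group_add)"
  unfolding psum_def by (simp add: sum_subtractf)

lemma psum_mult: "psum J (\<lambda>c d. t * F c d) = t * (psum J F :: 'b::semiring_0)"
  unfolding psum_def by (simp add: sum_distrib_left)

lemma psum_sum: "psum J (\<lambda>c d. \<Sum>a\<in>I. F a c d) = (\<Sum>a\<in>I. psum J (F a))"
  unfolding psum_def by (simp add: sum.swap[of _ I])

lemma sum_offdiag:
  fixes J :: "'a::linorder set"
  assumes "finite J"
  shows "(\<Sum>c\<in>J. \<Sum>d\<in>J - {c}. F c d) = psum J (\<lambda>c d. F c d + F d c)"
proof -
  have "(\<Sum>d\<in>J - {c}. F c d) = (\<Sum>d\<in>{d \<in> J. c < d}. F c d) + (\<Sum>d\<in>{d \<in> J. d < c}. F c d)" for c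
  proof -
    have "J - {c} = {d \<in> J. c < d} \<union> {d \<in> J. d < c}" by auto
    moreover have "{d \<in> J. c < d} \<inter> {d \<in> J. d < c} = {}" by auto
    ultimately show ?thesis using assms by (simp add: sum.union_disjoint)
  qed
  then have "(\<Sum>c\<in>J. \<Sum>d\<in>J - {c}. F c d)
      = psum J F + (\<Sum>c\<in>J. \<Sum>d\<in>{d \<in> J. d < c}. F c d)"
    by (simp add: psum_def sum.distrib)
  also have "(\<Sum>c\<in>J. \<Sum>d\<in>{d \<in> J. d < c}. F c d) = psum J (\<lambda>c d. F d c)"
    unfolding psum_def using sum.swap_restrict[OF assms assms, of F "\<lambda>c d. d < c"] by simp
  finally show ?thesis by (simp add: psum_add)
qed

lemma sum_offdiag_swap:
  fixes J :: "'a::linorder set"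
  assumes "finite J"
  shows "(\<Sum>c\<in>J. \<Sum>d\<in>J - {c}. F c d) = (\<Sum>d\<in>J. \<Sum>c\<in>J - {d}. F c d)"
  unfolding sum_offdiag[OF assms] by (simp add: add.commute)

text \<open>The new element may stand anywhere in the order, so symmetry of \<open>F\<close> is used
  to write all its pairs with \<open>x\<close> in front.\<close>

lemma psum_insert:
  assumes "finite I" "x \<notin> I" and sym: "\<And>c d. F c d = F d c"
  shows "psum (insert x I) F = psum I F + (\<Sum>a\<in>I. F x a)"
proof -
  have up: "{d \<in> insert x I. c < d} = (if c < x then insert x {d \<in> I. c < d} else {d \<in> I. c < d})" for c
    by auto
  have "psum (insert x I) F = (\<Sum>d\<in>{d \<in> insert x I. x < d}. F x d) + (\<Sum>c\<in>I. \<Sum>d\<in>{d \<in> insert x I. c < d}. F c d)"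
    unfolding psum_def using assms(1,2) by simp
  also have "{d \<in> insert x I. x < d} = {d \<in> I. x < d}" by auto
  also have "(\<Sum>c\<in>I. \<Sum>d\<in>{d \<in> insert x I. c < d}. F c d)
      = (\<Sum>c\<in>I. (if c < x then F x c else 0) + (\<Sum>d\<in>{d \<in> I. c < d}. F c d))"
    unfolding up using assms by (intro sum.cong) (auto simp: sym)
  also have "\<dots> = (\<Sum>c\<in>{c \<in> I. c < x}. F x c) + psum I F"
    using assms(1) by (simp add: sum.distrib psum_def sum.inter_filter)
  also have "(\<Sum>d\<in>{d \<in> I. x < d}. F x d) + ((\<Sum>c\<in>{c \<in> I. c < x}. F x c) + psum I F)
      = psum I F + ((\<Sum>d\<in>{d \<in> I. x < d}. F x d) + (\<Sum>c\<in>{c \<in> I. c < x}. F x c))"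
    by (simp add: add_ac)
  also have "(\<Sum>d\<in>{d \<in> I. x < d}. F x d) + (\<Sum>c\<in>{c \<in> I. c < x}. F x c) = (\<Sum>a\<in>I. F x a)"
  proof -
    have "I = {d \<in> I. x < d} \<union> {c \<in> I. c < x}" using assms(2) by (auto simp: not_less_iff_gr_or_eq)
    moreover have "{d \<in> I. x < d} \<inter> {c \<in> I. c < x} = {}" by auto
    ultimately show ?thesis using assms(1) by (metis (no_types, lifting) finite_Un sum.union_disjoint)
  qed
  finally show ?thesis .
qed

text \<open>Both sides run over a pair \<open>c < d\<close> together with a third element
  \<open>e\<close> different from both.\<close>

lemma sum_psum_swap:
  assumes "finite J"
  shows "(\<Sum>e\<in>J. psum (J - {e}) (F e)) = psum J (\<lambda>c d. \<Sum>e\<in>J - {c, d}. F e c d)"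
proof -
  have A: "(\<Sum>e\<in>J. psum (J - {e}) (F e)) =
      (\<Sum>e\<in>J. \<Sum>c\<in>J. \<Sum>d\<in>J. if c \<noteq> e \<and> d \<noteq> e \<and> c < d then F e c d else 0)"
  proof (rule sum.cong[OF refl])
    fix e
    have "psum (J - {e}) (F e) = (\<Sum>c\<in>J - {e}. \<Sum>d\<in>J. if c \<noteq> e \<and> d \<noteq> e \<and> c < d then F e c d else 0)"
      unfolding psum_def using assms
      by (intro sum.cong refl sum.mono_neutral_cong_left) auto
    also have "\<dots> = (\<Sum>c\<in>J. \<Sum>d\<in>J. if c \<noteq> e \<and> d \<noteq> e \<and> c < d then F e c d else 0)"
      using assms by (intro sum.mono_neutral_left) auto
    finally show "psum (J - {e}) (F e)
        = (\<Sum>c\<in>J. \<Sum>d\<in>J. if c \<noteq> e \<and> d \<noteq> e \<and> c < d then F e c d else 0)" .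
  qed
  have B: "psum J (\<lambda>c d. \<Sum>e\<in>J - {c, d}. F e c d) =
      (\<Sum>c\<in>J. \<Sum>d\<in>J. \<Sum>e\<in>J. if c \<noteq> e \<and> d \<noteq> e \<and> c < d then F e c d else 0)"
    unfolding psum_def
  proof (rule sum.cong[OF refl])
    fix c
    have "(\<Sum>e\<in>J - {c, d}. F e c d) = (\<Sum>e\<in>J. if c \<noteq> e \<and> d \<noteq> e \<and> c < d then F e c d else 0)"
      if "c < d" for d
      using assms that by (intro sum.mono_neutral_cong_left) auto
    then show "(\<Sum>d\<in>{d \<in> J. c < d}. \<Sum>e\<in>J - {c, d}. F e c d)
        = (\<Sum>d\<in>J. \<Sum>e\<in>J. if c \<noteq> e \<and> d \<noteq> e \<and> c < d then F e c d else 0)"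
      using assms by (intro sum.mono_neutral_cong_left) auto
  qed
  show ?thesis unfolding A B by (rule trans[OF sum.swap]) (intro sum.cong refl sum.swap)
qed

section \<open>Rook placements and rook numbers\<close>

definition placements :: "'a set \<Rightarrow> 'b set \<Rightarrow> ('a \<times> 'b) set set" where
  "placements I J = {R. R \<subseteq> I \<times> J \<and> inj_on fst R \<and> inj_on snd R}"

lemma finite_placements [simp]: "finite I \<Longrightarrow> finite J \<Longrightarrow> finite (placements I J)"
  unfolding placements_def by (rule finite_subset[of _ "Pow (I \<times> J)"]) auto

text \<open>Row \<open>x\<close> is either empty or holds exactly one rook, whose column
  \<open>c\<close> is closed to all others.\<close>

lemma placements_insert_row:
  assumes "finite I" "finite J" "x \<notin> I"
  shows "(\<Sum>R\<in>placements (insert x I) J. f R)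
    = (\<Sum>R\<in>placements I J. f R) + (\<Sum>c\<in>J. \<Sum>R\<in>placements I (J - {c}). f (insert (x, c) R))"
proof -
  have fin: "finite (placements I J)" "\<And>c. finite (placements I (J - {c}))"
    using assms by auto
  let ?P = "\<lambda>c. insert (x, c) ` placements I (J - {c})"
  have split: "placements (insert x I) J = placements I J \<union> (\<Union>c\<in>J. ?P c)"
  proof (intro equalityI subsetI)
    fix R assume R: "R \<in> placements (insert x I) J"
    show "R \<in> placements I J \<union> (\<Union>c\<in>J. ?P c)"
    proof (cases "x \<in> fst ` R")
      case False
      then have "R \<in> placements I J" using R by (force simp: placements_def)
      then show ?thesis by simp
    next
      case True
      then obtain c where c: "(x, c) \<in> R" by auto
      have "R - {(x, c)} \<in> placements I (J - {c})"
      proof -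
        have "a \<in> I \<and> j \<in> J - {c}" if "(a, j) \<in> R" "(a, j) \<noteq> (x, c)" for a j
        proof -
          have inj: "inj_on fst R" "inj_on snd R" and "R \<subseteq> insert x I \<times> J"
            using R by (simp_all add: placements_def)
          then have "a \<in> insert x I" "j \<in> J" using that(1) by auto
          moreover have "a \<noteq> x" using inj_onD[OF inj(1) _ that(1) c] that(2) by auto
          moreover have "j \<noteq> c" using inj_onD[OF inj(2) _ that(1) c] that(2) by auto
          ultimately show ?thesis by blast
        qed
        then have "R - {(x, c)} \<subseteq> I \<times> (J - {c})" by auto
        then show ?thesis using R unfolding placements_def by (blast intro: inj_on_subset)
      qed
      moreover have "R = insert (x, c) (R - {(x, c)})" using c by auto
      moreover have "c \<in> J" using R c by (auto simp: placements_def)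
      ultimately show ?thesis by blast
    qed
  next
    fix R assume "R \<in> placements I J \<union> (\<Union>c\<in>J. ?P c)"
    then show "R \<in> placements (insert x I) J"
    proof
      assume "R \<in> placements I J"
      then show ?thesis by (auto simp: placements_def)
    next
      assume "R \<in> (\<Union>c\<in>J. ?P c)"
      then obtain c R' where R': "c \<in> J" "R' \<in> placements I (J - {c})" "R = insert (x, c) R'" by blast
      then have "x \<notin> fst ` R'" "c \<notin> snd ` R'" using assms(3) by (auto simp: placements_def)
      with R' show ?thesis by (auto simp: placements_def inj_on_def)
    qed
  qed
  have nx: "(x, c) \<notin> R" if "R \<in> placements I J'" for c R and J' :: "'b set"
    using that assms(3) by (auto simp: placements_def)
  have inj: "inj_on (insert (x, c)) (placements I (J - {c}))" for c
    using nx by (intro inj_onI) (metis insert_ident)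
  have "(\<Sum>R\<in>placements (insert x I) J. f R) = (\<Sum>R\<in>placements I J. f R) + (\<Sum>R\<in>(\<Union>c\<in>J. ?P c). f R)"
    unfolding split using assms fin nx by (intro sum.union_disjoint) auto
  also have "(\<Sum>R\<in>(\<Union>c\<in>J. ?P c). f R) = (\<Sum>c\<in>J. \<Sum>R\<in>?P c. f R)"
  proof (rule sum.UNION_disjoint)
    show "\<forall>c\<in>J. \<forall>d\<in>J. c \<noteq> d \<longrightarrow> ?P c \<inter> ?P d = {}"
    proof (intro ballI impI)
      fix c d assume "c \<in> J" "d \<in> J" "c \<noteq> d"
      then show "?P c \<inter> ?P d = {}" using nx by auto (metis Pair_inject insert_iff)
    qed
  qed (use assms fin in auto)
  also have "\<dots> = (\<Sum>c\<in>J. \<Sum>R\<in>placements I (J - {c}). f (insert (x, c) R))"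
    by (rule sum.cong[OF refl]) (simp add: sum.reindex[OF inj])
  finally show ?thesis .
qed

definition rook :: "('a \<times> 'b) set \<Rightarrow> 'a set \<Rightarrow> 'b set \<Rightarrow> nat \<Rightarrow> nat" where
  "rook B I J k = card {R \<in> placements I J. R \<subseteq> B \<and> card R = k}"

lemma rook_alt:
  assumes "finite I" "finite J"
  shows "rook B I J k = (\<Sum>R\<in>placements I J. if R \<subseteq> B \<and> card R = k then 1 else 0)"
  unfolding rook_def using assms by (simp add: sum.If_cases Int_def)

lemma card_placement:
  assumes "finite I" "finite J" "R \<in> placements I J"
  shows "finite R" "card (fst ` R) = card R" "card (snd ` R) = card R"
proof -
  have "R \<subseteq> I \<times> J" using assms(3) by (simp add: placements_def)
  then show "finite R" using assms by (meson finite_SigmaI finite_subset)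
qed (use assms in \<open>auto simp: placements_def card_image\<close>)

lemma rook_0 [simp]:
  assumes "finite I" "finite J" shows "rook B I J 0 = 1"
proof -
  have "{R \<in> placements I J. R \<subseteq> B \<and> card R = 0} = {{}}"
    using card_placement(1)[OF assms] by (auto simp: placements_def)
  then show ?thesis by (simp add: rook_def)
qed

lemma rook_insert_row:
  assumes fin: "finite I" "finite J" and x: "x \<notin> I"
  shows "rook B (insert x I) J (Suc k)
    = rook B I J (Suc k) + (\<Sum>c\<in>J. if (x, c) \<in> B then rook B I (J - {c}) k else 0)"
proof -
  have fin': "finite (insert x I)" "\<And>c. finite (J - {c})" using fin by auto
  have "(\<Sum>R\<in>placements I (J - {c}). if insert (x, c) R \<subseteq> B \<and> card (insert (x, c) R) = Suc k then 1 else 0)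
      = (if (x, c) \<in> B then rook B I (J - {c}) k else 0)" for c
  proof -
    have "(x, c) \<notin> R \<and> finite R" if "R \<in> placements I (J - {c})" for R
      using that x card_placement(1)[OF fin(1) fin'(2) that] by (auto simp: placements_def)
    then show ?thesis unfolding rook_alt[OF fin(1) fin'(2)] by (auto intro!: sum.cong)
  qed
  then show ?thesis
    unfolding rook_alt[OF fin'(1) fin(2)] rook_alt[OF fin] placements_insert_row[OF fin x] by simp
qed

lemma placements_swap: "placements J I = (\<lambda>R. prod.swap ` R) ` placements I J"
proof -
  have "prod.swap ` R \<in> placements J I" if "R \<in> placements I J" for R and I :: "'x set" and J :: "'y set"
    using that unfolding placements_def by (auto simp: inj_on_def)
  note sw = this
  show ?thesis
  proof (intro equalityI subsetI)
    fix R assume R: "R \<in> placements J I"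
    have "R = prod.swap ` prod.swap ` R" by (auto simp: image_comp)
    then show "R \<in> (\<lambda>R. prod.swap ` R) ` placements I J" using sw[OF R] by blast
  qed (use sw in auto)
qed

text \<open>Transposing the board allows statements on columns to be deduced from those on
  rows.\<close>

lemma rook_swap: "rook (B\<inverse>) J I k = rook B I J k"
proof -
  have inj: "inj_on (\<lambda>R. prod.swap ` R) S" for S :: "('x \<times> 'y) set set"
    by (intro inj_onI) (metis inj_image_eq_iff inj_swap)
  have sub: "prod.swap ` R \<subseteq> B\<inverse> \<longleftrightarrow> R \<subseteq> B" for R by (force simp: subset_iff image_iff)
  have "{R \<in> placements J I. R \<subseteq> B\<inverse> \<and> card R = k}
      = (\<lambda>R. prod.swap ` R) ` {R \<in> placements I J. R \<subseteq> B \<and> card R = k}"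
    unfolding placements_swap[of J I] by (auto simp: card_image sub)
  then show ?thesis unfolding rook_def by (simp add: card_image[OF inj])
qed

text \<open>Double counting of a placement of \<open>k\<close> rooks together with a row that it
  leaves empty. Integers are used because of the difference \<open>card I - k\<close>.\<close>

lemma sum_rook_remove_row:
  assumes fin: "finite I" "finite J"
  shows "(\<Sum>a\<in>I. int (rook B (I - {a}) J k)) = (int (card I) - int k) * int (rook B I J k)"
proof -
  let ?S = "{R \<in> placements I J. R \<subseteq> B \<and> card R = k}"
  have finS: "finite ?S" using fin by simp
  have "(\<Sum>a\<in>I. rook B (I - {a}) J k) = (\<Sum>a\<in>I. \<Sum>R\<in>?S. if a \<notin> fst ` R then 1 else 0)"
  proof (rule sum.cong[OF refl])
    fix a
    have "{R \<in> placements (I - {a}) J. R \<subseteq> B \<and> card R = k} = {R \<in> ?S. a \<notin> fst ` R}"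
      unfolding placements_def by force
    then show "rook B (I - {a}) J k = (\<Sum>R\<in>?S. if a \<notin> fst ` R then 1 else 0)"
      unfolding rook_def using finS by (simp add: sum.If_cases Int_def)
  qed
  also have "\<dots> = (\<Sum>R\<in>?S. \<Sum>a\<in>I. if a \<notin> fst ` R then 1 else 0)" by (rule sum.swap)
  also have "int \<dots> = (\<Sum>R\<in>?S. int (card I) - int k)"
    unfolding of_nat_sum[of _ ?S]
  proof (rule sum.cong[OF refl])
    fix R assume R: "R \<in> ?S"
    then have sub: "fst ` R \<subseteq> I" by (auto simp: placements_def)
    have "(\<Sum>a\<in>I. if a \<notin> fst ` R then 1 else 0) = card (I - fst ` R)"
      using fin by (simp add: sum.If_cases Int_def set_diff_eq)
    also have "\<dots> = card I - card (fst ` R)"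
      using sub fin by (intro card_Diff_subset) (auto intro: finite_subset)
    also have "card (fst ` R) = k" using R card_placement(2)[OF fin] by auto
    finally show "int (\<Sum>a\<in>I. if a \<notin> fst ` R then 1 else 0) = int (card I) - int k"
      using card_mono[OF fin(1) sub] R card_placement(2)[OF fin, of R] by auto
  qed
  also have "\<dots> = (int (card I) - int k) * int (rook B I J k)" by (simp add: rook_def)
  finally show ?thesis by simp
qed

lemma sum_rook_remove_col:
  assumes fin: "finite I" "finite J"
  shows "(\<Sum>c\<in>J. int (rook B I (J - {c}) k)) = (int (card J) - int k) * int (rook B I J k)"
  using sum_rook_remove_row[OF fin(2,1), of "B\<inverse>" k] by (simp add: rook_swap cong: if_cong)

text \<open>Both sides count placements of \<open>Suc k\<close> rooks with one rook marked. The
  expansion along row \<open>a\<close> is summed over all \<open>a\<close>, and the placements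
  avoiding that row are subtracted.\<close>

lemma sum_rook_remove_cell:
  assumes fin: "finite I" "finite J"
  shows "(\<Sum>a\<in>I. \<Sum>c\<in>J. of_bool ((a, c) \<in> B) * int (rook B (I - {a}) (J - {c}) k))
    = int (Suc k) * int (rook B I J (Suc k))"
proof -
  have "int (rook B I J (Suc k)) = int (rook B (I - {a}) J (Suc k))
      + (\<Sum>c\<in>J. of_bool ((a, c) \<in> B) * int (rook B (I - {a}) (J - {c}) k))" if "a \<in> I" for a
  proof -
    have e: "of_bool P * int m = int (if P then m else 0)" for P m by simp
    show ?thesis
      using rook_insert_row[of "I - {a}" J a B k] fin that
      unfolding e of_nat_sum[symmetric] of_nat_add[symmetric] by (simp add: insert_absorb)
  qed
  then have "(\<Sum>a\<in>I. int (rook B I J (Suc k))) = (\<Sum>a\<in>I. int (rook B (I - {a}) J (Suc k)))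
      + (\<Sum>a\<in>I. \<Sum>c\<in>J. of_bool ((a, c) \<in> B) * int (rook B (I - {a}) (J - {c}) k))"
    by (simp add: sum.distrib[symmetric])
  then show ?thesis
    using sum_rook_remove_row[OF fin, of B "Suc k"] by (simp add: algebra_simps)
qed

lemma rook_eq_0:
  assumes "finite I" "finite J" "card I < k \<or> card J < k"
  shows "rook B I J k = 0"
proof -
  have "card R \<le> card I \<and> card R \<le> card J" if "R \<in> placements I J" for R
  proof -
    have "fst ` R \<subseteq> I" "snd ` R \<subseteq> J" using that by (auto simp: placements_def)
    then show ?thesis using card_mono assms card_placement[OF assms(1,2) that] by metis
  qed
  then have "{R \<in> placements I J. R \<subseteq> B \<and> card R = k} = {}" using assms(3) by fastforce
  then show ?thesis unfolding rook_def by (simp only: card.empty)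
qed

section \<open>Rank counts modulo the square of \<open>q - 1\<close>\<close>

abbreviation T :: "int poly" where "T \<equiv> [:0, 1:]"

definition rook_poly :: "('a \<times> 'b) set \<Rightarrow> 'a set \<Rightarrow> 'b set \<Rightarrow> int poly" where
  "rook_poly B I J = (\<Sum>k\<le>card I. Polynomial.monom (int (rook B I J k)) k)"

lemma coeff_rook_poly:
  assumes "finite I" "finite J"
  shows "Polynomial.coeff (rook_poly B I J) k = int (rook B I J k)"
  unfolding rook_poly_def coeff_sum using rook_eq_0[OF assms, of k B]
  by (auto simp: not_le sum.delta)

text \<open>An indicator with polymorphic value, so that one notation serves for integer weights and
  for constant polynomials.\<close>

definition cell :: "('a \<times> 'b) set \<Rightarrow> 'a \<Rightarrow> 'b \<Rightarrow> 'c::zero_neq_one" where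
  "cell B a c = of_bool ((a, c) \<in> B)"

lemma coeff_T_mult: "Polynomial.coeff (T * p) (Suc k) = Polynomial.coeff p k" "Polynomial.coeff (T * p) 0 = 0"
  by auto

lemma coeff_cell_mult: "Polynomial.coeff (cell B a c * p) k = cell B a c * Polynomial.coeff p k"
  by (simp add: cell_def)

lemma coeff_sum_cell_mult:
  "Polynomial.coeff ((\<Sum>a\<in>I. cell B a c) * p) k = (\<Sum>a\<in>I. cell B a c) * Polynomial.coeff p k"
  by (simp add: sum_distrib_right coeff_sum coeff_cell_mult)

lemma rook_poly_insert_row:
  assumes fin: "finite I" "finite J" and x: "x \<notin> I"
  shows "rook_poly B (insert x I) J = rook_poly B I J + T * (\<Sum>c\<in>J. cell B x c * rook_poly B I (J - {c}))"
proof (rule poly_eqI)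
  fix k
  show "Polynomial.coeff (rook_poly B (insert x I) J) k
      = Polynomial.coeff (rook_poly B I J + T * (\<Sum>c\<in>J. cell B x c * rook_poly B I (J - {c}))) k"
  proof (cases k)
    case 0
    then show ?thesis using fin by (simp only: coeff_add coeff_T_mult coeff_rook_poly finite_insert) simp
  next
    case (Suc l)
    have e: "int (if P then m else 0) = of_bool P * int m" for P m by simp
    show ?thesis
      unfolding Suc coeff_add coeff_T_mult coeff_sum coeff_cell_mult
      using fin x by (simp add: coeff_rook_poly rook_insert_row e cell_def)
  qed
qed

lemma rook_poly_swap:
  assumes "finite I" "finite J"
  shows "rook_poly (B\<inverse>) J I = rook_poly B I J"
  using assms by (intro poly_eqI) (simp add: coeff_rook_poly rook_swap)

lemma rook_poly_insert_col:
  assumes fin: "finite I" "finite J" and x: "y \<notin> J"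
  shows "rook_poly B I (insert y J) = rook_poly B I J + T * (\<Sum>a\<in>I. cell B a y * rook_poly B (I - {a}) J)"
  using rook_poly_insert_row[OF fin(2,1) x, of "B\<inverse>"] fin
  by (simp add: rook_poly_swap cell_def)

lemma rook_poly_cong:
  assumes "B \<inter> I \<times> J = B' \<inter> I \<times> J"
  shows "rook_poly B I J = rook_poly B' I J"
proof -
  have "{R \<in> placements I J. R \<subseteq> B \<and> card R = k} = {R \<in> placements I J. R \<subseteq> B' \<and> card R = k}" for k
    using assms unfolding placements_def by blast
  then show ?thesis unfolding rook_poly_def rook_def by simp
qed

text \<open>Signed count of the supports in a two by two block that carry an invertible matrix without
  being a permutation matrix: \<open>e\<^sub>3 - e\<^sub>4\<close> of the four cells.\<close>
definition block_weight :: "('a \<times> 'b) set \<Rightarrow> 'a \<Rightarrow> 'a \<Rightarrow> 'b \<Rightarrow> 'b \<Rightarrow> 'c::comm_ring_1" where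
  "block_weight B a a' c d =
     cell B a c * cell B a d * cell B a' c + cell B a c * cell B a d * cell B a' d
   + cell B a c * cell B a' c * cell B a' d + cell B a d * cell B a' c * cell B a' d
   - cell B a c * cell B a d * cell B a' c * cell B a' d"

definition hook_rows :: "('a \<times> 'b::linorder) set \<Rightarrow> 'a set \<Rightarrow> 'b set \<Rightarrow> int poly" where
  "hook_rows B I J = (\<Sum>a\<in>I. psum J (\<lambda>c d. cell B a c * cell B a d * rook_poly B (I - {a}) (J - {c, d})))"

definition hook_cols :: "('a::linorder \<times> 'b) set \<Rightarrow> 'a set \<Rightarrow> 'b set \<Rightarrow> int poly" where
  "hook_cols B I J = (\<Sum>c\<in>J. psum I (\<lambda>a a'. cell B a c * cell B a' c * rook_poly B (I - {a, a'}) (J - {c})))"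

definition blocks :: "('a::linorder \<times> 'b::linorder) set \<Rightarrow> 'a set \<Rightarrow> 'b set \<Rightarrow> int poly" where
  "blocks B I J = psum I (\<lambda>a a'. psum J (\<lambda>c d. block_weight B a a' c d * rook_poly B (I - {a, a'}) (J - {c, d})))"

text \<open>The linear coefficients in \<open>z\<close> of the counts divided by
  \<open>z ^ i\<close>. Two cells in a line carry \<open>z ^ 2\<close> matrices of rank 1 and
  replace one rook, hence one factor \<open>T\<close>. In a two by two block, a support of three
  cells carries \<open>z ^ 3\<close> invertible matrices and the full support
  \<open>z ^ 4 - z ^ 3\<close>; both replace two rooks, hence two factors \<open>T\<close> and the
  signs in \<open>block_weight\<close>.\<close>

definition rook_corr :: "('a::linorder \<times> 'b::linorder) set \<Rightarrow> 'a set \<Rightarrow> 'b set \<Rightarrow> int poly" where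
  "rook_corr B I J = T * (hook_rows B I J + hook_cols B I J) + T * (T * blocks B I J)"

text \<open>Row \<open>x\<close> is empty, or it holds a rook in some column \<open>e\<close>, or it
  is itself the row with the two cells.\<close>

lemma hook_rows_insert:
  assumes fin: "finite I" "finite J" and x: "x \<notin> I"
  shows "hook_rows B (insert x I) J = hook_rows B I J
    + T * (\<Sum>e\<in>J. cell B x e * hook_rows B I (J - {e}))
    + psum J (\<lambda>c d. cell B x c * cell B x d * rook_poly B I (J - {c, d}))"
proof -
  let ?R = "rook_poly B"
  have ins: "insert x I - {a} = insert x (I - {a})" "x \<notin> I - {a}" if "a \<in> I" for a
    using that x by auto
  have "hook_rows B (insert x I) J
      = psum J (\<lambda>c d. cell B x c * cell B x d * ?R I (J - {c, d}))
      + (\<Sum>a\<in>I. psum J (\<lambda>c d. cell B a c * cell B a d * ?R (insert x I - {a}) (J - {c, d})))"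
    unfolding hook_rows_def using fin x by simp
  also have "(\<Sum>a\<in>I. psum J (\<lambda>c d. cell B a c * cell B a d * ?R (insert x I - {a}) (J - {c, d})))
      = (\<Sum>a\<in>I. psum J (\<lambda>c d. cell B a c * cell B a d * ?R (I - {a}) (J - {c, d})
          + T * (\<Sum>e\<in>J - {c, d}. cell B x e * (cell B a c * cell B a d * ?R (I - {a}) (J - {c, d} - {e})))))"
    using fin ins
    by (intro sum.cong refl psum_cong)
      (simp add: rook_poly_insert_row ring_distribs sum_distrib_left mult_ac del: mult_pCons_left mult_pCons_right)
  also have "\<dots> = hook_rows B I J + T * (\<Sum>a\<in>I. psum J (\<lambda>c d.
      \<Sum>e\<in>J - {c, d}. cell B x e * (cell B a c * cell B a d * ?R (I - {a}) (J - {c, d} - {e}))))"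
    unfolding hook_rows_def psum_add sum.distrib psum_mult sum_distrib_left[symmetric] ..
  also have "(\<Sum>a\<in>I. psum J (\<lambda>c d.
      \<Sum>e\<in>J - {c, d}. cell B x e * (cell B a c * cell B a d * ?R (I - {a}) (J - {c, d} - {e}))))
      = (\<Sum>e\<in>J. cell B x e * hook_rows B I (J - {e}))"
  proof -
    have "J - {c, d} - {e} = J - {e} - {c, d}" for c d e by auto
    then show ?thesis
      unfolding hook_rows_def sum_psum_swap[OF fin(2), symmetric] psum_mult sum_distrib_left
      by (subst sum.swap) simp
  qed
  finally show ?thesis by (simp only: add_ac)
qed

text \<open>The last sum collects the pairs in a column that have one cell in row \<open>x\<close>;
  the other cell lies in some row \<open>a\<close> of \<open>I\<close>.\<close>

lemma hook_cols_insert: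
  fixes B :: "('a::linorder \<times> 'b::linorder) set"
  assumes fin: "finite I" "finite J" and x: "x \<notin> I"
  shows "hook_cols B (insert x I) J = hook_cols B I J
    + T * (\<Sum>e\<in>J. cell B x e * hook_cols B I (J - {e}))
    + (\<Sum>c\<in>J. \<Sum>a\<in>I. cell B x c * cell B a c * rook_poly B (I - {a}) (J - {c}))"
proof -
  let ?R = "rook_poly B"
  have ins: "insert x I - {a, a'} = insert x (I - {a, a'})" "x \<notin> I - {a, a'}" if "a \<in> I" "a' \<in> I" for a a'
    using that x by auto
  have insx: "insert x I - {x, a} = I - {a}" "I - {a, x} = I - {a}" for a using x by auto
  have "hook_cols B (insert x I) J
      = (\<Sum>c\<in>J. psum I (\<lambda>a a'. cell B a c * cell B a' c * ?R (insert x I - {a, a'}) (J - {c}))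
          + (\<Sum>a\<in>I. cell B x c * cell B a c * ?R (I - {a}) (J - {c})))"
    unfolding hook_cols_def using fin x
    by (subst psum_insert) (auto simp: insert_commute mult_ac insx)
  also have "\<dots> = (\<Sum>c\<in>J. psum I (\<lambda>a a'. cell B a c * cell B a' c * ?R (insert x I - {a, a'}) (J - {c})))
      + (\<Sum>c\<in>J. \<Sum>a\<in>I. cell B x c * cell B a c * ?R (I - {a}) (J - {c}))"
    by (rule sum.distrib)
  also have "(\<Sum>c\<in>J. psum I (\<lambda>a a'. cell B a c * cell B a' c * ?R (insert x I - {a, a'}) (J - {c})))
      = (\<Sum>c\<in>J. psum I (\<lambda>a a'. cell B a c * cell B a' c * ?R (I - {a, a'}) (J - {c})
          + T * (\<Sum>e\<in>J - {c}. cell B x e * (cell B a c * cell B a' c * ?R (I - {a, a'}) (J - {c} - {e})))))"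
    using fin ins
    by (intro sum.cong refl psum_cong)
      (simp add: rook_poly_insert_row ring_distribs sum_distrib_left mult_ac del: mult_pCons_left mult_pCons_right)
  also have "\<dots> = hook_cols B I J + T * (\<Sum>c\<in>J. \<Sum>e\<in>J - {c}. psum I (\<lambda>a a'.
      cell B x e * (cell B a c * cell B a' c * ?R (I - {a, a'}) (J - {c} - {e}))))"
    unfolding hook_cols_def psum_add sum.distrib psum_mult sum_distrib_left[symmetric] psum_sum ..
  also have "(\<Sum>c\<in>J. \<Sum>e\<in>J - {c}. psum I (\<lambda>a a'.
      cell B x e * (cell B a c * cell B a' c * ?R (I - {a, a'}) (J - {c} - {e}))))
      = (\<Sum>e\<in>J. cell B x e * hook_cols B I (J - {e}))"
  proof -
    have "J - {c} - {e} = J - {e} - {c}" for c e by auto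
    then show ?thesis
      unfolding hook_cols_def psum_mult sum_distrib_left
      by (subst sum_offdiag_swap[OF fin(2)]) simp
  qed
  finally show ?thesis .
qed

lemma blocks_insert:
  assumes fin: "finite I" "finite J" and x: "x \<notin> I"
  shows "blocks B (insert x I) J = blocks B I J
    + T * (\<Sum>e\<in>J. cell B x e * blocks B I (J - {e}))
    + (\<Sum>a\<in>I. psum J (\<lambda>c d. block_weight B x a c d * rook_poly B (I - {a}) (J - {c, d})))"
proof -
  let ?R = "rook_poly B"
  have ins: "insert x I - {a, a'} = insert x (I - {a, a'})" "x \<notin> I - {a, a'}" if "a \<in> I" "a' \<in> I" for a a'
    using that x by auto
  have insx: "insert x I - {x, a} = I - {a}" "I - {a, x} = I - {a}" for a using x by auto
  have sym: "block_weight B a a' c d = (block_weight B a' a c d :: int poly)" for a a' c d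
    unfolding block_weight_def by (simp add: algebra_simps)
  have "blocks B (insert x I) J
      = psum I (\<lambda>a a'. psum J (\<lambda>c d. block_weight B a a' c d * ?R (insert x I - {a, a'}) (J - {c, d})))
      + (\<Sum>a\<in>I. psum J (\<lambda>c d. block_weight B x a c d * ?R (I - {a}) (J - {c, d})))"
    unfolding blocks_def using fin x
    by (subst psum_insert) (auto simp: insert_commute sym insx)
  also have "psum I (\<lambda>a a'. psum J (\<lambda>c d. block_weight B a a' c d * ?R (insert x I - {a, a'}) (J - {c, d})))
      = psum I (\<lambda>a a'. psum J (\<lambda>c d. block_weight B a a' c d * ?R (I - {a, a'}) (J - {c, d})
          + T * (\<Sum>e\<in>J - {c, d}. cell B x e * (block_weight B a a' c d * ?R (I - {a, a'}) (J - {c, d} - {e})))))"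
    using fin ins
    by (intro psum_cong)
      (simp add: rook_poly_insert_row ring_distribs sum_distrib_left mult_ac del: mult_pCons_left mult_pCons_right)
  also have "\<dots> = blocks B I J + T * psum I (\<lambda>a a'. psum J (\<lambda>c d.
      \<Sum>e\<in>J - {c, d}. cell B x e * (block_weight B a a' c d * ?R (I - {a, a'}) (J - {c, d} - {e}))))"
    unfolding blocks_def psum_add psum_mult ..
  also have "psum I (\<lambda>a a'. psum J (\<lambda>c d.
      \<Sum>e\<in>J - {c, d}. cell B x e * (block_weight B a a' c d * ?R (I - {a, a'}) (J - {c, d} - {e}))))
      = (\<Sum>e\<in>J. cell B x e * blocks B I (J - {e}))"
  proof -
    have "J - {c, d} - {e} = J - {e} - {c, d}" for c d e by auto
    then show ?thesis
      unfolding blocks_def sum_psum_swap[OF fin(2), symmetric] psum_mult psum_sum by simp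
  qed
  finally show ?thesis .
qed


text \<open>Column \<open>d\<close> of the merged board is the union of columns \<open>c\<close> and
  \<open>d\<close>, with indicator \<open>x + y - x y\<close>. Expanding along it leaves columns
  that merging has not touched.\<close>

lemma rook_poly_merge:
  assumes fin: "finite I" "finite J" and cd: "c \<in> J" "d \<in> J" "c \<noteq> d"
  shows "rook_poly (merge_board c d B) I (J - {c}) = rook_poly B I (J - {c, d})
    + T * (\<Sum>a\<in>I. (cell B a c + cell B a d - cell B a c * cell B a d) * rook_poly B (I - {a}) (J - {c, d}))"
proof -
  have J: "J - {c} = insert d (J - {c, d})" using cd by auto
  have eq: "rook_poly (merge_board c d B) I' (J - {c, d}) = rook_poly B I' (J - {c, d})" for I'
    by (rule rook_poly_cong) (auto simp: merge_board_def)
  have "cell (merge_board c d B) a d = (cell B a c + cell B a d - cell B a c * cell B a d :: int poly)" for a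
    by (auto simp: cell_def merge_board_def)
  then show ?thesis unfolding J using fin by (simp add: rook_poly_insert_col eq)
qed

text \<open>This is the recursion that the linear coefficients of the rank counts obey: the column
  sums of \<open>cell B a c\<close> stem from \<open>q ^ m = 1 + m z\<close> to first order, and the
  last term from rows with two entries. To match it, the blocks through row \<open>x\<close> are
  split: \<open>H1\<close> collects the supports with one cell in row \<open>x\<close>,
  \<open>H2\<close> those with two.\<close>

lemma rook_corr_insert:
  assumes fin: "finite I" "finite J" and x: "x \<notin> I"
  shows "rook_corr B (insert x I) J = rook_corr B I J
    + T * (\<Sum>c\<in>J. cell B x c * (rook_corr B I (J - {c}) + (\<Sum>a\<in>I. cell B a c) * rook_poly B I (J - {c})))
    + T * psum J (\<lambda>c d. cell B x c * cell B x d * rook_poly (merge_board c d B) I (J - {c}))"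
proof -
  let ?R = "rook_poly B"
  define t where "t = T"
  define P where "P = psum J (\<lambda>c d. cell B x c * cell B x d * ?R I (J - {c, d}))"
  define Q where "Q = (\<Sum>c\<in>J. \<Sum>a\<in>I. cell B x c * cell B a c * ?R (I - {a}) (J - {c}))"
  define W where "W = (\<Sum>a\<in>I. psum J (\<lambda>c d. block_weight B x a c d * ?R (I - {a}) (J - {c, d})))"
  define H1 where "H1 = (\<Sum>a\<in>I. psum J (\<lambda>c d. (cell B x c * cell B a c * cell B a d
      + cell B x d * cell B a d * cell B a c) * ?R (I - {a}) (J - {c, d})))"
  define H2 where "H2 = (\<Sum>a\<in>I. psum J (\<lambda>c d. cell B x c * cell B x d *
      (cell B a c + cell B a d - cell B a c * cell B a d) * ?R (I - {a}) (J - {c, d})))"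
  have WH: "W = H1 + H2"
    unfolding W_def H1_def H2_def sum.distrib[symmetric] psum_add[symmetric]
    by (intro sum.cong refl psum_cong) (simp add: block_weight_def algebra_simps)
  \<comment> \<open>The board without row \<open>x\<close> and column \<open>c\<close> is expanded
    along row \<open>a\<close>: an empty row \<open>a\<close> leaves two cells in column
    \<open>c\<close>, a rook of row \<open>a\<close> in column \<open>d\<close> gives three cells of
    a block.\<close>
  have 1: "(\<Sum>c\<in>J. cell B x c * ((\<Sum>a\<in>I. cell B a c) * ?R I (J - {c}))) = Q + t * H1"
  proof -
    have "(\<Sum>c\<in>J. cell B x c * ((\<Sum>a\<in>I. cell B a c) * ?R I (J - {c})))
        = (\<Sum>c\<in>J. \<Sum>a\<in>I. cell B x c * cell B a c * ?R I (J - {c}))"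
      by (simp add: sum_distrib_left sum_distrib_right mult_ac)
    also have "\<dots> = (\<Sum>c\<in>J. \<Sum>a\<in>I. cell B x c * cell B a c * ?R (I - {a}) (J - {c})
        + t * (\<Sum>d\<in>J - {c}. cell B x c * cell B a c * cell B a d * ?R (I - {a}) (J - {c, d})))"
    proof (intro sum.cong refl)
      fix c a assume "c \<in> J" "a \<in> I"
      then have "?R I (J - {c}) = ?R (I - {a}) (J - {c}) + t * (\<Sum>d\<in>J - {c}. cell B a d * ?R (I - {a}) (J - {c, d}))"
        using rook_poly_insert_row[of "I - {a}" "J - {c}" a B] fin
        by (simp add: insert_absorb t_def Diff_insert2[symmetric] del: mult_pCons_left mult_pCons_right)
      then show "cell B x c * cell B a c * ?R I (J - {c}) = cell B x c * cell B a c * ?R (I - {a}) (J - {c})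
          + t * (\<Sum>d\<in>J - {c}. cell B x c * cell B a c * cell B a d * ?R (I - {a}) (J - {c, d}))"
        by (simp add: ring_distribs sum_distrib_left mult_ac)
    qed
    also have "\<dots> = Q + t * (\<Sum>c\<in>J. \<Sum>a\<in>I. \<Sum>d\<in>J - {c}.
        cell B x c * cell B a c * cell B a d * ?R (I - {a}) (J - {c, d}))"
      unfolding Q_def sum.distrib sum_distrib_left ..
    also have "(\<Sum>c\<in>J. \<Sum>a\<in>I. \<Sum>d\<in>J - {c}.
        cell B x c * cell B a c * cell B a d * ?R (I - {a}) (J - {c, d})) = H1"
      unfolding H1_def
      by (subst sum.swap, intro sum.cong refl, subst sum_offdiag[OF fin(2)], intro psum_cong)
        (simp add: ring_distribs insert_commute)
    finally show ?thesis .
  qed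
  have 2: "psum J (\<lambda>c d. cell B x c * cell B x d * rook_poly (merge_board c d B) I (J - {c})) = P + t * H2"
  proof -
    have "psum J (\<lambda>c d. cell B x c * cell B x d * rook_poly (merge_board c d B) I (J - {c}))
        = psum J (\<lambda>c d. cell B x c * cell B x d * ?R I (J - {c, d}) + t * (\<Sum>a\<in>I. cell B x c * cell B x d *
      (cell B a c + cell B a d - cell B a c * cell B a d) * ?R (I - {a}) (J - {c, d})))"
    proof (intro psum_cong)
      fix c d assume cd: "c \<in> J" "d \<in> J" "c < d"
      show "cell B x c * cell B x d * rook_poly (merge_board c d B) I (J - {c})
        = cell B x c * cell B x d * ?R I (J - {c, d}) + t * (\<Sum>a\<in>I. cell B x c * cell B x d *
      (cell B a c + cell B a d - cell B a c * cell B a d) * ?R (I - {a}) (J - {c, d}))"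
        using cd by (subst rook_poly_merge[OF fin])
          (auto simp only: t_def[symmetric] distrib_left sum_distrib_left mult_ac)
    qed
    then show ?thesis unfolding P_def H2_def psum_add psum_mult psum_sum .
  qed
  define E1 E2 E3 where "E1 = (\<Sum>e\<in>J. cell B x e * hook_rows B I (J - {e}))"
    and "E2 = (\<Sum>e\<in>J. cell B x e * hook_cols B I (J - {e}))"
    and "E3 = (\<Sum>e\<in>J. cell B x e * blocks B I (J - {e}))"
  have 3: "(\<Sum>c\<in>J. cell B x c * rook_corr B I (J - {c})) = t * (E1 + E2) + t * (t * E3)"
    unfolding E1_def E2_def E3_def rook_corr_def t_def[symmetric] sum_distrib_left sum.distrib[symmetric]
    by (intro sum.cong refl) (simp add: algebra_simps)
  have "rook_corr B (insert x I) J = t * ((hook_rows B I J + t * E1 + P) + (hook_cols B I J + t * E2 + Q))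
      + t * (t * (blocks B I J + t * E3 + W))"
    unfolding rook_corr_def hook_rows_insert[OF assms] hook_cols_insert[OF assms] blocks_insert[OF assms]
      t_def P_def Q_def W_def E1_def E2_def E3_def ..
  also have "\<dots> = rook_corr B I J + t * ((t * (E1 + E2) + t * (t * E3)) + (Q + t * H1)) + t * (P + t * H2)"
    unfolding rook_corr_def t_def[symmetric] WH by (simp add: algebra_simps)
  also have "\<dots> = rook_corr B I J
    + t * (\<Sum>c\<in>J. cell B x c * (rook_corr B I (J - {c}) + (\<Sum>a\<in>I. cell B a c) * ?R I (J - {c})))
    + t * psum J (\<lambda>c d. cell B x c * cell B x d * rook_poly (merge_board c d B) I (J - {c}))"
    unfolding 1[symmetric] 2[symmetric] 3[symmetric] distrib_left[of "cell _ _ _"] sum.distrib ..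
  finally show ?thesis unfolding t_def .
qed

section \<open>Supports of a row sorted by size, and the induction modulo powers of
  \<open>z\<close>\<close>

lemma psum_filter:
  assumes "finite J"
  shows "psum {j \<in> J. P j} F = psum J (\<lambda>c d. of_bool (P c) * of_bool (P d) * (F c d :: 'b::comm_semiring_1))"
proof -
  have "(\<Sum>d\<in>{d \<in> {j \<in> J. P j}. c < d}. F c d) = (\<Sum>d\<in>{d \<in> J. c < d}. of_bool (P d) * F c d)" for c
    using assms by (intro sum.mono_neutral_cong_left) auto
  then have "psum {j \<in> J. P j} F = (\<Sum>c\<in>{j \<in> J. P j}. \<Sum>d\<in>{d \<in> J. c < d}. of_bool (P d) * F c d)"
    by (simp add: psum_def)
  also have "\<dots> = psum J (\<lambda>c d. of_bool (P c) * of_bool (P d) * F c d)"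
    unfolding psum_def using assms by (intro sum.mono_neutral_cong_left) auto
  finally show ?thesis .
qed

text \<open>Sets with at least three elements stay together as an unevaluated remainder, since only
  divisibility will matter for them.\<close>

lemma sum_Pow_split:
  fixes f :: "'a::linorder set \<Rightarrow> 'b::comm_monoid_add"
  assumes "finite A"
  shows "(\<Sum>S\<in>Pow A. f S) = f {} + (\<Sum>c\<in>A. f {c}) + psum A (\<lambda>c d. f {c, d}) + (\<Sum>S\<in>{S \<in> Pow A. 3 \<le> card S}. f S)"
proof -
  let ?P1 = "(\<lambda>c. {c}) ` A" and ?P2 = "(\<lambda>(c, d). {c, d}) ` (SIGMA c:A. {d \<in> A. c < d})"
  let ?P3 = "{S \<in> Pow A. 3 \<le> card S}"
  have fin: "finite ?P1" "finite ?P2" "finite ?P3" using assms by auto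
  have split: "Pow A = insert {} (?P1 \<union> (?P2 \<union> ?P3))"
  proof (intro equalityI subsetI)
    fix S assume S: "S \<in> Pow A"
    then have finS: "finite S" using assms by (auto intro: finite_subset)
    consider "card S = 0" | "card S = 1" | "card S = 2" | "3 \<le> card S" by linarith
    then show "S \<in> insert {} (?P1 \<union> (?P2 \<union> ?P3))"
    proof cases
      case 1
      then show ?thesis using finS by simp
    next
      case 2
      then obtain c where "S = {c}" by (auto simp: card_1_singleton_iff)
      then show ?thesis using S by auto
    next
      case 3
      then obtain c d where cd: "S = {c, d}" "c \<noteq> d" by (auto simp: card_2_iff)
      have "\<exists>c d. S = {c, d} \<and> c < d"
        using cd by (metis insert_commute neqE)
      then obtain c d where "S = {c, d}" "c < d" by blast
      then show ?thesis using S by force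
    qed (use S in auto)
  qed auto
  have c2: "card S = 2" if "S \<in> ?P2" for S using that by auto
  have c1: "card S = 1" if "S \<in> ?P1" for S using that by auto
  have inj: "inj_on (\<lambda>(c, d). {c, d}) (SIGMA c:A. {d \<in> A. c < d})"
    by (auto simp: inj_on_def doubleton_eq_iff)
  have "(\<Sum>S\<in>Pow A. f S) = f {} + ((\<Sum>S\<in>?P1. f S) + ((\<Sum>S\<in>?P2. f S) + (\<Sum>S\<in>?P3. f S)))"
  proof -
    have d2: "?P2 \<inter> ?P3 = {}" using c2 by force
    have d1: "?P1 \<inter> (?P2 \<union> ?P3) = {}" using c1 c2 by force
    have "{} \<notin> ?P1 \<union> (?P2 \<union> ?P3)" by auto
    then have "(\<Sum>S\<in>insert {} (?P1 \<union> (?P2 \<union> ?P3)). f S) = f {} + (\<Sum>S\<in>?P1 \<union> (?P2 \<union> ?P3). f S)"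
      by (rule sum.insert[OF finite_UnI[OF fin(1) finite_UnI[OF fin(2,3)]]])
    then show ?thesis
      unfolding split[symmetric] sum.union_disjoint[OF fin(1) finite_UnI[OF fin(2,3)] d1]
        sum.union_disjoint[OF fin(2,3) d2] .
  qed
  also have "(\<Sum>S\<in>?P1. f S) = (\<Sum>c\<in>A. f {c})" by (simp add: sum.reindex)
  also have "(\<Sum>S\<in>?P2. f S) = psum A (\<lambda>c d. f {c, d})"
    unfolding sum.reindex[OF inj] psum_def using assms by (subst sum.Sigma) (auto simp: case_prod_unfold)
  finally show ?thesis by (simp add: add_ac)
qed


lemma power_cong_linear:
  fixes q :: int
  shows "[q ^ n = 1 + int n * (q - 1)] (mod (q - 1)\<^sup>2)"
proof (induction n)
  case (Suc n)
  then have "[q * q ^ n = q * (1 + int n * (q - 1))] (mod (q - 1)\<^sup>2)" by (rule cong_scalar_left)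
  also have "q * (1 + int n * (q - 1)) = 1 + int (Suc n) * (q - 1) + int n * (q - 1)\<^sup>2"
    by (simp add: algebra_simps power2_eq_square)
  also have "[\<dots> = 1 + int (Suc n) * (q - 1)] (mod (q - 1)\<^sup>2)" by (simp add: cong_def)
  finally show ?case by simp
qed simp

lemma psum_cong_mod:
  fixes m :: int
  shows "(\<And>c d. c \<in> J \<Longrightarrow> d \<in> J \<Longrightarrow> c < d \<Longrightarrow> [F c d = G c d] (mod m)) \<Longrightarrow> [psum J F = psum J G] (mod m)"
  unfolding psum_def by (intro cong_sum) auto

lemma coeff_psum: "Polynomial.coeff (psum J F) k = psum J (\<lambda>c d. Polynomial.coeff (F c d) k)"
  by (simp add: psum_def coeff_sum)

lemma cong_mult_power:
  fixes x :: int
  shows "[a = b] (mod x ^ m) \<Longrightarrow> n = k + m \<Longrightarrow> [x ^ k * a = x ^ k * b] (mod x ^ n)"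
  by (metis cong_scalar_left cong_modulus_mult cong_iff_dvd_diff mult_dvd_mono dvd_refl power_add right_diff_distrib)

text \<open>The board and the column set vary in the induction because rows with one or two entries
  change them. A row with \<open>s\<close> entries multiplies a count of rank
  \<open>j = i - 1\<close> by \<open>z ^ s\<close>. Relative to the modulus
  \<open>z ^ (i + 2)\<close>, one entry requires the smaller count to first order, two entries only
  its leading term, and three or more contribute nothing.\<close>

lemma (in finite_field) rank_num_cong:
  fixes B :: "('i::linorder \<times> 'j::linorder) set"
  assumes "finite I" "finite J"
  shows "[int (rank_num R B I J i) = (int q - 1) ^ i *
    (Polynomial.coeff (rook_poly B I J) i + (int q - 1) * Polynomial.coeff (rook_corr B I J) i)]
    (mod (int q - 1) ^ (i + 2))"
  using assms
proof (induction I arbitrary: J B i rule: finite_induct)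
  case empty
  have "rank_num R B {} J i = (if i = 0 then 1 else 0)"
  proof -
    have "kern R {} J A = J \<rightarrow>\<^sub>E carrier R" for A :: "'i \<Rightarrow> 'j \<Rightarrow> 'a" by (simp add: kern_def)
    then have "card (kern R {} J A) = q ^ card J" for A :: "'i \<Rightarrow> 'j \<Rightarrow> 'a"
      using empty.prems by (simp add: card_PiE)
    then show ?thesis using q_gt_1 by (auto simp: rank_num_def board_mats_def)
  qed
  moreover have "Polynomial.coeff (rook_poly B {} J) i = (if i = 0 then 1 else 0)"
    using empty.prems by (simp add: coeff_rook_poly rook_eq_0)
  moreover have "rook_corr B {} J = 0"
    by (simp add: rook_corr_def hook_rows_def hook_cols_def blocks_def psum_def)
  ultimately show ?case by simp
next
  case (insert x I)
  note fin = insert.hyps(1) insert.prems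
  define z where "z = int q - 1"
  have zq: "int (q - 1) = z" using q_gt_1 by (simp add: z_def)
  let ?N = "\<lambda>B J i. int (rank_num R B I J i)"
  let ?r = "\<lambda>B J i. Polynomial.coeff (rook_poly B I J) i"
  let ?s = "\<lambda>B J i. Polynomial.coeff (rook_corr B I J) i"
  have IH: "[?N B J i = z ^ i * (?r B J i + z * ?s B J i)] (mod z ^ (i + 2))"
    if "finite J" for B :: "('i \<times> 'j) set" and J i
    unfolding z_def by (rule insert.IH[OF that])
  have fin': "finite (insert x I)" using fin by simp
  have goal: "[int (rank_num R B (insert x I) J i) = z ^ i *
      (Polynomial.coeff (rook_poly B (insert x I) J) i + z * Polynomial.coeff (rook_corr B (insert x I) J) i)]
    (mod z ^ (i + 2))"
  proof (cases i)
    case 0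
    have "Polynomial.coeff (rook_corr B (insert x I) J) 0 = 0" by (simp add: rook_corr_def)
    then show ?thesis using 0 fin fin' by (simp add: rank_num_0 coeff_rook_poly)
  next
    case (Suc j)
    let ?X = "{c \<in> J. (x, c) \<in> B}"
    let ?e = "\<lambda>S. int (ext_rank_num R B (ind_vec R J S) I J (Suc j))"
    let ?m = "z ^ (j + 3)"
    have finX: "finite ?X" using fin by simp
    have split: "int (rank_num R B (insert x I) J i)
      = ?N B J (Suc j) + (\<Sum>c\<in>?X. z * ?e {c}) + psum ?X (\<lambda>c d. z\<^sup>2 * ?e {c, d})
        + (\<Sum>S\<in>{S \<in> Pow ?X. 3 \<le> card S}. z ^ card S * ?e S)"
    proof -
      have "int (rank_num R B (insert x I) J i) = (\<Sum>S\<in>Pow ?X. z ^ card S * ?e S)"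
        unfolding rank_num_insert[OF fin insert.hyps(2)] Suc by (simp add: zq del: One_nat_def)
      also have "\<dots> = z ^ card ({} :: 'j set) * ?e {} + (\<Sum>c\<in>?X. z ^ card {c} * ?e {c})
          + psum ?X (\<lambda>c d. z ^ card {c, d} * ?e {c, d})
          + (\<Sum>S\<in>{S \<in> Pow ?X. 3 \<le> card S}. z ^ card S * ?e S)"
        by (rule sum_Pow_split[OF finX])
      also have "psum ?X (\<lambda>c d. z ^ card {c, d} * ?e {c, d}) = psum ?X (\<lambda>c d. z\<^sup>2 * ?e {c, d})"
        by (rule psum_cong) (simp add: power2_eq_square)
      finally show ?thesis using ext_rank_num_empty[OF fin(2), of B I "Suc j"] by simp
    qed
    have c1: "[?N B J (Suc j) = z ^ Suc j * (?r B J (Suc j) + z * ?s B J (Suc j))] (mod ?m)"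
      using IH[OF fin(2), of B "Suc j"] by (simp add: numeral_3_eq_3)
    have c2: "[z * ?e {c} = z ^ Suc j * (?r B (J - {c}) j
        + z * (?s B (J - {c}) j + int (card {a \<in> I. (a, c) \<in> B}) * ?r B (J - {c}) j))] (mod ?m)"
      if c: "c \<in> ?X" for c
    proof -
      let ?n = "card {a \<in> I. (a, c) \<in> B}" and ?r' = "?r B (J - {c}) j" and ?s' = "?s B (J - {c}) j"
      have "?e {c} = int q ^ ?n * ?N B (J - {c}) j"
        using ext_rank_num_singleton[OF fin, of c B j] c by simp
      then have "z * ?e {c} = int q ^ ?n * (z ^ 1 * ?N B (J - {c}) j)" by simp
      also have "[\<dots> = int q ^ ?n * (z ^ 1 * (z ^ j * (?r' + z * ?s')))] (mod ?m)"
        using fin by (intro cong_scalar_left[of _ _ _ "int q ^ ?n"] cong_mult_power[where m = "j + 2"] IH) auto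
      also have "int q ^ ?n * (z ^ 1 * (z ^ j * (?r' + z * ?s'))) = z ^ Suc j * (int q ^ ?n * (?r' + z * ?s'))"
        by simp
      also have "[\<dots> = z ^ Suc j * ((1 + int ?n * z) * (?r' + z * ?s'))] (mod ?m)"
        unfolding z_def by (intro cong_mult_power[where m = 2] cong_scalar_right power_cong_linear) simp
      also have "[z ^ Suc j * ((1 + int ?n * z) * (?r' + z * ?s'))
          = z ^ Suc j * (?r' + z * (?s' + int ?n * ?r'))] (mod ?m)"
      proof (rule cong_mult_power[where m = 2])
        have "(1 + int ?n * z) * (?r' + z * ?s') - (?r' + z * (?s' + int ?n * ?r')) = z\<^sup>2 * (int ?n * ?s')"
          by (simp add: algebra_simps power2_eq_square)
        then show "[(1 + int ?n * z) * (?r' + z * ?s') = ?r' + z * (?s' + int ?n * ?r')] (mod z\<^sup>2)"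
          unfolding cong_iff_dvd_diff by simp
      qed simp
      finally show ?thesis by (simp add: numeral_3_eq_3)
    qed
    \<comment> \<open>The factor \<open>z\<^sup>2\<close> in front makes the power of
      \<open>q\<close> count as 1 and the correction of the merged board negligible.\<close>
    have c3: "[z\<^sup>2 * ?e {c, d} = z ^ Suc j * (z * ?r (merge_board c d B) (J - {c}) j)] (mod ?m)"
      if cd: "c \<in> ?X" "d \<in> ?X" "c < d" for c d
    proof -
      let ?n = "card {a \<in> I. (a, c) \<in> B \<and> (a, d) \<in> B}" and ?B = "merge_board c d B"
      let ?r' = "?r ?B (J - {c}) j" and ?s' = "?s ?B (J - {c}) j"
      have "?e {c, d} = int q ^ ?n * ?N ?B (J - {c}) j"
        using ext_rank_num_pair[OF fin, of c d B j] cd by simp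
      then have "z\<^sup>2 * ?e {c, d} = int q ^ ?n * (z ^ 2 * ?N ?B (J - {c}) j)" by simp
      also have "[\<dots> = int q ^ ?n * (z ^ 2 * (z ^ j * ?r'))] (mod ?m)"
      proof (rule cong_scalar_left, rule cong_mult_power[where m = "j + 1"])
        have "[?N ?B (J - {c}) j = z ^ j * (?r' + z * ?s')] (mod z ^ (j + 2))" using fin by (intro IH) auto
        then have "[?N ?B (J - {c}) j = z ^ j * (?r' + z * ?s')] (mod z ^ (j + 1))"
          by (rule cong_dvd_modulus) (simp add: le_imp_power_dvd)
        also have "[z ^ j * (?r' + z * ?s') = z ^ j * ?r'] (mod z ^ (j + 1))"
          by (intro cong_mult_power[where m = 1]) (simp_all add: cong_iff_dvd_diff)
        finally show "[?N ?B (J - {c}) j = z ^ j * ?r'] (mod z ^ (j + 1))" .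
      qed simp
      also have "int q ^ ?n * (z ^ 2 * (z ^ j * ?r')) = z ^ (j + 2) * (int q ^ ?n * ?r')"
        by (simp add: power_add power2_eq_square)
      also have "[\<dots> = z ^ (j + 2) * ?r'] (mod ?m)"
      proof (rule cong_mult_power[where m = 1])
        have "[int q ^ ?n = 1 + int ?n * z] (mod z\<^sup>2)" unfolding z_def by (rule power_cong_linear)
        then have "[int q ^ ?n = 1 + int ?n * z] (mod z ^ 1)"
          by (rule cong_dvd_modulus) (simp add: power2_eq_square)
        also have "[1 + int ?n * z = 1] (mod z ^ 1)" by (simp add: cong_iff_dvd_diff)
        finally have "[int q ^ ?n * ?r' = 1 * ?r'] (mod z ^ 1)" by (rule cong_scalar_right)
        then show "[int q ^ ?n * ?r' = ?r'] (mod z ^ 1)" by simp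
      qed simp
      finally show ?thesis by (simp add: numeral_3_eq_3 power2_eq_square mult_ac)
    qed
    \<comment> \<open>No formula is available for these counts; row scaling shows that
      \<open>z ^ j\<close> divides them, and \<open>z ^ 3\<close> from the row supplies the rest of
      the modulus.\<close>
    have c4: "[(\<Sum>S\<in>{S \<in> Pow ?X. 3 \<le> card S}. z ^ card S * ?e S) = 0] (mod ?m)"
    proof -
      have "?m dvd z ^ card S * ?e S" if "3 \<le> card S" for S
      proof -
        have "(q - 1) ^ j dvd ext_rank_num R B (ind_vec R J S) I J (Suc j)"
          by (rule ext_rank_num_dvd[OF fin]) simp
        then have "int ((q - 1) ^ j) dvd ?e S" by (simp only: of_nat_dvd_iff)
        then have "z ^ j dvd ?e S" by (simp add: zq del: One_nat_def)
        then have "z ^ 3 * z ^ j dvd z ^ card S * ?e S" by (intro mult_dvd_mono le_imp_power_dvd that)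
        then show ?thesis by (simp add: power_add mult.commute)
      qed
      then show ?thesis unfolding cong_0_iff by (intro dvd_sum) auto
    qed
    have "[int (rank_num R B (insert x I) J i)
      = z ^ Suc j * (?r B J (Suc j) + z * ?s B J (Suc j))
        + (\<Sum>c\<in>?X. z ^ Suc j * (?r B (J - {c}) j
        + z * (?s B (J - {c}) j + int (card {a \<in> I. (a, c) \<in> B}) * ?r B (J - {c}) j)))
        + psum ?X (\<lambda>c d. z ^ Suc j * (z * ?r (merge_board c d B) (J - {c}) j)) + 0] (mod ?m)"
      unfolding split by (intro cong_add cong_sum psum_cong_mod c1 c2 c3 c4)
    also have "(\<Sum>c\<in>?X. z ^ Suc j * (?r B (J - {c}) j
        + z * (?s B (J - {c}) j + int (card {a \<in> I. (a, c) \<in> B}) * ?r B (J - {c}) j)))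
      = z ^ Suc j * ((\<Sum>c\<in>J. cell B x c * ?r B (J - {c}) j)
        + z * (\<Sum>c\<in>J. cell B x c * (?s B (J - {c}) j + (\<Sum>a\<in>I. cell B a c) * ?r B (J - {c}) j)))"
    proof -
      have n: "int (card {a \<in> I. (a, c) \<in> B}) = (\<Sum>a\<in>I. cell B a c)" for c
        using fin by (simp add: cell_def of_bool_def sum.If_cases Int_def)
      have "(\<Sum>c\<in>?X. f c) = (\<Sum>c\<in>J. cell B x c * f c)" for f :: "'j \<Rightarrow> int"
        using fin by (intro sum.mono_neutral_cong_left) (auto simp: cell_def)
      then show ?thesis unfolding n
        by (simp add: sum_distrib_left sum.distrib algebra_simps)
    qed
    also have "psum ?X (\<lambda>c d. z ^ Suc j * (z * ?r (merge_board c d B) (J - {c}) j))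
      = z ^ Suc j * (z * psum J (\<lambda>c d. cell B x c * cell B x d * ?r (merge_board c d B) (J - {c}) j))"
      unfolding psum_filter[OF fin(2)] cell_def psum_mult[symmetric]
      by (intro psum_cong) (simp add: mult_ac)
    finally have main: "[int (rank_num R B (insert x I) J i) = z ^ Suc j * (?r B J (Suc j) + z * ?s B J (Suc j))
        + z ^ Suc j * ((\<Sum>c\<in>J. cell B x c * ?r B (J - {c}) j)
        + z * (\<Sum>c\<in>J. cell B x c * (?s B (J - {c}) j + (\<Sum>a\<in>I. cell B a c) * ?r B (J - {c}) j)))
        + z ^ Suc j * (z * psum J (\<lambda>c d. cell B x c * cell B x d * ?r (merge_board c d B) (J - {c}) j)) + 0] (mod ?m)" .
    have r: "Polynomial.coeff (rook_poly B (insert x I) J) (Suc j)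
        = ?r B J (Suc j) + (\<Sum>c\<in>J. cell B x c * ?r B (J - {c}) j)"
      unfolding rook_poly_insert_row[OF fin insert.hyps(2)] coeff_add coeff_T_mult coeff_sum coeff_cell_mult ..
    have s: "Polynomial.coeff (rook_corr B (insert x I) J) (Suc j) = ?s B J (Suc j)
        + (\<Sum>c\<in>J. cell B x c * (?s B (J - {c}) j + (\<Sum>a\<in>I. cell B a c) * ?r B (J - {c}) j))
        + psum J (\<lambda>c d. cell B x c * cell B x d * ?r (merge_board c d B) (J - {c}) j)"
      unfolding rook_corr_insert[OF fin insert.hyps(2)] coeff_add coeff_T_mult coeff_sum coeff_psum
        mult.assoc coeff_cell_mult coeff_sum_cell_mult ..
    have alg: "a * (b + z * c) + a * (d + z * e) + a * (z * f) + 0 = a * (b + d + z * (c + e + f))"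
      for a b c d e f :: int by (simp add: algebra_simps)
    have m: "j + 3 = i + 2" using Suc by simp
    show ?thesis using main unfolding alg m r[symmetric] s[symmetric] Suc .
  qed
  then show ?case unfolding z_def .
qed

section \<open>Hit polynomials\<close>

text \<open>Currying turns a matrix on cells into a family of rows, and the support condition into
  membership of each row in its \<open>row_space\<close>. The two rank conditions agree because
  \<open>q > 1\<close> makes the exponent unique.\<close>

lemma rank_count_eq_rank_num:
  assumes "primepow q"
  shows "rank_count m n B i q = rank_num (GF q) B {1..m} {1..n} i"
proof -
  interpret F: finite_field "GF q"
    using GF_field[OF assms] by (simp add: finite_field_def finite_field_axioms_def)
  have q: "card (carrier (GF q)) = q" by (rule GF_field(3)[OF assms])
  define I J where "I = {1..m}" and "J = {1..n}"
  have cells: "cells m n = I \<times> J" by (simp add: cells_def I_def J_def)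
  let ?F = "carrier (GF q)"
  let ?f = "\<lambda>A. \<lambda>a\<in>I. \<lambda>j\<in>J. A (a, j)"
  let ?g = "\<lambda>A. \<lambda>(a, j)\<in>I \<times> J. A a j"
  let ?S = "{A \<in> cells m n \<rightarrow>\<^sub>E ?F. mat_rank (GF q) m n A = i \<and> mat_support (GF q) m n A \<subseteq> B}"
  let ?M = "{A \<in> board_mats (GF q) B I J. card (kern (GF q) I J A) * q ^ i = q ^ card J}"
  have rank: "mat_rank (GF q) m n A = i \<longleftrightarrow> card (kern (GF q) I J (\<lambda>a j. A (a, j))) * q ^ i = q ^ card J"
    if A: "A \<in> cells m n \<rightarrow>\<^sub>E ?F" for A
  proof -
    have *: "card (kern (GF q) I J (\<lambda>a j. A (a, j))) * q ^ mat_rank (GF q) m n A = q ^ card J"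
      using card_kern_mat_rank[OF F.field_axioms F.finite_carrier A] by (simp add: q I_def J_def)
    have "q > 1" using F.q_gt_1 by (simp add: q)
    moreover have "card (kern (GF q) I J (\<lambda>a j. A (a, j))) \<noteq> 0"
    proof
      assume "card (kern (GF q) I J (\<lambda>a j. A (a, j))) = 0"
      then have "q ^ card J = 0" using * by simp
      then show False using \<open>q > 1\<close> by simp
    qed
    ultimately show ?thesis unfolding *[symmetric] by (auto simp: power_inject_exp)
  qed
  have kern_f: "kern (GF q) I J (?f A) = kern (GF q) I J (\<lambda>a j. A (a, j))"
    if "A \<in> cells m n \<rightarrow>\<^sub>E ?F" for A
    using that by (intro F.kern_cong) (auto simp: cells)
  have "bij_betw ?f ?S ?M"
  proof (rule bij_betw_byWitness[where f' = ?g])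
    show "\<forall>A\<in>?S. ?g (?f A) = A"
    proof
      fix A assume "A \<in> ?S"
      then have "A \<in> extensional (I \<times> J)" by (simp add: cells PiE_iff)
      then have "?g (?f A) p = A p" for p by (cases p) (auto simp: extensional_def)
      then show "?g (?f A) = A" by blast
    qed
    show "\<forall>A\<in>?M. ?f (?g A) = A"
    proof
      fix A assume "A \<in> ?M"
      then have A: "A \<in> extensional I" "\<And>a. a \<in> I \<Longrightarrow> A a \<in> extensional J"
        by (auto simp: board_mats_def row_space_def PiE_iff)
      then have "?f (?g A) a j = A a j" for a j
        by (cases "a \<in> I"; cases "j \<in> J") (auto simp: extensional_def)
      then show "?f (?g A) = A" by blast
    qed
    show "?f ` ?S \<subseteq> ?M"
    proof (intro image_subsetI)
      fix A assume A: "A \<in> ?S"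
      then have AE: "A \<in> cells m n \<rightarrow>\<^sub>E ?F" by blast
      have "?f A \<in> board_mats (GF q) B I J"
        unfolding board_mats_def row_space_def
      proof (intro PiE_I)
        fix a j assume "a \<in> I" "j \<in> J"
        then show "?f A a j \<in> (if (a, j) \<in> B then ?F else {\<zero>\<^bsub>GF q\<^esub>})"
          using A by (auto simp: mat_support_def cells PiE_iff)
      qed auto
      moreover have "card (kern (GF q) I J (?f A)) * q ^ i = q ^ card J"
        using A rank[OF AE] unfolding kern_f[OF AE] by blast
      ultimately show "?f A \<in> ?M" by blast
    qed
    show "?g ` ?M \<subseteq> ?S"
    proof (intro image_subsetI)
      fix A assume A: "A \<in> ?M"
      then have AB: "A a j \<in> (if (a, j) \<in> B then ?F else {\<zero>\<^bsub>GF q\<^esub>})" if "a \<in> I" "j \<in> J" for a j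
        using that by (auto simp: board_mats_def row_space_def PiE_iff)
      have Ac: "A a j \<in> ?F" if "a \<in> I" "j \<in> J" for a j
        using AB[OF that] F.zero_closed by (cases "(a, j) \<in> B") simp_all
      then have gE: "?g A \<in> cells m n \<rightarrow>\<^sub>E ?F" by (auto simp: cells PiE_iff)
      have "mat_support (GF q) m n (?g A) \<subseteq> B"
      proof
        fix p assume p: "p \<in> mat_support (GF q) m n (?g A)"
        then obtain a j where aj: "p = (a, j)" "a \<in> I" "j \<in> J" "A a j \<noteq> \<zero>\<^bsub>GF q\<^esub>"
          by (auto simp: mat_support_def cells)
        then show "p \<in> B" using AB[of a j] by (auto split: if_splits)
      qed
      moreover have "kern (GF q) I J (\<lambda>a j. ?g A (a, j)) = kern (GF q) I J A"
        using Ac by (intro F.kern_cong) auto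
      then have "mat_rank (GF q) m n (?g A) = i" using rank[OF gE] A by simp
      ultimately show "?g A \<in> ?S" using gE by blast
    qed
  qed
  then show ?thesis
    unfolding rank_count_def rank_num_def q I_def[symmetric] J_def[symmetric] by (rule bij_betw_same_card)
qed

abbreviation U :: "int poly" where "U \<equiv> [:-1, 1:]"

text \<open>The linear functional \<open>T ^ k \<mapsto> (N - k)! (t - 1) ^ k\<close>, which turns rook polynomials into hit polynomials.\<close>
definition rook_to_hit :: "nat \<Rightarrow> int poly \<Rightarrow> int poly" where
  "rook_to_hit N p = (\<Sum>k\<le>N. smult (Polynomial.coeff p k * fact (N - k)) (U ^ k))"

lemma rook_to_hit_add: "rook_to_hit N (p + p') = rook_to_hit N p + rook_to_hit N p'"
  by (simp add: rook_to_hit_def sum.distrib ring_distribs smult_add_left)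

lemma rook_to_hit_0 [simp]: "rook_to_hit N 0 = 0"
  by (simp add: rook_to_hit_def)

lemma rook_to_hit_sum: "rook_to_hit N (\<Sum>a\<in>A. f a) = (\<Sum>a\<in>A. rook_to_hit N (f a))"
  by (induction A rule: infinite_finite_induct) (auto simp: rook_to_hit_add)

lemma rook_to_hit_psum: "rook_to_hit N (psum A f) = psum A (\<lambda>a b. rook_to_hit N (f a b))"
  by (simp add: psum_def rook_to_hit_sum)

lemma rook_to_hit_smult: "rook_to_hit N (smult s p) = smult s (rook_to_hit N p)"
  by (intro poly_eqI) (simp add: rook_to_hit_def coeff_sum sum_distrib_left mult.assoc)

lemma cell_mult_eq_smult: "cell B a c * p = smult (cell B a c) p"
  by (simp add: cell_def)

lemma cell_poly: "(cell B a c :: 'c::comm_semiring_1 poly) = [:cell B a c:]"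
  by (simp add: cell_def one_pCons)

lemma block_weight_mult_eq_smult: "block_weight B a a' c d * p = smult (block_weight B a a' c d) p"
  by (simp add: block_weight_def cell_poly mult_ac)

text \<open>The shift leaves the factorial alone, as \<open>Suc N - Suc k = N - k\<close>; each
  \<open>T\<close> thus turns into a factor \<open>t - 1\<close> and lowers the level by
  one.\<close>

lemma rook_to_hit_T_mult: "rook_to_hit (Suc N) (T * p) = U * rook_to_hit N p"
  unfolding rook_to_hit_def sum.atMost_Suc_shift coeff_T_mult
  by (simp add: sum_distrib_left del: mult_pCons_left mult_pCons_right)

text \<open>The factor \<open>Suc N - k\<close> raises the factorial of \<open>N - k\<close> to that
  of \<open>Suc N - k\<close>. The top coefficient has no counterpart at level \<open>N\<close> and
  must vanish.\<close>

lemma rook_to_hit_Suc: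
  assumes "\<And>k. k \<le> N \<Longrightarrow> Polynomial.coeff p' k = (int (Suc N) - int k) * Polynomial.coeff p k"
    and "Polynomial.coeff p (Suc N) = 0"
  shows "rook_to_hit (Suc N) p = rook_to_hit N p'"
proof -
  have "Polynomial.coeff p k * fact (Suc N - k) = Polynomial.coeff p' k * fact (N - k)" if "k \<le> N" for k
    using that by (simp add: assms(1) Suc_diff_le algebra_simps)
  then show ?thesis unfolding rook_to_hit_def by (simp add: assms(2))
qed

text \<open>The double counting factor \<open>card I - k\<close> is the one that fits the
  factorials. A board with surplus rows is thus traded for the boards with one row less; the bound
  on \<open>card J\<close> excludes placements of \<open>Suc N\<close> rooks.\<close>

lemma rook_to_hit_remove_row:
  assumes fin: "finite I" "finite J" and "card I = Suc N" "card J \<le> N"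
  shows "rook_to_hit (Suc N) (rook_poly B I J) = (\<Sum>a\<in>I. rook_to_hit N (rook_poly B (I - {a}) J))"
  unfolding rook_to_hit_sum[symmetric]
proof (rule rook_to_hit_Suc)
  fix k
  show "Polynomial.coeff (\<Sum>a\<in>I. rook_poly B (I - {a}) J) k
      = (int (Suc N) - int k) * Polynomial.coeff (rook_poly B I J) k"
    using sum_rook_remove_row[OF fin, of B k] fin assms(3) by (simp add: coeff_sum coeff_rook_poly)
qed (use fin assms(4) in \<open>simp add: coeff_rook_poly rook_eq_0\<close>)

lemma rook_to_hit_remove_col:
  assumes fin: "finite I" "finite J" and "card J = Suc N" "card I \<le> N"
  shows "rook_to_hit (Suc N) (rook_poly B I J) = (\<Sum>c\<in>J. rook_to_hit N (rook_poly B I (J - {c})))"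
  using rook_to_hit_remove_row[OF fin(2,1) assms(3,4), of "B\<inverse>"] fin by (simp add: rook_poly_swap)

section \<open>Hit polynomials and their relation to rook polynomials\<close>

definition hit_poly :: "('a \<times> 'b) set \<Rightarrow> 'a set \<Rightarrow> 'b set \<Rightarrow> int poly" where
  "hit_poly B I J = (\<Sum>R\<in>placements I J. if card R = card I then Polynomial.monom 1 (card (R \<inter> B)) else 0)"

lemma coeff_hit_poly:
  assumes "finite I" "finite J"
  shows "Polynomial.coeff (hit_poly B I J) i
    = int (card {R \<in> placements I J. card R = card I \<and> card (R \<inter> B) = i})"
proof -
  have "Polynomial.coeff (hit_poly B I J) i
      = (\<Sum>R\<in>placements I J. if card R = card I \<and> card (R \<inter> B) = i then 1 else 0)"
    unfolding hit_poly_def coeff_sum by (intro sum.cong) auto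
  then show ?thesis using assms by (simp add: sum.If_cases Int_def)
qed

text \<open>A rook of row \<open>x\<close> contributes a factor \<open>t\<close> on the board and 1
  off it, and \<open>1 + cell * (t - 1)\<close> covers both cases. Placements that miss row
  \<open>x\<close> are too small to count.\<close>

lemma hit_poly_insert_row:
  assumes fin: "finite I" "finite J" and x: "x \<notin> I"
  shows "hit_poly B (insert x I) J = (\<Sum>c\<in>J. (1 + cell B x c * U) * hit_poly B I (J - {c}))"
proof -
  have "card R \<le> card I" if "R \<in> placements I J" for R
  proof -
    have "fst ` R \<subseteq> I" using that by (auto simp: placements_def)
    then show ?thesis using card_placement(2)[OF fin that] card_mono[OF fin(1)] by metis
  qed
  then have zero: "(if card R = card (insert x I) then Polynomial.monom 1 (card (R \<inter> B)) else 0) = (0 :: int poly)"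
    if "R \<in> placements I J" for R
    using fin x that by fastforce
  have step: "(\<Sum>R\<in>placements I (J - {c}). if card (insert (x, c) R) = card (insert x I)
      then Polynomial.monom 1 (card (insert (x, c) R \<inter> B)) else 0)
    = (1 + cell B x c * U) * hit_poly B I (J - {c})" for c
    unfolding hit_poly_def sum_distrib_left
  proof (rule sum.cong[OF refl])
    fix R assume R: "R \<in> placements I (J - {c})"
    then have "(x, c) \<notin> R" "finite R"
      using x card_placement(1)[OF fin(1) _ R] fin by (auto simp: placements_def)
    then show "(if card (insert (x, c) R) = card (insert x I) then Polynomial.monom 1 (card (insert (x, c) R \<inter> B)) else 0)
        = (1 + cell B x c * U) * (if card R = card I then Polynomial.monom 1 (card (R \<inter> B)) else 0)"
      using fin x by (auto simp: cell_def Int_insert_left one_pCons monom_Suc)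
  qed
  show ?thesis
    unfolding hit_poly_def[of B "insert x I"] placements_insert_row[OF fin x] using zero step by simp
qed

text \<open>The classical relation \<open>\<Sum> h_i t^i = \<Sum> r_k (n - k)! (t - 1)^k\<close>,
  proved by expanding both sides along a row. The rook polynomial of the remaining rows has a
  surplus column, which the factorials remove.\<close>

lemma hit_poly_eq_rook_to_hit:
  fixes B :: "('a \<times> 'b) set"
  assumes "finite I" "finite J" "card I = n" "card J = n"
  shows "hit_poly B I J = rook_to_hit n (rook_poly B I J)"
  using assms
proof (induction I arbitrary: J n rule: finite_induct)
  case empty
  then have "n = 0" "J = {}" by auto
  moreover have "placements ({} :: 'a set) ({} :: 'b set) = {{}}" by (auto simp: placements_def)
  ultimately show ?case by (simp add: hit_poly_def rook_to_hit_def coeff_rook_poly monom_0)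
next
  case (insert x I)
  obtain N where N: "n = Suc N" "card I = N" using insert.hyps insert.prems by auto
  have fin: "finite I" "finite J" using insert by auto
  have IH: "hit_poly B I (J - {c}) = rook_to_hit N (rook_poly B I (J - {c}))" if "c \<in> J" for c
    using insert.IH[of "J - {c}" N] that N insert.prems by simp
  have "rook_to_hit n (rook_poly B (insert x I) J)
      = rook_to_hit (Suc N) (rook_poly B I J)
        + U * (\<Sum>c\<in>J. smult (cell B x c) (rook_to_hit N (rook_poly B I (J - {c}))))"
    unfolding rook_poly_insert_row[OF fin insert.hyps(2)] rook_to_hit_add N(1) rook_to_hit_T_mult
      cell_mult_eq_smult rook_to_hit_sum rook_to_hit_smult ..
  also have "rook_to_hit (Suc N) (rook_poly B I J) = (\<Sum>c\<in>J. rook_to_hit N (rook_poly B I (J - {c})))"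
    using rook_to_hit_remove_col[OF fin, of N B] N insert.prems by simp
  also have "\<dots> + U * (\<Sum>c\<in>J. smult (cell B x c) (rook_to_hit N (rook_poly B I (J - {c}))))
      = (\<Sum>c\<in>J. (1 + cell B x c * U) * rook_to_hit N (rook_poly B I (J - {c})))"
    unfolding sum_distrib_left sum.distrib[symmetric] cell_mult_eq_smult[symmetric]
    by (intro sum.cong refl) (simp only: distrib_left distrib_right mult_1_left mult_1_right mult_ac)
  also have "\<dots> = hit_poly B (insert x I) J"
    unfolding hit_poly_insert_row[OF fin insert.hyps(2)] using IH by simp
  finally show ?case ..
qed

lemma hit_number_eq_coeff:
  assumes "B \<subseteq> cells n n"
  shows "int (hit_number n n B i) = Polynomial.coeff (hit_poly B {1..n} {1..n}) i"
proof -
  have "non_attacking R \<longleftrightarrow> inj_on fst R \<and> inj_on snd R" for R :: "(nat \<times> nat) set"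
    unfolding non_attacking_def inj_on_def by blast
  then have "{R. R \<subseteq> cells n n \<and> card R = n \<and> non_attacking R \<and> card (R \<inter> B) = i}
      = {R \<in> placements {1..n} {1..n}. card R = card {1..n} \<and> card (R \<inter> B) = i}"
    unfolding placements_def cells_def by auto
  then show ?thesis unfolding hit_number_def by (simp only: coeff_hit_poly finite_atLeastAtMost)
qed

section \<open>The linear coefficient as a sum over two by two blocks\<close>

lemma psum_psum_swap:
  assumes "finite I" "finite J"
  shows "psum I (\<lambda>a b. psum J (\<lambda>c d. F a b c d)) = psum J (\<lambda>c d. psum I (\<lambda>a b. F a b c d))"
  unfolding psum_def[of I] psum_sum[symmetric] ..

lemma sum_offdiag_offdiag:
  fixes F :: "'a::linorder \<Rightarrow> 'a \<Rightarrow> 'b::linorder \<Rightarrow> 'b \<Rightarrow> int"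
  assumes fin: "finite I" "finite J"
  shows "(\<Sum>a\<in>I. \<Sum>b\<in>I - {a}. \<Sum>c\<in>J. \<Sum>d\<in>J - {c}. F a b c d)
    = psum I (\<lambda>a b. psum J (\<lambda>c d. F a b c d + F a b d c + F b a c d + F b a d c))"
  unfolding sum_offdiag[OF fin(1)] sum_offdiag[OF fin(2)] psum_add[symmetric]
  by (simp add: add_ac)

text \<open>The linear coefficient of the \<open>q\<close>-factorial at \<open>q = 1\<close>. It
  equals \<open>m! (m choose 2) / 2\<close>, written here without a quotient; the truncated
  \<open>m - 2\<close> does no harm, since the binomial vanishes for \<open>m < 2\<close>.\<close>

definition fact_corr :: "nat \<Rightarrow> int" where
  "fact_corr m = (int (m choose 2))\<^sup>2 * fact (m - 2)"

lemma choose_two_mult: "2 * (m choose 2) = m * (m - 1)"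
proof -
  have "even (m * (m - 1))" by (cases m) auto
  then show ?thesis by (simp add: choose_two)
qed

lemma int_mult_pred: "int (m * (m - 1)) = int m * (int m - 1)"
  by (cases m) (auto simp: algebra_simps)

lemma int_choose_two: "2 * int (m choose 2) = int m * (int m - 1)"
  by (metis choose_two_mult int_mult_pred of_nat_mult of_nat_numeral)

lemma fact_mult_choose_two: "fact m * int (m choose 2) = 2 * fact_corr m"
proof (cases "m \<ge> 2")
  case True
  then obtain l where m: "m = Suc (Suc l)" by (metis add_2_eq_Suc le_Suc_ex)
  have "int (Suc (Suc l)) * int (Suc l) = 2 * int (m choose 2)" by (simp add: m int_choose_two)
  then have "fact m = 2 * int (m choose 2) * fact l" by (simp add: m mult_ac)
  then show ?thesis by (simp add: fact_corr_def m power2_eq_square)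
qed (simp add: fact_corr_def binomial_eq_0)

section \<open>Double counting of blocks together with placements on their complements\<close>

context
  fixes B :: "('a::linorder \<times> 'b::linorder) set" and I :: "'a set" and J :: "'b set" and n :: nat
  assumes fin: "finite I" "finite J" and card: "card I = n" "card J = n"
begin

abbreviation (input) r where "r k \<equiv> int (rook B I J k)"
abbreviation (input) r2 where "r2 a b c d k \<equiv> int (rook B (I - {a, b}) (J - {c, d}) k)"

lemma r2_sym: "r2 b a c d k = r2 a b c d k" "r2 a b d c k = r2 a b c d k"
  by (simp_all add: insert_commute)

lemma Diff_pair: "A - {a, b} = A - {a} - {b}" by auto

lemma sum_remove_two_cols:
  assumes "finite I'"
  shows "(\<Sum>c\<in>J. \<Sum>d\<in>J - {c}. int (rook B I' (J - {c, d}) k))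
    = (int n - int k) * (int n - 1 - int k) * int (rook B I' J k)"
proof -
  have "(\<Sum>d\<in>J - {c}. int (rook B I' (J - {c, d}) k)) = (int n - 1 - int k) * int (rook B I' (J - {c}) k)"
    if "c \<in> J" for c
  proof -
    have "int (card (J - {c})) = int n - 1" using that card fin card_gt_0_iff[of J] by (auto simp: of_nat_diff)
    then show ?thesis using sum_rook_remove_col[OF assms, of "J - {c}" B k] fin by (simp add: Diff_pair)
  qed
  then have "(\<Sum>c\<in>J. \<Sum>d\<in>J - {c}. int (rook B I' (J - {c, d}) k))
      = (int n - 1 - int k) * (\<Sum>c\<in>J. int (rook B I' (J - {c}) k))"
    by (simp add: sum_distrib_left)
  then show ?thesis using sum_rook_remove_col[OF assms fin(2), of B k] card by (simp add: mult_ac)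
qed

lemma sum_remove_two_rows:
  assumes "finite J'"
  shows "(\<Sum>a\<in>I. \<Sum>b\<in>I - {a}. int (rook B (I - {a, b}) J' k))
    = (int n - int k) * (int n - 1 - int k) * int (rook B I J' k)"
proof -
  have "(\<Sum>b\<in>I - {a}. int (rook B (I - {a, b}) J' k)) = (int n - 1 - int k) * int (rook B (I - {a}) J' k)"
    if "a \<in> I" for a
  proof -
    have "int (card (I - {a})) = int n - 1" using that card fin card_gt_0_iff[of I] by (auto simp: of_nat_diff)
    then show ?thesis using sum_rook_remove_row[of "I - {a}" J' B k] assms fin by (simp add: Diff_pair)
  qed
  then have "(\<Sum>a\<in>I. \<Sum>b\<in>I - {a}. int (rook B (I - {a, b}) J' k))
      = (int n - 1 - int k) * (\<Sum>a\<in>I. int (rook B (I - {a}) J' k))"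
    by (simp add: sum_distrib_left)
  then show ?thesis using sum_rook_remove_row[OF fin(1) assms, of B k] card by (simp add: mult_ac)
qed

text \<open>Choosing two rows and two columns in order counts each block four times; a placement of
  \<open>k\<close> rooks leaves \<open>n - k\<close> rows and as many columns to choose
  from.\<close>

lemma blocks_total:
  "4 * psum I (\<lambda>a b. psum J (\<lambda>c d. r2 a b c d k)) = ((int n - int k) * (int n - 1 - int k))\<^sup>2 * r k"
proof -
  have "(\<Sum>a\<in>I. \<Sum>b\<in>I - {a}. \<Sum>c\<in>J. \<Sum>d\<in>J - {c}. r2 a b c d k)
      = (\<Sum>a\<in>I. \<Sum>b\<in>I - {a}. (int n - int k) * (int n - 1 - int k) * int (rook B (I - {a, b}) J k))"
    using fin by (intro sum.cong refl sum_remove_two_cols) auto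
  also have "\<dots> = (int n - int k) * (int n - 1 - int k) * ((int n - int k) * (int n - 1 - int k) * r k)"
    unfolding sum_remove_two_rows[OF fin(2), symmetric] sum_distrib_left ..
  finally have "(\<Sum>a\<in>I. \<Sum>b\<in>I - {a}. \<Sum>c\<in>J. \<Sum>d\<in>J - {c}. r2 a b c d k)
      = ((int n - int k) * (int n - 1 - int k))\<^sup>2 * r k"
    by (simp add: power2_eq_square mult_ac)
  moreover have "(\<Sum>a\<in>I. \<Sum>b\<in>I - {a}. \<Sum>c\<in>J. \<Sum>d\<in>J - {c}. r2 a b c d k)
      = 4 * psum I (\<lambda>a b. psum J (\<lambda>c d. r2 a b c d k))"
    unfolding sum_offdiag_offdiag[OF fin] psum_mult[symmetric] r2_sym by simp
  ultimately show ?thesis by simp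
qed

text \<open>A block with one of its cells marked amounts to a placement of \<open>Suc k\<close>
  rooks with a marked rook, together with one of the \<open>n - 1 - k\<close> empty rows and one of
  the \<open>n - 1 - k\<close> empty columns.\<close>

lemma blocks_cells:
  "psum I (\<lambda>a b. psum J (\<lambda>c d. (cell B a c + cell B a d + cell B b c + cell B b d) * r2 a b c d k))
    = (int n - 1 - int k)\<^sup>2 * (int (Suc k) * r (Suc k))"
proof -
  have "(\<Sum>a\<in>I. \<Sum>b\<in>I - {a}. \<Sum>c\<in>J. \<Sum>d\<in>J - {c}. cell B a c * r2 a b c d k)
      = (\<Sum>a\<in>I. \<Sum>c\<in>J. cell B a c * (\<Sum>b\<in>I - {a}. \<Sum>d\<in>J - {c}. r2 a b c d k))"
    unfolding sum_distrib_left by (intro sum.cong refl sum.swap)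
  also have "\<dots> = (\<Sum>a\<in>I. \<Sum>c\<in>J. cell B a c * ((int n - 1 - int k)\<^sup>2 * int (rook B (I - {a}) (J - {c}) k)))"
  proof (intro sum.cong refl arg_cong[of _ _ "times _"])
    fix a c assume ac: "a \<in> I" "c \<in> J"
    have cI: "int (card (I - {a})) = int n - 1" using ac card fin card_gt_0_iff[of I] by (auto simp: of_nat_diff)
    have cJ: "int (card (J - {c})) = int n - 1" using ac card fin card_gt_0_iff[of J] by (auto simp: of_nat_diff)
    have "(\<Sum>d\<in>J - {c}. r2 a b c d k) = (int n - 1 - int k) * int (rook B (I - {a} - {b}) (J - {c}) k)" for b
      using sum_rook_remove_col[of "I - {a} - {b}" "J - {c}" B k] fin cJ by (simp add: Diff_pair)
    then have "(\<Sum>b\<in>I - {a}. \<Sum>d\<in>J - {c}. r2 a b c d k)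
        = (int n - 1 - int k) * (\<Sum>b\<in>I - {a}. int (rook B (I - {a} - {b}) (J - {c}) k))"
      by (simp add: sum_distrib_left)
    then show "(\<Sum>b\<in>I - {a}. \<Sum>d\<in>J - {c}. r2 a b c d k)
        = (int n - 1 - int k)\<^sup>2 * int (rook B (I - {a}) (J - {c}) k)"
      using sum_rook_remove_row[of "I - {a}" "J - {c}" B k] fin cI by (simp add: power2_eq_square)
  qed
  also have "\<dots> = (int n - 1 - int k)\<^sup>2 * (int (Suc k) * r (Suc k))"
    unfolding sum_rook_remove_cell[OF fin, symmetric] sum_distrib_left cell_def
    by (intro sum.cong refl) (simp only: mult_ac)
  finally show ?thesis
    unfolding sum_offdiag_offdiag[OF fin] r2_sym by (simp add: ring_distribs add_ac)
qed

text \<open>Two rooks on a diagonal of the block enlarge the placement to \<open>Suc (Suc k)\<close>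
  rooks; marking them in order counts each diagonal twice.\<close>

lemma blocks_diagonals:
  "2 * psum I (\<lambda>a b. psum J (\<lambda>c d. (cell B a c * cell B b d + cell B a d * cell B b c) * r2 a b c d k))
    = int (Suc k) * int (Suc (Suc k)) * r (Suc (Suc k))"
proof -
  have "(\<Sum>a\<in>I. \<Sum>b\<in>I - {a}. \<Sum>c\<in>J. \<Sum>d\<in>J - {c}. cell B a c * cell B b d * r2 a b c d k)
      = (\<Sum>a\<in>I. \<Sum>c\<in>J. cell B a c * (\<Sum>b\<in>I - {a}. \<Sum>d\<in>J - {c}. cell B b d * r2 a b c d k))"
    unfolding sum_distrib_left mult.assoc by (intro sum.cong refl sum.swap)
  also have "\<dots> = (\<Sum>a\<in>I. \<Sum>c\<in>J. cell B a c * (int (Suc k) * int (rook B (I - {a}) (J - {c}) (Suc k))))"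
  proof (intro sum.cong refl arg_cong[of _ _ "times _"])
    fix a c
    show "(\<Sum>b\<in>I - {a}. \<Sum>d\<in>J - {c}. cell B b d * r2 a b c d k)
        = int (Suc k) * int (rook B (I - {a}) (J - {c}) (Suc k))"
      using sum_rook_remove_cell[of "I - {a}" "J - {c}" B k] fin unfolding cell_def Diff_pair by blast
  qed
  also have "\<dots> = int (Suc k) * (\<Sum>a\<in>I. \<Sum>c\<in>J. cell B a c * int (rook B (I - {a}) (J - {c}) (Suc k)))"
    by (simp add: sum_distrib_left mult_ac)
  also have "(\<Sum>a\<in>I. \<Sum>c\<in>J. cell B a c * int (rook B (I - {a}) (J - {c}) (Suc k)))
      = int (Suc (Suc k)) * r (Suc (Suc k))"
    using sum_rook_remove_cell[OF fin, of B "Suc k"] unfolding cell_def .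
  finally have "(\<Sum>a\<in>I. \<Sum>b\<in>I - {a}. \<Sum>c\<in>J. \<Sum>d\<in>J - {c}. cell B a c * cell B b d * r2 a b c d k)
      = int (Suc k) * int (Suc (Suc k)) * r (Suc (Suc k))" by simp
  moreover have "(\<Sum>a\<in>I. \<Sum>b\<in>I - {a}. \<Sum>c\<in>J. \<Sum>d\<in>J - {c}. cell B a c * cell B b d * r2 a b c d k)
      = 2 * psum I (\<lambda>a b. psum J (\<lambda>c d. (cell B a c * cell B b d + cell B a d * cell B b c) * r2 a b c d k))"
    unfolding sum_offdiag_offdiag[OF fin] psum_mult[symmetric] r2_sym
    by (intro psum_cong) (simp add: algebra_simps)
  ultimately show ?thesis by simp
qed

text \<open>Two cells in a row leave a complement with one more row than columns. Removing a surplus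
  row \<open>b\<close> completes the two cells to a block, and the block arises in this way from
  either of its rows.\<close>

lemma hook_rows_to_hit:
  assumes n: "n = Suc (Suc N)"
  shows "rook_to_hit (Suc N) (hook_rows B I J)
    = psum I (\<lambda>a b. psum J (\<lambda>c d. smult (cell B a c * cell B a d + cell B b c * cell B b d)
        (rook_to_hit N (rook_poly B (I - {a, b}) (J - {c, d})))))"
proof -
  have "rook_to_hit (Suc N) (hook_rows B I J)
      = (\<Sum>a\<in>I. psum J (\<lambda>c d. smult (cell B a c * cell B a d) (rook_to_hit (Suc N) (rook_poly B (I - {a}) (J - {c, d})))))"
    unfolding hook_rows_def rook_to_hit_sum rook_to_hit_psum mult.assoc
    unfolding cell_mult_eq_smult rook_to_hit_smult smult_smult ..
  also have "\<dots> = (\<Sum>a\<in>I. psum J (\<lambda>c d. \<Sum>b\<in>I - {a}. smult (cell B a c * cell B a d)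
      (rook_to_hit N (rook_poly B (I - {a, b}) (J - {c, d})))))"
  proof (intro sum.cong refl psum_cong)
    fix a c d assume *: "a \<in> I" "c \<in> J" "d \<in> J" "c < d"
    have "card (I - {a}) = Suc N" "card (J - {c, d}) = N" using * card n fin by auto
    then have "rook_to_hit (Suc N) (rook_poly B (I - {a}) (J - {c, d}))
        = (\<Sum>b\<in>I - {a}. rook_to_hit N (rook_poly B (I - {a, b}) (J - {c, d})))"
      using rook_to_hit_remove_row[of "I - {a}" "J - {c, d}" N B] fin by (simp add: Diff_pair[of I])
    then show "smult (cell B a c * cell B a d) (rook_to_hit (Suc N) (rook_poly B (I - {a}) (J - {c, d})))
        = (\<Sum>b\<in>I - {a}. smult (cell B a c * cell B a d) (rook_to_hit N (rook_poly B (I - {a, b}) (J - {c, d}))))"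
      by (simp add: cell_def of_bool_conj[symmetric])
  qed
  also have "\<dots> = (\<Sum>a\<in>I. \<Sum>b\<in>I - {a}. psum J (\<lambda>c d. smult (cell B a c * cell B a d)
      (rook_to_hit N (rook_poly B (I - {a, b}) (J - {c, d})))))"
    unfolding psum_sum ..
  also have "\<dots> = psum I (\<lambda>a b. psum J (\<lambda>c d. smult (cell B a c * cell B a d + cell B b c * cell B b d)
        (rook_to_hit N (rook_poly B (I - {a, b}) (J - {c, d})))))"
    unfolding sum_offdiag[OF fin(1)] psum_add[symmetric]
    by (intro psum_cong) (simp add: smult_add_left insert_commute)
  finally show ?thesis .
qed

lemma hook_cols_to_hit:
  assumes n: "n = Suc (Suc N)"
  shows "rook_to_hit (Suc N) (hook_cols B I J)
    = psum I (\<lambda>a b. psum J (\<lambda>c d. smult (cell B a c * cell B b c + cell B a d * cell B b d)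
        (rook_to_hit N (rook_poly B (I - {a, b}) (J - {c, d})))))"
proof -
  have "rook_to_hit (Suc N) (hook_cols B I J)
      = (\<Sum>c\<in>J. psum I (\<lambda>a b. smult (cell B a c * cell B b c) (rook_to_hit (Suc N) (rook_poly B (I - {a, b}) (J - {c})))))"
    unfolding hook_cols_def rook_to_hit_sum rook_to_hit_psum mult.assoc
    unfolding cell_mult_eq_smult rook_to_hit_smult smult_smult ..
  also have "\<dots> = (\<Sum>c\<in>J. psum I (\<lambda>a b. \<Sum>d\<in>J - {c}. smult (cell B a c * cell B b c)
      (rook_to_hit N (rook_poly B (I - {a, b}) (J - {c, d})))))"
  proof (intro sum.cong refl psum_cong)
    fix a b c assume *: "c \<in> J" "a \<in> I" "b \<in> I" "a < b"
    have "card (J - {c}) = Suc N" "card (I - {a, b}) = N" using * card n fin by auto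
    then have "rook_to_hit (Suc N) (rook_poly B (I - {a, b}) (J - {c}))
        = (\<Sum>d\<in>J - {c}. rook_to_hit N (rook_poly B (I - {a, b}) (J - {c, d})))"
      using rook_to_hit_remove_col[of "I - {a, b}" "J - {c}" N B] fin by (simp add: Diff_pair[of J])
    then show "smult (cell B a c * cell B b c) (rook_to_hit (Suc N) (rook_poly B (I - {a, b}) (J - {c})))
        = (\<Sum>d\<in>J - {c}. smult (cell B a c * cell B b c) (rook_to_hit N (rook_poly B (I - {a, b}) (J - {c, d}))))"
      by (simp add: cell_def of_bool_conj[symmetric])
  qed
  also have "\<dots> = (\<Sum>c\<in>J. \<Sum>d\<in>J - {c}. psum I (\<lambda>a b. smult (cell B a c * cell B b c)
      (rook_to_hit N (rook_poly B (I - {a, b}) (J - {c, d})))))"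
    unfolding psum_sum ..
  also have "\<dots> = psum J (\<lambda>c d. psum I (\<lambda>a b. smult (cell B a c * cell B b c + cell B a d * cell B b d)
        (rook_to_hit N (rook_poly B (I - {a, b}) (J - {c, d})))))"
    unfolding sum_offdiag[OF fin(2)] psum_add[symmetric]
    by (intro psum_cong) (simp add: smult_add_left insert_commute)
  finally show ?thesis unfolding psum_psum_swap[OF fin] .
qed


text \<open>The coefficient of \<open>q - 1\<close> in the expansion of the \<open>q\<close>-hit polynomial, term by term.\<close>
definition hit_corr :: "int poly" where
  "hit_corr = (\<Sum>i\<le>n. smult (Polynomial.coeff (rook_corr B I J) i * fact (n - i)) (U ^ i)
     + smult (r i * fact_corr (n - i)) (U ^ i)
     + smult (r i * fact (n - i) * (int (n choose 2) - int (i choose 2))) (U ^ i)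
     - smult (r i * fact (n - i) * int (i choose 2)) (U ^ (i - 1)))"

text \<open>The constant is \<open>3 = 1 + 2\<close>: one from the \<open>q\<close>-factorial and
  two from the power of \<open>q\<close>, which also yields the single cells. Pairs in a line come
  from \<open>hook_rows\<close> and \<open>hook_cols\<close>, the negative diagonal pairs from the
  factors \<open>t - q ^ j\<close>, the last term from \<open>blocks\<close>.\<close>

definition block_poly :: "'a \<Rightarrow> 'a \<Rightarrow> 'b \<Rightarrow> 'b \<Rightarrow> int poly" where
  "block_poly a b c d = 3
     + U * (cell B a c + cell B a d + cell B b c + cell B b d)
     + U * (cell B a c * cell B a d + cell B b c * cell B b d + (cell B a c * cell B b c + cell B a d * cell B b d)
            - (cell B a c * cell B b d + cell B a d * cell B b c))
     + U * (U * block_weight B a b c d)"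

text \<open>Sorts a sum over blocks by powers of \<open>t - 1\<close>, whose coefficients are the
  sums evaluated by double counting.\<close>

lemma psum_rook_to_hit:
  "psum I (\<lambda>a b. psum J (\<lambda>c d. smult (f a b c d) (rook_to_hit N (rook_poly B (I - {a, b}) (J - {c, d})))))
    = (\<Sum>k\<le>N. smult (fact (N - k) * psum I (\<lambda>a b. psum J (\<lambda>c d. f a b c d * r2 a b c d k))) (U ^ k))"
proof -
  have "psum I (\<lambda>a b. psum J (\<lambda>c d. smult (f a b c d) (rook_to_hit N (rook_poly B (I - {a, b}) (J - {c, d})))))
      = rook_to_hit N (psum I (\<lambda>a b. psum J (\<lambda>c d. smult (f a b c d) (rook_poly B (I - {a, b}) (J - {c, d})))))"
    by (simp add: rook_to_hit_psum rook_to_hit_smult)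
  then show ?thesis
    unfolding rook_to_hit_def coeff_psum using fin by (simp add: coeff_rook_poly mult.commute)
qed

text \<open>All contributions are written over the same blocks so that their local weights can be
  added: the diagonal pairs enter with a negative sign, and nonnegativity is visible only after
  everything has been combined.\<close>

lemma hit_corr_eq_psum:
  assumes n: "n = Suc (Suc N)"
  shows "hit_corr = psum I (\<lambda>a b. psum J (\<lambda>c d.
    block_poly a b c d * rook_to_hit N (rook_poly B (I - {a, b}) (J - {c, d}))))"
proof -
  let ?W = "\<lambda>a b c d. rook_to_hit N (rook_poly B (I - {a, b}) (J - {c, d}))"
  let ?pp = "\<lambda>f. psum I (\<lambda>a b. psum J (\<lambda>c d. smult (f a b c d) (?W a b c d)))"
  define u where "u = U"
  have P1: "(\<Sum>i\<le>n. smult (Polynomial.coeff (rook_corr B I J) i * fact (n - i)) (u ^ i))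
      = u * (?pp (\<lambda>a b c d. cell B a c * cell B a d + cell B b c * cell B b d)
          + ?pp (\<lambda>a b c d. cell B a c * cell B b c + cell B a d * cell B b d))
        + u * (u * ?pp (block_weight B))"
  proof -
    have "(\<Sum>i\<le>n. smult (Polynomial.coeff (rook_corr B I J) i * fact (n - i)) (u ^ i))
        = rook_to_hit (Suc (Suc N)) (rook_corr B I J)"
      unfolding rook_to_hit_def n u_def ..
    also have "\<dots> = U * (rook_to_hit (Suc N) (hook_rows B I J) + rook_to_hit (Suc N) (hook_cols B I J))
        + U * (U * rook_to_hit N (blocks B I J))"
      unfolding rook_corr_def rook_to_hit_add rook_to_hit_T_mult ..
    also have "rook_to_hit N (blocks B I J) = ?pp (block_weight B)"
      unfolding blocks_def block_weight_mult_eq_smult rook_to_hit_psum rook_to_hit_smult ..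
    finally show ?thesis unfolding hook_rows_to_hit[OF n] hook_cols_to_hit[OF n] u_def .
  qed
  \<comment> \<open>A placement of \<open>k\<close> rooks leaves \<open>n - k\<close> rows and
    columns empty; choosing two of each gives the squared binomial in
    \<open>fact_corr\<close>.\<close>
  have P2: "(\<Sum>i\<le>n. smult (r i * fact_corr (n - i)) (u ^ i)) = ?pp (\<lambda>a b c d. 1)"
  proof -
    have "?pp (\<lambda>a b c d. 1) = (\<Sum>k\<le>N. smult (r k * fact_corr (n - k)) (u ^ k))"
      unfolding psum_rook_to_hit u_def
    proof (rule sum.cong[OF refl])
      fix k assume "k \<in> {..N}"
      then obtain m where m: "N = k + m" using le_Suc_ex by auto
      have "4 * psum I (\<lambda>a b. psum J (\<lambda>c d. r2 a b c d k)) = (int (m + 2) * int (m + 1))\<^sup>2 * r k"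
        unfolding blocks_total by (simp add: n m algebra_simps)
      moreover have "int (m + 2) * int (m + 1) = 2 * int (Suc (Suc m) choose 2)"
        by (simp add: int_choose_two)
      ultimately have "4 * psum I (\<lambda>a b. psum J (\<lambda>c d. r2 a b c d k)) = (2 * int (Suc (Suc m) choose 2))\<^sup>2 * r k"
        by (simp only:)
      then have "psum I (\<lambda>a b. psum J (\<lambda>c d. r2 a b c d k)) = (int (Suc (Suc m) choose 2))\<^sup>2 * r k"
        by (simp add: power_mult_distrib)
      then show "smult (fact (N - k) * psum I (\<lambda>a b. psum J (\<lambda>c d. 1 * r2 a b c d k))) (U ^ k)
          = smult (r k * fact_corr (n - k)) (U ^ k)"
        by (simp add: fact_corr_def n m Suc_diff_le mult_ac)
    qed
    then show ?thesis by (simp add: n fact_corr_def binomial_eq_0)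
  qed
  \<comment> \<open>The terms \<open>i = 0\<close> and \<open>i = n\<close> vanish. For
    \<open>i = Suc k\<close> the factors \<open>n - i\<close> and \<open>fact (n - i)\<close>
    combine to the square of \<open>n - 1 - k\<close> times \<open>fact (N - k)\<close>.\<close>
  have P3': "(\<Sum>i\<le>n. smult (r i * (int i * int (n - i) * fact (n - i))) (u ^ i))
      = u * ?pp (\<lambda>a b c d. cell B a c + cell B a d + cell B b c + cell B b d)"
  proof -
    have "(\<Sum>i\<le>n. smult (r i * (int i * int (n - i) * fact (n - i))) (u ^ i))
        = (\<Sum>k\<le>Suc N. smult (r (Suc k) * (int (Suc k) * int (n - Suc k) * fact (n - Suc k))) (u ^ Suc k))"
      unfolding n sum.atMost_Suc_shift[of _ "Suc N"] by simp
    also have "\<dots> = (\<Sum>k\<le>N. smult (r (Suc k) * (int (Suc k) * int (n - Suc k) * fact (n - Suc k))) (u ^ Suc k))"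
      by (simp add: n)
    also have "\<dots> = u * ?pp (\<lambda>a b c d. cell B a c + cell B a d + cell B b c + cell B b d)"
      unfolding psum_rook_to_hit blocks_cells sum_distrib_left
    proof (rule sum.cong[OF refl])
      fix k assume "k \<in> {..N}"
      then obtain m where m: "N = k + m" using le_Suc_ex by auto
      have e: "r (Suc k) * (int (Suc k) * int (n - Suc k) * fact (n - Suc k))
          = fact (N - k) * ((int n - 1 - int k)\<^sup>2 * (int (Suc k) * r (Suc k)))"
        by (simp add: n m power2_eq_square algebra_simps)
      show "smult (r (Suc k) * (int (Suc k) * int (n - Suc k) * fact (n - Suc k))) (u ^ Suc k)
          = u * smult (fact (N - k) * ((int n - 1 - int k)\<^sup>2 * (int (Suc k) * r (Suc k)))) (U ^ k)"
        unfolding e u_def[symmetric] by simp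
    qed
    finally show ?thesis .
  qed
  have P3: "(\<Sum>i\<le>n. smult (r i * fact (n - i) * (int (n choose 2) - int (i choose 2))) (u ^ i))
      = 2 * ?pp (\<lambda>a b c d. 1) + u * ?pp (\<lambda>a b c d. cell B a c + cell B a d + cell B b c + cell B b d)"
  proof -
    have "(\<Sum>i\<le>n. smult (r i * fact (n - i) * (int (n choose 2) - int (i choose 2))) (u ^ i))
        = (\<Sum>i\<le>n. 2 * smult (r i * fact_corr (n - i)) (u ^ i) + smult (r i * (int i * int (n - i) * fact (n - i))) (u ^ i))"
    proof (rule sum.cong[OF refl])
      fix i assume "i \<in> {..n}"
      then obtain m where m: "n = i + m" using le_Suc_ex by auto
      \<comment> \<open>Pairs among \<open>i + m\<close> elements that do not lie within the first
        \<open>i\<close> are within the last \<open>m\<close> or mixed. The former lead to twice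
        \<open>fact_corr\<close>, the latter to the single cells.\<close>
      have "int (n choose 2) - int (i choose 2) = int (m choose 2) + int i * int m"
        using int_choose_two[of n] int_choose_two[of i] int_choose_two[of m] unfolding m by (simp add: algebra_simps)
      moreover have "fact m * int (m choose 2) = 2 * fact_corr m" by (rule fact_mult_choose_two)
      ultimately have e: "r i * fact (n - i) * (int (n choose 2) - int (i choose 2))
          = 2 * (r i * fact_corr (n - i)) + r i * (int i * int (n - i) * fact (n - i))"
        by (simp add: m algebra_simps)
      show "smult (r i * fact (n - i) * (int (n choose 2) - int (i choose 2))) (u ^ i)
          = 2 * smult (r i * fact_corr (n - i)) (u ^ i) + smult (r i * (int i * int (n - i) * fact (n - i))) (u ^ i)"
        unfolding e mult_2 smult_add_left ..
    qed
    also have "\<dots> = 2 * (\<Sum>i\<le>n. smult (r i * fact_corr (n - i)) (u ^ i))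
        + (\<Sum>i\<le>n. smult (r i * (int i * int (n - i) * fact (n - i))) (u ^ i))"
      by (simp add: sum.distrib sum_distrib_left)
    finally show ?thesis unfolding P2 P3' .
  qed
  \<comment> \<open>The index is shifted by two because \<open>i choose 2\<close> vanishes for
    \<open>i < 2\<close>; the exponent \<open>i - 1\<close> is then \<open>Suc k\<close>, which
    leaves one factor \<open>u\<close> in front.\<close>
  have P4: "(\<Sum>i\<le>n. smult (r i * fact (n - i) * int (i choose 2)) (u ^ (i - 1)))
      = u * ?pp (\<lambda>a b c d. cell B a c * cell B b d + cell B a d * cell B b c)"
  proof -
    have "(\<Sum>i\<le>n. smult (r i * fact (n - i) * int (i choose 2)) (u ^ (i - 1)))
        = (\<Sum>k\<le>N. smult (r (Suc (Suc k)) * fact (N - k) * int (Suc (Suc k) choose 2)) (u ^ Suc k))"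
      unfolding n sum.atMost_Suc_shift by (simp add: binomial_eq_0)
    also have "\<dots> = u * ?pp (\<lambda>a b c d. cell B a c * cell B b d + cell B a d * cell B b c)"
      unfolding psum_rook_to_hit sum_distrib_left
    proof (rule sum.cong[OF refl])
      fix k
      let ?x = "psum I (\<lambda>a b. psum J (\<lambda>c d. (cell B a c * cell B b d + cell B a d * cell B b c) * r2 a b c d k))"
      have e: "2 * int (Suc (Suc k) choose 2) = int (Suc k) * int (Suc (Suc k))" by (simp add: int_choose_two)
      have "2 * ?x = 2 * (int (Suc (Suc k) choose 2) * r (Suc (Suc k)))"
        unfolding blocks_diagonals mult.assoc[symmetric] e ..
      then have x: "?x = int (Suc (Suc k) choose 2) * r (Suc (Suc k))" by simp
      show "smult (r (Suc (Suc k)) * fact (N - k) * int (Suc (Suc k) choose 2)) (u ^ Suc k)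
          = u * smult (fact (N - k) * ?x) (U ^ k)"
        unfolding x u_def[symmetric] by (simp add: mult_ac)
    qed
    finally show ?thesis .
  qed
  have cm: "cell B a c * p = smult (cell B a c) p" for a c p by (rule cell_mult_eq_smult)
  have expand: "block_poly a b c d * p = 3 * smult 1 p
      + u * smult (cell B a c + cell B a d + cell B b c + cell B b d) p
      + u * (smult (cell B a c * cell B a d + cell B b c * cell B b d) p
          + smult (cell B a c * cell B b c + cell B a d * cell B b d) p)
      - u * smult (cell B a c * cell B b d + cell B a d * cell B b c) p
      + u * (u * smult (block_weight B a b c d) p)" for a b c d p
  proof -
    have s1: "smult (x + y) p = smult x p + smult y p" for x y and p :: "int poly" by (rule smult_add_left)
    have s2: "smult (cell B a c * y) p = cell B a c * smult y p" for a c y p unfolding cm smult_smult ..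
    have s3: "smult (cell B a c) p = cell B a c * p" for a c p by (simp add: cm)
    show ?thesis
      unfolding block_poly_def u_def[symmetric] block_weight_mult_eq_smult[symmetric] s1 s2 s3 smult_1_left
      by (simp add: algebra_simps)
  qed
  have "hit_corr = (u * (?pp (\<lambda>a b c d. cell B a c * cell B a d + cell B b c * cell B b d)
          + ?pp (\<lambda>a b c d. cell B a c * cell B b c + cell B a d * cell B b d))
        + u * (u * ?pp (block_weight B)))
      + ?pp (\<lambda>a b c d. 1)
      + (2 * ?pp (\<lambda>a b c d. 1) + u * ?pp (\<lambda>a b c d. cell B a c + cell B a d + cell B b c + cell B b d))
      - u * ?pp (\<lambda>a b c d. cell B a c * cell B b d + cell B a d * cell B b c)"
    unfolding hit_corr_def u_def[symmetric] sum_subtractf sum.distrib P1 P2 P3 P4 ..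
  also have "\<dots> = 3 * ?pp (\<lambda>a b c d. 1)
      + u * ?pp (\<lambda>a b c d. cell B a c + cell B a d + cell B b c + cell B b d)
      + u * (?pp (\<lambda>a b c d. cell B a c * cell B a d + cell B b c * cell B b d)
          + ?pp (\<lambda>a b c d. cell B a c * cell B b c + cell B a d * cell B b d))
      - u * ?pp (\<lambda>a b c d. cell B a c * cell B b d + cell B a d * cell B b c)
      + u * (u * ?pp (block_weight B))"
    by (simp add: algebra_simps)
  also have "\<dots> = psum I (\<lambda>a b. psum J (\<lambda>c d. block_poly a b c d * ?W a b c d))"
    unfolding expand psum_add psum_diff psum_mult ..
  finally show ?thesis .
qed

lemma hit_corr_nonneg: "Polynomial.coeff hit_corr i \<ge> 0"
proof (cases "n \<ge> 2")
  case False
  \<comment> \<open>With fewer than two rows and columns there are no pairs, and all binomials in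
    \<open>hit_corr\<close> are zero.\<close>
  have ps: "psum A F = 0" if "finite A" "card A \<le> 1" for A :: "'c::linorder set" and F :: "'c \<Rightarrow> 'c \<Rightarrow> int poly"
    using that by (auto simp: psum_def card_le_Suc0_iff_eq intro!: sum.neutral)
  have "rook_corr B I J = 0"
    using ps[OF fin(1)] ps[OF fin(2)] False card by (simp add: rook_corr_def hook_rows_def hook_cols_def blocks_def)
  then have "hit_corr = 0"
    unfolding hit_corr_def using False by (intro sum.neutral) (auto simp: fact_corr_def binomial_eq_0)
  then show ?thesis by simp
next
  case True
  then obtain N where n: "n = Suc (Suc N)" by (metis add_2_eq_Suc le_Suc_ex)
  have W: "Polynomial.coeff (rook_to_hit N (rook_poly B (I - {a, b}) (J - {c, d}))) k \<ge> 0"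
    if "a \<in> I" "b \<in> I" "a < b" "c \<in> J" "d \<in> J" "c < d" for a b c d k
  proof -
    have "card (I - {a, b}) = N" "card (J - {c, d}) = N" using that card n fin by auto
    then have "rook_to_hit N (rook_poly B (I - {a, b}) (J - {c, d})) = hit_poly B (I - {a, b}) (J - {c, d})"
      using hit_poly_eq_rook_to_hit[of "I - {a, b}" "J - {c, d}" N B] fin by simp
    then show ?thesis using fin by (simp only: coeff_hit_poly finite_Diff of_nat_0_le_iff)
  qed
  have bp: "Polynomial.coeff (block_poly a b c d) k \<ge> 0" for a b c d k
  proof -
    have n3: "(3 :: int poly) = [:3:]" by (simp add: numeral_poly)
    \<comment> \<open>The weight depends on four cells only, and each of the sixteen cases is a
      polynomial of degree at most two with explicit coefficients.\<close>
    have "\<exists>x y w. block_poly a b c d = [:x, y, w:] \<and> x \<ge> 0 \<and> y \<ge> 0 \<and> w \<ge> 0"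
      unfolding block_poly_def block_weight_def cell_poly[where 'c = int] n3
      by (cases "(a, c) \<in> B"; cases "(a, d) \<in> B"; cases "(b, c) \<in> B"; cases "(b, d) \<in> B") (simp_all add: cell_def)
    then show ?thesis by (auto simp: coeff_pCons split: nat.split)
  qed
  have "Polynomial.coeff (block_poly a b c d * rook_to_hit N (rook_poly B (I - {a, b}) (J - {c, d}))) i \<ge> 0"
    if "a \<in> I" "b \<in> I" "a < b" "c \<in> J" "d \<in> J" "c < d" for a b c d
    unfolding coeff_mult using bp W[OF that] by (intro sum_nonneg mult_nonneg_nonneg) auto
  then show ?thesis
    unfolding hit_corr_eq_psum[OF n] coeff_psum psum_def coeff_sum by (intro sum_nonneg) auto
qed

end

section \<open>First order expansion of the \<open>q\<close>-hit numbers\<close>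

lemma dvd_diff_mult:
  fixes m :: "'a::comm_ring_1"
  assumes "m dvd a - a'" "m dvd b - b'"
  shows "m dvd a * b - a' * b'"
proof -
  have "a * b - a' * b' = (a - a') * b + a' * (b - b')" by (simp add: algebra_simps)
  then show ?thesis using assms by simp
qed

lemma dvd_diff_trans:
  fixes m :: "'a::comm_ring_1"
  assumes "m dvd a - b" "m dvd b - c"
  shows "m dvd a - c"
  using dvd_add[OF assms] by simp

lemma choose_two_Suc: "int (Suc k choose 2) = int (k choose 2) + int k"
  by (simp add: numeral_2_eq_2)

text \<open>Each summand \<open>q ^ j\<close> is \<open>1 + j (q - 1)\<close> to first order, and
  the \<open>j < k\<close> add up to \<open>k choose 2\<close>.\<close>

lemma q_int_linear:
  fixes q :: int
  shows "(q - 1)\<^sup>2 dvd q_int q k - (int k + (q - 1) * int (k choose 2))"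
proof (induction k)
  case 0
  then show ?case by (simp add: q_int_def binomial_eq_0)
next
  case (Suc k)
  have "(q - 1)\<^sup>2 dvd q ^ k - (1 + int k * (q - 1))" using power_cong_linear by (simp add: cong_iff_dvd_diff)
  from dvd_add[OF Suc this] show ?case by (simp add: q_int_def choose_two_Suc algebra_simps)
qed

text \<open>The product rule for the linear coefficient of \<open>[Suc k]! = [k]! [Suc k]\<close>.
  It is verified after multiplication by 4, which removes the halves hidden in the binomials and in
  \<open>fact_corr\<close>.\<close>

lemma fact_corr_Suc: "fact_corr (Suc k) = fact_corr k * int (Suc k) + fact k * int (Suc k choose 2)"
proof -
  have 1: "2 * fact_corr (Suc k) = fact (Suc k) * int (Suc k choose 2)" by (rule fact_mult_choose_two[symmetric])
  have 2: "2 * fact_corr k = fact k * int (k choose 2)" by (rule fact_mult_choose_two[symmetric])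
  have "2 * (2 * fact_corr (Suc k)) = fact (Suc k) * (2 * int (Suc k choose 2))" unfolding 1 by simp
  also have "\<dots> = fact k * int (Suc k) * (int (Suc k) * int k)" unfolding int_choose_two by simp
  also have "\<dots> = fact k * (int k * (int k - 1)) * int (Suc k) + 2 * (fact k * (int (Suc k) * (int (Suc k) - 1)))"
    by (simp add: algebra_simps)
  also have "\<dots> = 2 * (2 * fact_corr k) * int (Suc k) + 2 * (2 * (fact k * int (Suc k choose 2)))"
    unfolding 2 int_choose_two[symmetric] by simp
  finally show ?thesis by simp
qed

lemma q_fact_linear:
  fixes q :: int
  shows "(q - 1)\<^sup>2 dvd q_fact q k - (fact k + (q - 1) * fact_corr k)"
proof (induction k)
  case 0
  then show ?case by (simp add: q_fact_def fact_corr_def binomial_eq_0)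
next
  case (Suc k)
  let ?z = "q - 1"
  have "q_fact q (Suc k) = q_fact q k * q_int q (Suc k)" by (simp add: q_fact_def)
  moreover have "?z\<^sup>2 dvd q_fact q k * q_int q (Suc k)
      - (fact k + ?z * fact_corr k) * (int (Suc k) + ?z * int (Suc k choose 2))"
    by (rule dvd_diff_mult[OF Suc q_int_linear])
  moreover have "(fact k + ?z * fact_corr k) * (int (Suc k) + ?z * int (Suc k choose 2))
      - (fact (Suc k) + ?z * fact_corr (Suc k)) = ?z\<^sup>2 * (fact_corr k * int (Suc k choose 2))"
    unfolding fact_corr_Suc by (simp add: algebra_simps power2_eq_square)
  ultimately show ?case using dvd_diff_trans dvd_triv_left by metis
qed

text \<open>The Pochhammer symbol in \<open>1 / q\<close> with each factor
  \<open>1 - t / q ^ j\<close> multiplied by \<open>- q ^ j\<close>. It has integer coefficients, so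
  that congruences make sense for it.\<close>

definition shift_prod :: "int \<Rightarrow> nat \<Rightarrow> int poly" where
  "shift_prod q i = (\<Prod>j<i. [:- (q ^ j), 1:])"

text \<open>Each factor is \<open>(t - 1) - j (q - 1)\<close> to first order, and the
  \<open>j < i\<close> add up to \<open>i choose 2\<close>. For \<open>i = 0\<close> the truncated
  exponent belongs to a coefficient zero.\<close>

lemma shift_prod_linear:
  fixes q :: int
  defines "z \<equiv> [:q - 1:]"
  shows "z\<^sup>2 dvd shift_prod q i - (U ^ i - z * (smult (int (i choose 2)) (U ^ (i - 1))))"
proof (induction i)
  case 0
  then show ?case by (simp add: shift_prod_def binomial_eq_0)
next
  case (Suc i)
  let ?C = "int (i choose 2)"
  have z2: "z\<^sup>2 = [:(q - 1)\<^sup>2:]" by (simp add: z_def power2_eq_square)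
  have "(q - 1)\<^sup>2 dvd q ^ i - (1 + int i * (q - 1))" using power_cong_linear by (simp add: cong_iff_dvd_diff)
  then obtain l where l: "q ^ i = 1 + int i * (q - 1) + (q - 1)\<^sup>2 * l" by (metis dvd_def diff_eq_eq add.commute)
  have "[:- (q ^ i), 1:] - (U - z * [:int i:]) = z\<^sup>2 * [:- l:]"
    unfolding z2 by (simp add: l z_def algebra_simps)
  then have f: "z\<^sup>2 dvd [:- (q ^ i), 1:] - (U - z * [:int i:])" by (metis dvd_triv_left)
  have e: "shift_prod q (Suc i) = shift_prod q i * [:- (q ^ i), 1:]" by (simp add: shift_prod_def)
  have "z\<^sup>2 dvd (U ^ i - z * smult ?C (U ^ (i - 1))) * (U - z * [:int i:])
      - (U ^ Suc i - z * smult (int (Suc i choose 2)) (U ^ (Suc i - 1)))"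
  proof -
    define u where "u = U"
    have alg1: "(a - z * b) * (c - z * d) = a * c - z * (a * d) - z * (b * c) + z\<^sup>2 * (b * d)"
      for a b c d :: "int poly" by (simp add: algebra_simps power2_eq_square)
    have alg2: "a - z * b - z * c + e = a - z * (c + b) + e" for a b c e :: "int poly"
      by (simp add: algebra_simps)
    have pw: "smult ?C (u ^ (i - 1)) * u = smult ?C (u ^ i)" by (cases i) (simp_all add: binomial_eq_0 mult.commute)
    have ii: "u ^ i * [:int i:] = smult (int i) (u ^ i)" by simp
    have "(u ^ i - z * smult ?C (u ^ (i - 1))) * (u - z * [:int i:])
        = u ^ i * u - z * (u ^ i * [:int i:]) - z * (smult ?C (u ^ (i - 1)) * u)
          + z\<^sup>2 * (smult ?C (u ^ (i - 1)) * [:int i:])"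
      by (rule alg1)
    also have "\<dots> = (u ^ Suc i - z * smult (int (Suc i choose 2)) (u ^ (Suc i - 1)))
          + z\<^sup>2 * (smult ?C (u ^ (i - 1)) * [:int i:])"
      unfolding pw ii choose_two_Suc smult_add_left power_Suc2 diff_Suc_1 by (rule alg2)
    finally show ?thesis unfolding u_def[symmetric] by (simp only: add_diff_cancel_left' dvd_triv_left)
  qed
  from dvd_diff_trans[OF dvd_diff_mult[OF Suc f] this] show ?case unfolding e .
qed

lemma coeff_shift_prod_rat:
  "Polynomial.coeff (\<Prod>j<i. [:- (of_int q ^ j), 1:] :: rat poly) k = of_int (Polynomial.coeff (shift_prod q i) k)"
proof (induction i arbitrary: k)
  case 0
  then show ?case by (simp add: shift_prod_def)
next
  case (Suc i)
  then show ?case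
    by (cases k) (simp_all add: shift_prod_def mult.commute[of _ "[:_, _:]"])
qed

text \<open>The exponents of the factors \<open>- q ^ j\<close> for \<open>j < i\<close> add up to
  \<open>i choose 2\<close>; this is the share of \<open>q ^ (n choose 2)\<close> that is spent on
  clearing denominators.\<close>

lemma q_pochhammer_eq:
  fixes q :: rat
  assumes "q \<noteq> 0"
  shows "smult (q ^ (i choose 2) * (-1) ^ i) (q_pochhammer [:0, 1:] [:1 / q:] i) = (\<Prod>j<i. [:- (q ^ j), 1:])"
proof (induction i)
  case 0
  then show ?case by (simp add: q_pochhammer_def binomial_eq_0)
next
  case (Suc i)
  have c: "Suc i choose 2 = (i choose 2) + i" by (simp add: numeral_2_eq_2)
  have pc: "[:1 / q:] ^ i = [:(1 / q) ^ i:]" by (induction i) (simp_all add: one_pCons)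
  have f: "smult (q ^ i * (-1)) (1 - [:0, 1:] * [:1 / q:] ^ i) = [:- (q ^ i), 1:]"
    unfolding pc using assms by (simp add: one_pCons power_one_over)
  have "smult (q ^ (Suc i choose 2) * (-1) ^ Suc i) (q_pochhammer [:0, 1:] [:1 / q:] (Suc i))
      = smult (q ^ (i choose 2) * (-1) ^ i) (q_pochhammer [:0, 1:] [:1 / q:] i)
        * smult (q ^ i * (-1)) (1 - [:0, 1:] * [:1 / q:] ^ i)"
    unfolding c q_pochhammer_def prod.lessThan_Suc mult_smult_left mult_smult_right smult_smult power_add power_Suc
    by (simp only: mult_ac)
  then show ?case unfolding f Suc by simp
qed

lemma q_fact_of_int: "q_fact (of_nat q :: rat) k = of_int (q_fact (int q) k)"
  by (simp add: q_fact_def q_int_def)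

lemma choose_two_mono: "i \<le> n \<Longrightarrow> i choose 2 \<le> n choose 2"
  unfolding choose_two by (intro div_le_mono mult_le_mono) auto

text \<open>The definition is brought into the form \<open>\<Sum> c i * shift_prod q i\<close> with
  integers \<open>c i\<close>. Then first order expansions can be multiplied: of the rank counts,
  the \<open>q\<close>-factorials, the remaining power of \<open>q\<close> and the products in
  \<open>t\<close>.\<close>

lemma q_hit_expansion:
  assumes q: "primepow q" and B: "B \<subseteq> cells n n"
  obtains l where "q_hit n n B i q = of_int (int (hit_number n n B i)
    + Polynomial.coeff (hit_corr B {1..n} {1..n} n) i * (int q - 1) + l * (int q - 1)\<^sup>2)"
proof -
  interpret F: finite_field "GF q"
    using GF_field[OF q] by (simp add: finite_field_def finite_field_axioms_def)
  have cardF: "card (carrier (GF q)) = q" by (rule GF_field(3)[OF q])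
  define J where "J = {1..n}"
  have fin: "finite J" "finite J" and card: "card J = n" "card J = n" by (simp_all add: J_def)
  define z where "z = int q - 1"
  have z0: "z \<noteq> 0" using F.q_gt_1 by (simp add: z_def cardF)
  define r s where "r i = int (rook B J J i)" and "s i = Polynomial.coeff (rook_corr B J J) i" for i
  have "\<forall>i. \<exists>k. int (rank_num (GF q) B J J i) = z ^ i * (r i + z * s i + z\<^sup>2 * k)"
  proof
    fix i
    have "z ^ (i + 2) dvd int (rank_num (GF q) B J J i) - z ^ i * (r i + z * s i)"
      using F.rank_num_cong[OF fin, of B i] fin
      by (simp add: cong_iff_dvd_diff cardF z_def r_def s_def coeff_rook_poly)
    then obtain k where "int (rank_num (GF q) B J J i) - z ^ i * (r i + z * s i) = z ^ (i + 2) * k" by blast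
    then show "\<exists>k. int (rank_num (GF q) B J J i) = z ^ i * (r i + z * s i + z\<^sup>2 * k)"
      by (intro exI[of _ k]) (simp add: power_add power2_eq_square algebra_simps)
  qed
  then obtain K where K: "int (rank_num (GF q) B J J i) = z ^ i * (r i + z * s i + z\<^sup>2 * K i)" for i by metis
  define M where "M i = r i + z * s i + z\<^sup>2 * K i" for i
  have rookM: "q_rook n n B i q = of_int (M i)" for i
  proof -
    have "rat_of_nat (rank_num (GF q) B J J i) = of_int z ^ i * of_int (M i)"
      unfolding M_def by (metis K of_int_mult of_int_of_nat_eq of_int_power)
    moreover have "rat_of_nat q - 1 = of_int z" by (simp add: z_def)
    ultimately show ?thesis
      using z0 unfolding q_rook_def rank_count_eq_rank_num[OF q] J_def[symmetric] by simp
  qed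
  define c where "c i = M i * q_fact (int q) (n - i) * int q ^ ((n choose 2) - (i choose 2))" for i
  define HI where "HI = (\<Sum>i\<le>n. smult (c i) (shift_prod (int q) i))"
  have q0: "rat_of_nat q \<noteq> 0" using F.q_gt_1 by (simp add: cardF)
  have "q_hit n n B i q = of_int (Polynomial.coeff HI i)"
  proof -
    have "smult (of_nat q ^ (n choose 2)) (smult (of_int (M i) * (q_fact (of_nat q) (n - i) / q_fact (of_nat q) (n - n)) * (-1) ^ i)
          (q_pochhammer [:0, 1:] [:1 / of_nat q:] i))
        = smult (of_int (c i)) (\<Prod>j<i. [:- (of_int (int q) ^ j), 1:] :: rat poly)" if "i \<le> n" for i
    proof -
      have e: "rat_of_nat q ^ (n choose 2) = of_nat q ^ ((n choose 2) - (i choose 2)) * of_nat q ^ (i choose 2)"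
        using choose_two_mono[OF that] by (simp flip: power_add)
      have "q_fact (of_nat q :: rat) (n - n) = 1" by (simp add: q_fact_def)
      then show ?thesis
        unfolding of_int_of_nat_eq q_pochhammer_eq[OF q0, symmetric] smult_smult e c_def
        by (simp add: q_fact_of_int mult_ac)
    qed
    moreover have sms: "smult a (\<Sum>i\<in>A. f i) = (\<Sum>i\<in>A. smult a (f i))"
      for a :: rat and A :: "nat set" and f by (intro poly_eqI) (simp add: coeff_sum sum_distrib_left)
    ultimately have "q_hit_poly n n B q = (\<Sum>i\<le>n. smult (of_int (c i)) (\<Prod>j<i. [:- (of_int (int q) ^ j), 1:]))"
      unfolding q_hit_poly_def rookM sms by (intro sum.cong refl) auto
    then show ?thesis
      unfolding q_hit_def HI_def by (simp add: coeff_sum coeff_shift_prod_rat del: of_int_of_nat_eq)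
  qed
  moreover have "[:z:]\<^sup>2 dvd HI - (hit_poly B J J + [:z:] * hit_corr B J J n)"
  proof -
    define e where "e i = int (n choose 2) - int (i choose 2)" for i
    \<comment> \<open>Constant and linear coefficient of \<open>c i\<close>; the three summands of
      \<open>c1\<close> take the linear part from the rook number, the factorial and the power of
      \<open>q\<close> in turn.\<close>
    define c0 c1 where "c0 i = r i * fact (n - i)"
      and "c1 i = s i * fact (n - i) + r i * fact_corr (n - i) + r i * fact (n - i) * e i" for i
    have cz: "z\<^sup>2 dvd c i - (c0 i + z * c1 i)" if "i \<le> n" for i
    proof -
      have 1: "z\<^sup>2 dvd M i - (r i + z * s i)" by (simp add: M_def)
      have 2: "z\<^sup>2 dvd q_fact (int q) (n - i) - (fact (n - i) + z * fact_corr (n - i))"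
        unfolding z_def by (rule q_fact_linear)
      have 3: "z\<^sup>2 dvd int q ^ ((n choose 2) - (i choose 2)) - (1 + z * e i)"
        using power_cong_linear[of "int q" "(n choose 2) - (i choose 2)"] choose_two_mono[OF that]
        by (simp add: cong_iff_dvd_diff z_def e_def of_nat_diff mult.commute)
      have 4: "z\<^sup>2 dvd (r i + z * s i) * (fact (n - i) + z * fact_corr (n - i)) * (1 + z * e i) - (c0 i + z * c1 i)"
      proof -
        have "(r i + z * s i) * (f + z * g) * (1 + z * e i) - (r i * f + z * (s i * f + r i * g + r i * f * e i))
            = z\<^sup>2 * (s i * g + s i * f * e i + r i * g * e i + z * s i * g * e i)" for f g
          by (simp add: algebra_simps power2_eq_square)
        then show ?thesis unfolding c0_def c1_def by (metis dvd_triv_left)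
      qed
      show ?thesis unfolding c_def
        by (rule dvd_diff_trans[OF dvd_diff_mult[OF dvd_diff_mult[OF 1 2] 3] 4])
    qed
    let ?t = "\<lambda>i. smult (c0 i) (U ^ i) + [:z:] * (smult (c1 i) (U ^ i) - smult (c0 i * int (i choose 2)) (U ^ (i - 1)))"
    have "[:z:]\<^sup>2 dvd smult (c i) (shift_prod (int q) i) - ?t i" if i: "i \<le> n" for i
    proof -
      obtain k where k: "c i - (c0 i + z * c1 i) = z\<^sup>2 * k" using cz[OF i] by blast
      have "[:c i:] - ([:c0 i:] + [:z:] * [:c1 i:]) = [:z:]\<^sup>2 * [:k:]"
        using k by (simp add: power2_eq_square mult_ac)
      then have 1: "[:z:]\<^sup>2 dvd [:c i:] - ([:c0 i:] + [:z:] * [:c1 i:])" by (metis dvd_triv_left)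
      have 2: "[:z:]\<^sup>2 dvd shift_prod (int q) i - (U ^ i - [:z:] * smult (int (i choose 2)) (U ^ (i - 1)))"
        unfolding z_def by (rule shift_prod_linear)
      have "(a + y * b) * (v - y * w) - (a * v + y * (b * v - a * w)) = y\<^sup>2 * (- (b * w))" for a b v w y :: "int poly"
        by (simp add: algebra_simps power2_eq_square)
      then have 3: "[:z:]\<^sup>2 dvd ([:c0 i:] + [:z:] * [:c1 i:]) * (U ^ i - [:z:] * smult (int (i choose 2)) (U ^ (i - 1)))
          - ([:c0 i:] * U ^ i + [:z:] * ([:c1 i:] * U ^ i - [:c0 i:] * smult (int (i choose 2)) (U ^ (i - 1))))"
        by (metis dvd_triv_left)
      have sm: "[:a:] * p = smult a p" for a and p :: "int poly" by simp
      show ?thesis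
        using dvd_diff_trans[OF dvd_diff_mult[OF 1 2] 3]
        unfolding sm[of "c i"] sm[of "c0 i"] sm[of "c1 i"] smult_smult .
    qed
    then have "[:z:]\<^sup>2 dvd (\<Sum>i\<le>n. smult (c i) (shift_prod (int q) i) - ?t i)" by (intro dvd_sum) auto
    moreover have "(\<Sum>i\<le>n. ?t i) = hit_poly B J J + [:z:] * hit_corr B J J n"
    proof -
      have "hit_poly B J J = (\<Sum>i\<le>n. smult (c0 i) (U ^ i))"
        using fin unfolding hit_poly_eq_rook_to_hit[OF fin card] rook_to_hit_def c0_def r_def
        by (simp add: coeff_rook_poly)
      moreover have "hit_corr B J J n = (\<Sum>i\<le>n. smult (c1 i) (U ^ i) - smult (c0 i * int (i choose 2)) (U ^ (i - 1)))"
        unfolding hit_corr_def[OF fin card] c1_def c0_def s_def r_def e_def smult_add_left ..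
      ultimately show ?thesis unfolding sum.distrib sum_distrib_left[symmetric] by simp
    qed
    ultimately show ?thesis unfolding HI_def sum_subtractf by simp
  qed
  then obtain L where L: "HI - (hit_poly B J J + [:z:] * hit_corr B J J n) = [:z:]\<^sup>2 * L" by blast
  have "Polynomial.coeff HI i = Polynomial.coeff (hit_poly B J J + [:z:] * hit_corr B J J n + [:z:]\<^sup>2 * L) i"
    using L by (metis add.commute diff_add_cancel)
  then have "Polynomial.coeff HI i = Polynomial.coeff (hit_poly B J J) i
      + Polynomial.coeff (hit_corr B J J n) i * z + Polynomial.coeff L i * z\<^sup>2"
    by (simp add: power2_eq_square)
  ultimately show thesis
    using that[of "Polynomial.coeff L i"] hit_number_eq_coeff[OF B, of i] unfolding z_def J_def by simp
qed

text \<open>For \<open>q = 2 ^ k\<close> with \<open>k\<close> large the square exceeds the absolute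
  value of the linear expression, which must then be zero. Two consecutive exponents determine
  \<open>a\<close> and \<open>b\<close>.\<close>

lemma linear_dvd_square_imp_zero:
  fixes a b :: int
  assumes "\<And>q :: nat. primepow q \<Longrightarrow> (int q - 1)\<^sup>2 dvd a + b * (int q - 1)"
  shows "a = 0 \<and> b = 0"
proof -
  have van: "a + b * (2 ^ k - 1) = 0" if k: "k \<ge> nat (\<bar>a\<bar> + \<bar>b\<bar>) + 2" for k
  proof (rule ccontr)
    assume nz: "a + b * (2 ^ k - 1) \<noteq> 0"
    define y where "y = (2 ^ k - 1 :: int)"
    have "primepow ((2 :: nat) ^ k)" using k by simp
    from assms[OF this] have "y\<^sup>2 dvd a + b * y" by (simp add: y_def)
    then have "y\<^sup>2 \<le> \<bar>a + b * y\<bar>" using nz unfolding y_def[symmetric] by (metis abs_power2 dvd_imp_le_int)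
    also have "\<dots> \<le> \<bar>a\<bar> + \<bar>b\<bar> * \<bar>y\<bar>" by (metis abs_mult abs_triangle_ineq)
    finally have le: "y\<^sup>2 \<le> \<bar>a\<bar> + \<bar>b\<bar> * \<bar>y\<bar>" .
    have "int k < 2 ^ k" by (rule of_nat_less_two_power)
    then have y: "y > \<bar>a\<bar> + \<bar>b\<bar>" "y > 1" unfolding y_def using k by linarith+
    have "\<bar>a\<bar> + \<bar>b\<bar> * \<bar>y\<bar> \<le> (\<bar>a\<bar> + \<bar>b\<bar>) * y" using y(2) by (simp add: distrib_right mult_le_cancel_left1)
    also have "\<dots> < y * y" using y by (intro mult_strict_right_mono) auto
    finally show False using le by (simp add: power2_eq_square)
  qed
  let ?k = "nat (\<bar>a\<bar> + \<bar>b\<bar>) + 2"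
  have 1: "a + b * (2 ^ ?k - 1) = 0" and 2: "a + b * (2 ^ Suc ?k - 1) = 0" by (rule van; simp)+
  have "b * 2 ^ ?k = (a + b * (2 ^ Suc ?k - 1)) - (a + b * (2 ^ ?k - 1))" by (simp add: algebra_simps)
  then have "b = 0" unfolding 1 2 by simp
  then show ?thesis using 1 by simp
qed

theorem theorem4p11:
  fixes n i :: nat and B :: "(nat \<times> nat) set"
  assumes "n \<ge> 1" and "B \<subseteq> cells n n" and "i \<le> n"
  shows "polynomial_modulo shifted_primepows 2 (\<lambda>x. q_hit n n B i (nat (x + 1)))
    \<and> modulo_coeff shifted_primepows 2 (\<lambda>x. q_hit n n B i (nat (x + 1))) 1 \<ge> 0
    \<and> (\<exists>!C::int. \<forall>q. primepow q \<longrightarrow>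
          rat_cong (q_hit n n B i q) (of_int (C * (int q - 1) + int (hit_number n n B i)))
            ((int q - 1) ^ 2))
    \<and> (\<forall>C::int. (\<forall>q. primepow q \<longrightarrow>
          rat_cong (q_hit n n B i q) (of_int (C * (int q - 1) + int (hit_number n n B i)))
            ((int q - 1) ^ 2))
        \<longrightarrow> C \<ge> 0)"
proof -
  define C where "C = Polynomial.coeff (hit_corr B {1..n} {1..n} n) i"
  define h where "h = int (hit_number n n B i)"
  let ?f = "\<lambda>x. q_hit n n B i (nat (x + 1))"
  have C0: "C \<ge> 0" unfolding C_def by (rule hit_corr_nonneg) auto
  have exp: "\<exists>l. q_hit n n B i q = of_int (h + C * (int q - 1) + l * (int q - 1)\<^sup>2)" if "primepow q" for q :: nat
    using q_hit_expansion[OF that assms(2), of i] unfolding C_def h_def by metis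
  \<comment> \<open>The constant term is left open, so that this yields both the uniqueness of the
    representing polynomial and that of \<open>C\<close>.\<close>
  have uniq: "a = h \<and> b = C"
    if asm: "\<And>q :: nat. primepow q \<Longrightarrow> rat_cong (q_hit n n B i q) (of_int (a + b * (int q - 1))) ((int q - 1)\<^sup>2)" for a b
  proof -
    have "h - a = 0 \<and> C - b = 0"
    proof (rule linear_dvd_square_imp_zero)
      fix q :: nat assume q: "primepow q"
      obtain l where l: "q_hit n n B i q = of_int (h + C * (int q - 1) + l * (int q - 1)\<^sup>2)" using exp[OF q] by blast
      obtain k where k: "q_hit n n B i q - of_int (a + b * (int q - 1)) = of_int (k * (int q - 1)\<^sup>2)"
        using asm[OF q] unfolding rat_cong_def by blast
      have "rat_of_int (h + C * (int q - 1) + l * (int q - 1)\<^sup>2 - (a + b * (int q - 1))) = of_int (k * (int q - 1)\<^sup>2)"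
        using k unfolding l by (simp only: of_int_diff)
      then have "h + C * (int q - 1) + l * (int q - 1)\<^sup>2 - (a + b * (int q - 1)) = k * (int q - 1)\<^sup>2"
        by (simp only: of_int_eq_iff)
      then have "h - a + (C - b) * (int q - 1) = (int q - 1)\<^sup>2 * (k - l)" by (simp add: algebra_simps)
      then show "(int q - 1)\<^sup>2 dvd h - a + (C - b) * (int q - 1)" by simp
    qed
    then show ?thesis by simp
  qed
  have congC: "rat_cong (q_hit n n B i q) (of_int (C * (int q - 1) + h)) ((int q - 1)\<^sup>2)" if "primepow q" for q :: nat
  proof -
    obtain l where l: "q_hit n n B i q = of_int (h + C * (int q - 1) + l * (int q - 1)\<^sup>2)" using exp[OF \<open>primepow q\<close>] by blast
    show ?thesis unfolding rat_cong_def l by (intro exI[of _ l]) simp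
  qed
  have sym: "rat_cong a b d \<Longrightarrow> rat_cong b a d" for a b d
    unfolding rat_cong_def by (metis minus_diff_eq minus_mult_left of_int_minus)
  have rep: "represents_modulo shifted_primepows 2 ?f [:h, C:]"
    unfolding represents_modulo_def
  proof (intro conjI ballI)
    fix x assume "x \<in> shifted_primepows"
    then obtain q where q: "primepow q" "x = int q - 1" by (auto simp: shifted_primepows_def)
    show "rat_cong (of_int (poly [:h, C:] x)) (?f x) (x\<^sup>2)"
      using sym[OF congC[OF q(1)]] unfolding q(2) by (simp add: algebra_simps)
  qed simp
  have rep_uniq: "P = [:h, C:]" if P: "represents_modulo shifted_primepows 2 ?f P" for P
  proof -
    have deg: "Polynomial.degree P \<le> 1" using P by (simp add: represents_modulo_def)
    define a b where "a = Polynomial.coeff P 0" and "b = Polynomial.coeff P 1"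
    have ab: "P = [:a, b:]"
    proof (rule poly_eqI)
      fix k show "Polynomial.coeff P k = Polynomial.coeff [:a, b:] k"
        using deg by (auto simp: a_def b_def coeff_pCons coeff_eq_0 split: nat.split)
    qed
    have "rat_cong (q_hit n n B i q) (of_int (a + b * (int q - 1))) ((int q - 1)\<^sup>2)" if "primepow q" for q :: nat
    proof -
      have "int q - 1 \<in> shifted_primepows" using that by (auto simp: shifted_primepows_def)
      then have "rat_cong (of_int (poly P (int q - 1))) (?f (int q - 1)) ((int q - 1)\<^sup>2)"
        using P by (simp only: represents_modulo_def)
      from sym[OF this] show ?thesis by (simp add: ab algebra_simps)
    qed
    from uniq[OF this] show ?thesis by (simp add: ab)
  qed
  have "polynomial_modulo shifted_primepows 2 ?f" using rep unfolding polynomial_modulo_def by blast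
  moreover have "modulo_coeff shifted_primepows 2 ?f 1 \<ge> 0"
  proof -
    have "(THE P. represents_modulo shifted_primepows 2 ?f P) = [:h, C:]" using rep rep_uniq by (rule the_equality)
    then show ?thesis unfolding modulo_coeff_def using C0 by simp
  qed
  moreover have eqC: "C' = C"
    if "\<forall>q. primepow q \<longrightarrow> rat_cong (q_hit n n B i q) (of_int (C' * (int q - 1) + h)) ((int q - 1) ^ 2)" for C'
    using uniq[of h C'] that by (simp add: add.commute)
  moreover have "\<exists>!C'::int. \<forall>q. primepow q \<longrightarrow> rat_cong (q_hit n n B i q) (of_int (C' * (int q - 1) + h)) ((int q - 1) ^ 2)"
    using congC eqC by blast
  ultimately show ?thesis using C0 unfolding h_def by blast
qed

end
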